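(* Let $a\ge 0$ and $k\in\mathbb N$, $k\ge 1$. Let $\Omega^\star\subset\mathbb R^{k+1}=\mathbb R_r\times\mathbb R^k_y$ be a bounded, connected open set, symmetric with respect to the hyperplane $\{r=0\}$, and assume that $\Omega^\star$ is piecewise $C^1$ (i.e. has piecewise $C^1$ boundary). Then the overdetermined problem $$L_a u=-1\ \text{ in }\Omega^\star\setminus\{r=0\},\qquad u=0\ \text{ on }\partial\Omega^\star,\qquad |\nabla u|=c\ \text{ on }\partial\Omega^\star,$$ with $c$ a constant, admits a solution $u\in C^2(\Omega^\star\setminus\{r=0\})\cap C^1(\overline{\Omega^\star})$ if and only if for some $R>0$ and $y_0\in\mathbb R^k$ one has $$\Omega^\star=B_R((0,y_0))=\{(r,y)\in\mathbb R^{k+1}\mid r^2+|y-y_0|^2<R^2\},$$ and $$u(r,y)=\frac{R^2-r^2-|y-y_0|^2}{2(a+1+k)}.$$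
   Context: Points of $\mathbb R^{k+1}$ are written $(r,y)$ with $r\in\mathbb R$, $y\in\mathbb R^k$. For $a\ge 0$ the Weinstein operator is $$L_a u=\partial_{rr}u+\frac ar\,\partial_r u+\Delta_y u,\qquad r\neq 0,$$ where $\Delta_y$ is the Laplacian in the variables $y\in\mathbb R^k$. $\nabla$ is the full Euclidean gradient in $\mathbb R^{k+1}$. Symmetry with respect to $\{r=0\}$ means $(r,y)\in\Omega^\star\iff(-r,y)\in\Omega^\star$. *)

theory Defs
  imports "HOL-Analysis.Analysis"
begin

definition C1_grad_on :: "'a::real_inner set \<Rightarrow> ('a \<Rightarrow> real) \<Rightarrow> ('a \<Rightarrow> 'a) \<Rightarrow> bool" where
  "C1_grad_on U f G \<longleftrightarrow> (\<forall>x\<in>U. GDERIV f x :> G x) \<and> continuous_on U G"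

text \<open>For open \<open>\<Omega>\<close>, the function \<open>u\<close> is of class \<open>C\<^sup>1\<close> on the closure if \<open>u\<close> and its
  gradient in \<open>\<Omega>\<close> extend continuously to the closure. The extension \<open>G\<close> of the gradient
  is unique on the closure, and its values on the frontier are the meaning of the gradient there.\<close>

definition C1_closure_grad :: "'a::real_inner set \<Rightarrow> ('a \<Rightarrow> real) \<Rightarrow> ('a \<Rightarrow> 'a) \<Rightarrow> bool" where
  "C1_closure_grad \<Omega> u G \<longleftrightarrow>
     continuous_on (closure \<Omega>) u \<and> continuous_on (closure \<Omega>) G \<and> (\<forall>x\<in>\<Omega>. GDERIV u x :> G x)"

definition C2_on :: "'a::real_inner set \<Rightarrow> ('a \<Rightarrow> real) \<Rightarrow> bool" where
  "C2_on U f \<longleftrightarrow>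
     (\<exists>G (H :: 'a \<Rightarrow> 'a \<Rightarrow>\<^sub>L 'a). C1_grad_on U f G \<and>
        (\<forall>x\<in>U. (G has_derivative blinfun_apply (H x)) (at x)) \<and> continuous_on U H)"

text \<open>The set \<open>\<Omega>\<close> has a \<open>C\<^sup>1\<close> boundary near \<open>p\<close> and lies on one side of it. Since the gradient of
  \<open>g\<close> does not vanish, the frontier of \<open>\<Omega>\<close> in \<open>U\<close> is exactly the zero set of \<open>g\<close>.\<close>

definition C1_boundary_point :: "'a::euclidean_space set \<Rightarrow> 'a \<Rightarrow> bool" where
  "C1_boundary_point \<Omega> p \<longleftrightarrow> p \<in> frontier \<Omega> \<and>
     (\<exists>U g G. open U \<and> p \<in> U \<and> C1_grad_on U g G \<and> (\<forall>x\<in>U. G x \<noteq> 0) \<and>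
        \<Omega> \<inter> U = {x\<in>U. g x < 0})"

text \<open>A compact piece of an embedded \<open>C\<^sup>1\<close> hypersurface.\<close>

definition C1_piece :: "'a::euclidean_space set \<Rightarrow> bool" where
  "C1_piece S \<longleftrightarrow> compact S \<and>
     (\<exists>U g G. open U \<and> S \<subseteq> U \<and> C1_grad_on U g G \<and> (\<forall>x\<in>U. G x \<noteq> 0) \<and> (\<forall>x\<in>S. g x = 0))"

text \<open>For \<open>m \<ge> 1\<close> this says that the \<open>m\<close>-dimensional Hausdorff measure of \<open>N\<close> is zero: a small sum
  forces all radii to be small, so no separate bound on them is needed.\<close>

definition hausdorff_null :: "nat \<Rightarrow> 'a::metric_space set \<Rightarrow> bool" where
  "hausdorff_null m N \<longleftrightarrow>
     (\<forall>e>0. \<exists>(p :: nat \<Rightarrow> 'a) \<rho>. (\<forall>i. 0 < \<rho> i) \<and> N \<subseteq> (\<Union>i. ball (p i) (\<rho> i)) \<and>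
        summable (\<lambda>i. \<rho> i ^ m) \<and> (\<Sum>i. \<rho> i ^ m) < e)"

text \<open>The frontier consists of finitely many compact pieces of \<open>C\<^sup>1\<close> hypersurfaces; the points at
  which it is not a \<open>C\<^sup>1\<close> boundary with \<open>\<Omega>\<close> on one side (edges, corners, cusps) have vanishing
  surface measure, and the remaining points are dense in the frontier (so that, for instance,
  isolated frontier points are excluded).\<close>

definition piecewise_C1_boundary :: "'a::euclidean_space set \<Rightarrow> bool" where
  "piecewise_C1_boundary \<Omega> \<longleftrightarrow>
     (\<exists>\<S>. finite \<S> \<and> (\<forall>S\<in>\<S>. C1_piece S) \<and> frontier \<Omega> = \<Union>\<S>) \<and>
     hausdorff_null (DIM('a) - 1) {p \<in> frontier \<Omega>. \<not> C1_boundary_point \<Omega> p} \<and>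
     frontier \<Omega> \<subseteq> closure {p. C1_boundary_point \<Omega> p}"

definition dir_deriv :: "'a::real_normed_vector \<Rightarrow> ('a \<Rightarrow> real) \<Rightarrow> 'a \<Rightarrow> real" where
  "dir_deriv v f x = deriv (\<lambda>t. f (x + t *\<^sub>R v)) 0"

text \<open>Meaningful only at points \<open>(r, y)\<close> with \<open>r \<noteq> 0\<close>.\<close>

definition weinstein :: "real \<Rightarrow> (real \<times> (real^'k) \<Rightarrow> real) \<Rightarrow> real \<times> (real^'k) \<Rightarrow> real" where
  "weinstein a u x =
     dir_deriv (1, 0) (dir_deriv (1, 0) u) x + a / fst x * dir_deriv (1, 0) u x +
     (\<Sum>i\<in>UNIV. dir_deriv (0, axis i 1) (dir_deriv (0, axis i 1) u) x)"

end

theory Submission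
  imports Defs
begin

text \<open>
With the weight \<open>w = \<bar>r\<bar>\<^sup>a\<close> the equation reads \<open>div (w \<nabla>u) = - w\<close>, and since \<open>\<nabla>u\<close> is continuous, the flux
\<open>w \<partial>\<^sub>r u\<close> does not jump at \<open>r = 0\<close>. So integration by parts works in all of \<open>\<Omega>\<close>, as for the Laplacian in
dimension \<open>N = a + 1 + k\<close>, and a weighted form of Weinberger's argument for Serrin's problem applies.

Put \<open>q = u + \<bar>x\<bar>\<^sup>2 / (2 N)\<close> and \<open>Q = \<nabla>q\<close>, so that \<open>L\<^sub>a q = 0\<close>, and Bochner's formula gives
\<open>L\<^sub>a \<bar>Q\<bar>\<^sup>2 / 2 = \<bar>D\<^sup>2 q\<bar>\<^sup>2 + a Q\<^sub>r\<^sup>2 / r\<^sup>2\<close>. Green's identity with the positive function \<open>u\<close> turns the integral of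
\<open>w u\<close> times twice the right-hand side into the integral of \<open>- w \<bar>Q\<bar>\<^sup>2\<close> minus the flux of \<open>w \<bar>Q\<bar>\<^sup>2 \<nabla>u\<close>
through the boundary. The field \<open>(c\<^sup>2 - \<bar>\<nabla>u\<bar>\<^sup>2) Q + \<bar>Q\<bar>\<^sup>2 \<nabla>u - (2 / N) u Q\<close> agrees with \<open>\<bar>Q\<bar>\<^sup>2 \<nabla>u\<close> on the boundary and
has weighted divergence \<open>- \<bar>Q\<bar>\<^sup>2\<close>; so the two terms cancel. Hence \<open>D\<^sup>2 q = 0\<close>, \<open>q\<close> is affine, \<open>u\<close> is a
quadratic polynomial, and its positivity set is a ball.

Three points need care. First, the boundary is approached through the level sets of \<open>u\<close>: fields are
multiplied by cutoff functions of \<open>u\<close>, and the boundary terms become integrals over the layers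
\<open>e \<le> u \<le> 2 e\<close>, which \<open>key_identity\<close>, \<open>mass_identity\<close> and \<open>total_small\<close> evaluate in the limit. This uses
\<open>u > 0\<close> (\<open>minimum_principle\<close>, \<open>u_pos\<close>).

Second, \<open>u\<close> is only \<open>C\<^sup>2\<close> off the hyperplane, whereas Bochner's formula contains third derivatives.
Difference quotients replace them (\<open>directional_inequality\<close>); in the limit only inequalities survive, and
these suffice because the terms that are lost are nonnegative.

Third, the second derivatives may be unbounded near \<open>r = 0\<close>. The divergence theorem
(\<open>divergence_planes\<close>) therefore assumes only that the field is continuous across the hyperplane and that its
divergence is bounded. In the radial direction, for \<open>a > 0\<close>, \<open>\<partial>\<^sub>r u\<close> vanishes on the hyperplane
(\<open>radial_derivative_zero\<close>), so that the truncations of \<open>Q\<^sub>r\<^sup>2\<close> in \<open>radial_inequality_truncated\<close> live away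
from it.
\<close>

section \<open>Explicit cutoff functions\<close>

definition pos_part :: "real \<Rightarrow> real" where "pos_part t = max 0 t"

lemma pos_part_power_deriv:
  "((\<lambda>t. pos_part t ^ (n+2)) has_real_derivative real (n+2) * pos_part t ^ (n+1)) (at t)"
proof (cases t "0::real" rule: linorder_cases)
  case less
  have d: "((\<lambda>t. 0) has_real_derivative 0) (at t)" by simp
  have "eventually (\<lambda>s. s < (0::real)) (nhds t)"
    using less by (intro order_tendstoD(2)[OF filterlim_ident]) auto
  hence e: "eventually (\<lambda>s. pos_part s ^ (n+2) = 0) (nhds t)"
    by eventually_elim (auto simp: pos_part_def)
  show ?thesis using d less DERIV_cong_ev[OF refl e refl] by (simp add: pos_part_def)
next
  case greater
  have d: "((\<lambda>t. t ^ (n+2)) has_real_derivative real (n+2) * t ^ (n+1)) (at t)"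
    using DERIV_pow[of "n+2" t] by simp
  have "eventually (\<lambda>s. s > (0::real)) (nhds t)"
    using greater by (intro order_tendstoD(1)[OF filterlim_ident]) auto
  hence e: "eventually (\<lambda>s. pos_part s ^ (n+2) = s ^ (n+2)) (nhds t)"
    by eventually_elim (auto simp: pos_part_def)
  show ?thesis using d greater DERIV_cong_ev[OF refl e refl] by (simp add: pos_part_def)
next
  case equal
  have "((\<lambda>h. pos_part h ^ (n+2) / h) \<longlongrightarrow> 0) (at 0)"
  proof (rule Lim_null_comparison[where g="\<lambda>h. \<bar>h\<bar> ^ (n+1)"])
    show "\<forall>\<^sub>F x in at 0. norm (pos_part x ^ (n + 2) / x) \<le> \<bar>x\<bar> ^ (n + 1)"
    proof (intro always_eventually allI)
      fix x :: real
      show "norm (pos_part x ^ (n + 2) / x) \<le> \<bar>x\<bar> ^ (n + 1)"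
        by (cases "x \<ge> 0") (auto simp: pos_part_def max_def abs_if intro: mult_nonpos_nonneg)
    qed
    show "((\<lambda>h::real. \<bar>h\<bar> ^ (n + 1)) \<longlongrightarrow> 0) (at 0)"
      by (auto intro!: tendsto_eq_intros)
  qed
  thus ?thesis using equal by (simp add: DERIV_def pos_part_def)
qed

text \<open>The cutoffs are built from truncated powers because these have explicit derivatives. On \<open>[0, 1]\<close>
the bump is \<open>6 s (1 - s)\<close>, which is symmetric about \<open>1/2\<close> and has integral \<open>1\<close>; the other two
functions are its successive antiderivatives that vanish on the negative half-line.\<close>

definition bump :: "real \<Rightarrow> real" where
  "bump s = 6 * pos_part s - 6 * pos_part s ^ 2 + 6 * pos_part (s - 1) ^ 2 + 6 * pos_part (s - 1)"
definition step :: "real \<Rightarrow> real" where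
  "step s = 3 * pos_part s ^ 2 - 2 * pos_part s ^ 3 + 2 * pos_part (s - 1) ^ 3 + 3 * pos_part (s - 1) ^ 2"
definition ramp :: "real \<Rightarrow> real" where
  "ramp s = pos_part s ^ 3 - pos_part s ^ 4 / 2 + pos_part (s - 1) ^ 4 / 2 + pos_part (s - 1) ^ 3"

lemma pos_part_power_deriv2: "(g has_real_derivative D) (at t) \<Longrightarrow>
   ((\<lambda>t. pos_part (g t) ^ 2) has_real_derivative 2 * pos_part (g t) * D) (at t)"
  using DERIV_chain2[where f="\<lambda>t. pos_part t ^ (0+2)" and g=g and x=t and s=UNIV, OF pos_part_power_deriv[of 0 "g t"], of D] by (simp add: power2_eq_square)
lemma pos_part_power_deriv3: "(g has_real_derivative D) (at t) \<Longrightarrow>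
   ((\<lambda>t. pos_part (g t) ^ 3) has_real_derivative 3 * pos_part (g t)^2 * D) (at t)"
  using DERIV_chain2[where f="\<lambda>t. pos_part t ^ (1+2)" and g=g and x=t and s=UNIV, OF pos_part_power_deriv[of 1 "g t"], of D] by (simp add: numeral_eq_Suc)
lemma pos_part_power_deriv4: "(g has_real_derivative D) (at t) \<Longrightarrow>
   ((\<lambda>t. pos_part (g t) ^ 4) has_real_derivative 4 * pos_part (g t)^3 * D) (at t)"
  using DERIV_chain2[where f="\<lambda>t. pos_part t ^ (2+2)" and g=g and x=t and s=UNIV, OF pos_part_power_deriv[of 2 "g t"], of D] by (simp add: numeral_eq_Suc)

lemma step_deriv: "(step has_real_derivative bump s) (at s)"
  unfolding step_def[abs_def] bump_def
  by (rule pos_part_power_deriv2 pos_part_power_deriv3 derivative_eq_intros refl)+ (auto simp: algebra_simps)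

lemma ramp_deriv: "(ramp has_real_derivative step s) (at s)"
  unfolding ramp_def[abs_def] step_def
  by (rule DERIV_add DERIV_diff DERIV_cdivide pos_part_power_deriv3 pos_part_power_deriv4 derivative_eq_intros refl)+
    (auto simp: algebra_simps)

lemma bump_eq: "bump s = max 0 (6 * s * (1 - s))"
proof -
  consider "s \<le> 0" | "0 < s" "s \<le> 1" | "1 < s" by linarith
  thus ?thesis
  proof cases
    case 1
    have "s * (1 - s) \<le> 0" using 1 by (auto intro: mult_nonpos_nonneg)
    thus ?thesis using 1 by (auto simp: bump_def pos_part_def max_def algebra_simps)
  next
    case 2
    have "s * (1 - s) \<ge> 0" using 2 by auto
    thus ?thesis using 2 by (auto simp: bump_def pos_part_def max_def algebra_simps power2_eq_square)
  next
    case 3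
    have "s * (1 - s) \<le> 0" using 3 by (auto intro: mult_nonneg_nonpos)
    thus ?thesis using 3 by (auto simp: bump_def pos_part_def max_def algebra_simps power2_eq_square)
  qed
qed

lemma bump_nonneg: "bump s \<ge> 0" by (simp add: bump_eq)
lemma bump_zero: "s \<le> 0 \<or> s \<ge> 1 \<Longrightarrow> bump s = 0"
  by (auto simp: bump_def pos_part_def algebra_simps power2_eq_square)
lemma bump_le: "bump s \<le> 2"
proof -
  have "0 \<le> (s - 1/2)^2" by simp
  thus ?thesis by (simp add: bump_eq power2_eq_square algebra_simps)
qed
lemma bump_sym: "bump (1 - s) = bump s" by (simp add: bump_eq algebra_simps)

lemma step_mono: "s \<le> t \<Longrightarrow> step s \<le> step t"
  by (rule DERIV_nonneg_imp_nondecreasing[of s t]) (use step_deriv bump_nonneg in blast)+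
lemma step_0: "s \<le> 0 \<Longrightarrow> step s = 0" by (auto simp: step_def pos_part_def)
lemma step_1: "s \<ge> 1 \<Longrightarrow> step s = 1"
  by (auto simp: step_def pos_part_def max_def algebra_simps power2_eq_square power3_eq_cube)
lemma step_nonneg: "step s \<ge> 0"
  using step_mono[of "min s 0" s] step_0[of "min s 0"] by auto
lemma step_le: "step s \<le> 1"
  using step_mono[of s "max s 1"] step_1[of "max s 1"] by auto

lemma ramp_0: "s \<le> 0 \<Longrightarrow> ramp s = 0" by (auto simp: ramp_def pos_part_def)
lemma ramp_nonneg: "ramp s \<ge> 0"
  using DERIV_nonneg_imp_nondecreasing[of "min s 0" s ramp] ramp_deriv step_nonneg ramp_0[of "min s 0"]
  by fastforce
lemma ramp_ge: "ramp s \<ge> s - 1"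
proof (cases "s \<le> 1")
  case True thus ?thesis using ramp_nonneg[of s] by linarith
next
  case False
  have "ramp s = s - 1/2" using False
    by (simp add: ramp_def pos_part_def max_def field_simps numeral_eq_Suc)
  thus ?thesis by simp
qed
lemma ramp_le: "ramp s \<le> pos_part s"
proof (cases "s \<le> 0")
  case True thus ?thesis by (simp add: ramp_0 pos_part_def)
next
  case False
  have "(\<lambda>x. x - ramp x) 0 \<le> (\<lambda>x. x - ramp x) s"
    by (rule DERIV_nonneg_imp_nondecreasing[of 0 s])
       (use False step_le in \<open>auto intro!: exI derivative_eq_intros ramp_deriv\<close>)
  thus ?thesis using False by (simp add: ramp_0 pos_part_def)
qed

text \<open>At scale \<open>e\<close> all three functions vanish for \<open>t \<le> e\<close>, and the last one also for \<open>t \<ge> 2 e\<close>. The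
ramp differs from \<open>t\<close> by at most \<open>2 e\<close> on the positive half-line, so that for positive \<open>u\<close> the
function \<open>ramp_at e \<circ> u\<close> is close to \<open>u\<close>, of class \<open>C\<^sup>2\<close> where \<open>u\<close> is, and zero where \<open>u \<le> e\<close>.\<close>

definition ramp_at where "ramp_at e t = e * ramp (t / e - 1)"
definition step_at where "step_at e t = step (t / e - 1)" for e t :: real
definition bump_at where "bump_at e t = bump (t / e - 1) / e"

lemma scale_deriv: "e > 0 \<Longrightarrow> ((\<lambda>t. t / e - 1) has_real_derivative 1 / e) (at (s::real))"
  by (auto intro!: derivative_eq_intros)
lemma step_at_deriv: "e > 0 \<Longrightarrow> (step_at e has_real_derivative bump_at e s) (at s)"
  unfolding step_at_def[abs_def] bump_at_def
  using DERIV_chain2[OF step_deriv scale_deriv[of e s]] by simp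
lemma ramp_at_deriv: "e > 0 \<Longrightarrow> (ramp_at e has_real_derivative step_at e s) (at s)"
  unfolding ramp_at_def[abs_def] step_at_def
  using DERIV_cmult[OF DERIV_chain2[OF ramp_deriv scale_deriv[of e s]], of e] by simp
lemma bump_at_cont: "e > 0 \<Longrightarrow> continuous_on S (bump_at e)"
  unfolding bump_at_def[abs_def] bump_eq by (intro continuous_intros) auto
lemma step_at_cont: "e > 0 \<Longrightarrow> continuous_on S (step_at e)"
  by (rule DERIV_continuous_on[OF has_field_derivative_at_within[OF step_at_deriv]])
lemma ramp_at_cont: "e > 0 \<Longrightarrow> continuous_on S (ramp_at e)"
  by (rule DERIV_continuous_on[OF has_field_derivative_at_within[OF ramp_at_deriv]])
lemma cut_zero: "e > 0 \<Longrightarrow> t \<le> e \<Longrightarrow> ramp_at e t = 0 \<and> step_at e t = 0 \<and> bump_at e t = 0"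
  by (auto simp: ramp_at_def step_at_def bump_at_def ramp_0 step_0 bump_zero divide_simps)
lemma cut_large: "e > 0 \<Longrightarrow> t \<ge> 2 * e \<Longrightarrow> step_at e t = 1 \<and> bump_at e t = 0"
  by (auto simp: step_at_def bump_at_def step_1 bump_zero divide_simps)
lemma bump_at_nonneg: "e > 0 \<Longrightarrow> bump_at e t \<ge> 0" by (simp add: bump_at_def bump_nonneg)
lemma bump_at_le: "e > 0 \<Longrightarrow> bump_at e t \<le> 2 / e" by (simp add: bump_at_def bump_le divide_right_mono)
lemma step_at_nonneg: "step_at e t \<ge> 0" by (simp add: step_at_def step_nonneg)
lemma step_at_le: "step_at e t \<le> 1" by (simp add: step_at_def step_le)
lemma ramp_at_nonneg: "e > 0 \<Longrightarrow> ramp_at e t \<ge> 0" by (simp add: ramp_at_def ramp_nonneg)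
lemma ramp_at_ge: "e > 0 \<Longrightarrow> ramp_at e t \<ge> t - 2 * e"
  using ramp_ge[of "t / e - 1"] mult_left_mono[of "t / e - 2" "ramp (t / e - 1)" e]
  by (auto simp: ramp_at_def algebra_simps)
lemma ramp_at_le: "e > 0 \<Longrightarrow> t \<ge> 0 \<Longrightarrow> ramp_at e t \<le> t"
proof -
  assume e: "e > 0" "t \<ge> 0"
  have "e * ramp (t / e - 1) \<le> e * pos_part (t / e - 1)" using e ramp_le by auto
  also have "\<dots> \<le> t" using e by (auto simp: pos_part_def max_def algebra_simps)
  finally show ?thesis by (simp add: ramp_at_def)
qed

text \<open>This turns the reflection \<open>r \<mapsto> - r\<close> into a translation, so that translation invariance of the
Lebesgue measure is the only change of variables in what follows.\<close>

lemma bump_at_reflect: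
  assumes "e > 0" shows "bump_at e (- r) = bump_at e (r + 3 * e)"
proof -
  have "- r / e - 1 = 1 - ((r + 3 * e) / e - 1)" using assms by (simp add: field_simps)
  thus ?thesis unfolding bump_at_def by (simp only: bump_sym)
qed

section \<open>Integrals of directional derivatives\<close>

lemma lborel_integral_translate:
  fixes F :: "'a::euclidean_space \<Rightarrow> real"
  assumes [measurable]: "F \<in> borel_measurable borel"
  shows "(LINT x|lborel. F (x + c)) = integral\<^sup>L lborel F"
proof -
  have "integral\<^sup>L lborel F = integral\<^sup>L (distr lborel borel ((+) c)) F"
    by (simp add: lborel_distr_plus)
  also have "\<dots> = (LINT x|lborel. F (c + x))"
    by (subst integral_distr) auto
  finally show ?thesis by (simp add: add.commute)
qed

lemma bounded_support_integrable:
  fixes F :: "'a::euclidean_space \<Rightarrow> real"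
  assumes [measurable]: "F \<in> borel_measurable borel" and "bounded K"
    and "\<And>x. x \<notin> K \<Longrightarrow> F x = 0" and "\<And>x. \<bar>F x\<bar> \<le> M"
  shows "integrable lborel F"
proof -
  obtain p where p: "K \<subseteq> cbox (-p) p" using bounded_subset_cbox_symmetric[OF assms(2)] by auto
  have "integrable lborel (\<lambda>x. indicator (cbox (-p) p) x * M)"
    by (intro integrable_mult_left integrable_real_indicator emeasure_bounded_finite bounded_cbox) simp
  thus ?thesis
    by (rule Bochner_Integration.integrable_bound)
       (use p assms(3,4) in \<open>auto simp: indicator_def intro!: AE_I2 order_trans[OF assms(4) abs_ge_self]\<close>)
qed

text \<open>By translation invariance every difference quotient of \<open>F\<close> has integral zero. The quotients are
bounded by \<open>M\<close> and vanish outside a fixed ball, so dominated convergence gives the claim for the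
derivative.\<close>

lemma integral_directional_derivative_eq_0:
  fixes F D :: "'a::euclidean_space \<Rightarrow> real"
  assumes contF: "continuous_on UNIV F" and K: "bounded K" and FK: "\<And>x. x \<notin> K \<Longrightarrow> F x = 0"
    and der: "\<And>x. ((\<lambda>t. F (x + t *\<^sub>R b)) has_real_derivative D x) (at 0)"
    and M: "\<And>x. \<bar>D x\<bar> \<le> M"
  shows "integrable lborel D" "integral\<^sup>L lborel D = 0"
proof -
  define d where "d n x = (F (x + (1 / real (Suc n)) *\<^sub>R b) - F x) / (1 / real (Suc n))" for n x
  have [measurable]: "F \<in> borel_measurable borel"
    using contF by (rule borel_measurable_continuous_onI)
  have [measurable]: "d n \<in> borel_measurable borel" for n unfolding d_def by measurable
  have lim: "(\<lambda>n. d n x) \<longlonglongrightarrow> D x" for x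
  proof -
    have "((\<lambda>h. (F (x + h *\<^sub>R b) - F x) / h) \<longlongrightarrow> D x) (at 0)"
      using der[of x] by (simp add: DERIV_def)
    moreover have "filterlim (\<lambda>n. 1 / real (Suc n)) (at 0) sequentially"
      unfolding filterlim_at using LIMSEQ_inverse_real_of_nat
      by (auto simp: inverse_eq_divide)
    ultimately show ?thesis unfolding d_def by (rule filterlim_compose)
  qed
  have Dm[measurable]: "D \<in> borel_measurable lborel"
    by (rule borel_measurable_LIMSEQ_metric[OF _ lim]) auto
  obtain B where B: "\<And>x. x \<in> K \<Longrightarrow> norm x \<le> B" using K by (auto simp: bounded_iff)
  define K' where "K' = cball (0::'a) (B + norm b)"
  have dbound: "\<bar>d n x\<bar> \<le> M" for n x
  proof -
    have der': "((\<lambda>t. F (x + t *\<^sub>R b)) has_real_derivative D (x + t *\<^sub>R b)) (at t)" for t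
    proof -
      have "((\<lambda>s. F (x + t *\<^sub>R b + (s - t) *\<^sub>R b)) has_real_derivative D (x + t *\<^sub>R b) * 1) (at t)"
        by (rule DERIV_chain2[where g="\<lambda>s. s - t"])
           (use der[of "x + t *\<^sub>R b"] in \<open>auto intro!: derivative_eq_intros\<close>)
      thus ?thesis by (simp add: algebra_simps)
    qed
    obtain z where "F (x + (1 / real (Suc n)) *\<^sub>R b) - F (x + 0 *\<^sub>R b) = (1 / real (Suc n) - 0) * D (x + z *\<^sub>R b)"
      using MVT2[of 0 "1 / real (Suc n)" "\<lambda>t. F (x + t *\<^sub>R b)" "\<lambda>t. D (x + t *\<^sub>R b)"] der' by auto
    hence "d n x = D (x + z *\<^sub>R b)" unfolding d_def by simp
    thus ?thesis using M by simp
  qed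
  have dK: "d n x = 0" if "x \<notin> K'" for n x
  proof -
    have n: "norm ((1 / real (Suc n)) *\<^sub>R b) \<le> norm b"
      using norm_ge_zero[of b] by (simp add: divide_simps algebra_simps)
    have big: "norm x > B + norm b" using that by (auto simp: K'_def)
    have "norm x \<le> norm (x + (1 / real (Suc n)) *\<^sub>R b) + norm ((1 / real (Suc n)) *\<^sub>R b)"
      using norm_triangle_ineq4[of "x + (1 / real (Suc n)) *\<^sub>R b" "(1 / real (Suc n)) *\<^sub>R b"]
      by (simp only: add_diff_cancel_right')
    hence "norm (x + (1 / real (Suc n)) *\<^sub>R b) > B" using big n by linarith
    hence "x + (1 / real (Suc n)) *\<^sub>R b \<notin> K" using B not_less by blast
    moreover have "norm x > B" using big norm_ge_zero[of b] by linarith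
    hence "x \<notin> K" using B not_less by blast
    ultimately have "x \<notin> K" "x + (1 / real (Suc n)) *\<^sub>R b \<notin> K" by auto
    thus ?thesis unfolding d_def by (simp add: FK)
  qed
  have FI: "integrable lborel F"
  proof -
    have "compact K'" by (simp add: K'_def)
    have "bounded (F ` K')"
      by (intro compact_imp_bounded compact_continuous_image continuous_on_subset[OF contF] \<open>compact K'\<close>) auto
    then obtain m where m: "\<And>x. x \<in> K' \<Longrightarrow> \<bar>F x\<bar> \<le> m" by (auto simp: bounded_iff)
    have "K \<subseteq> K'"
    proof
      fix x assume "x \<in> K"
      thus "x \<in> K'" using B[of x] norm_ge_zero[of b] unfolding K'_def mem_cball dist_0_norm by linarith
    qed
    have "\<bar>F x\<bar> \<le> \<bar>m\<bar>" for x
    proof (cases "x \<in> K'")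
      case True thus ?thesis using m[of x] by linarith
    next
      case False
      hence "F x = 0" using \<open>K \<subseteq> K'\<close> by (intro FK) blast
      thus ?thesis by simp
    qed
    thus ?thesis using K FK by (intro bounded_support_integrable[of F K "\<bar>m\<bar>"]) auto
  qed
  have wI: "integrable lborel (\<lambda>x. M * indicator K' x)"
    unfolding K'_def
    by (intro integrable_mult_right integrable_real_indicator emeasure_bounded_finite bounded_cball) simp
  have w: "AE x in lborel. norm (d n x) \<le> M * indicator K' x" for n
    using dbound dK by (auto simp: indicator_def intro!: AE_I2)
  have di: "integral\<^sup>L lborel (d n) = 0" for n
  proof -
    have i2: "integrable lborel (\<lambda>x. F (x + c))" for c
    proof -
      have "integrable (distr lborel borel ((+) c)) F" using FI by (simp add: lborel_distr_plus)
      thus ?thesis by (subst (asm) integrable_distr_eq) (auto simp: add.commute)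
    qed
    have "integral\<^sup>L lborel (\<lambda>x. F (x + (1 / real (Suc n)) *\<^sub>R b) - F x) = 0"
      by (subst Bochner_Integration.integral_diff[OF i2 FI]) (simp add: lborel_integral_translate)
    thus ?thesis unfolding d_def by (subst integral_divide_zero) simp
  qed
  show "integrable lborel D"
    by (rule integrable_dominated_convergence[where s=d, OF Dm _ wI _ w]) (use lim in auto)
  have "(\<lambda>n. integral\<^sup>L lborel (d n)) \<longlonglongrightarrow> integral\<^sup>L lborel D"
    by (rule integral_dominated_convergence[where s=d, OF Dm _ wI _ w]) (use lim in auto)
  thus "integral\<^sup>L lborel D = 0" using di by (simp add: LIMSEQ_const_iff)
qed

section \<open>The divergence theorem across hyperplanes\<close>

definition tr :: "('a::euclidean_space \<Rightarrow> 'a) \<Rightarrow> real" where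
  "tr A = (\<Sum>b\<in>Basis. A b \<bullet> b)"

lemma derivative_zero_outside:
  assumes "closed K" "x \<notin> K" "\<And>x. x \<notin> K \<Longrightarrow> Y x = 0" "(Y has_derivative A) (at x)"
  shows "A = (\<lambda>_. 0)"
proof -
  have "(Y has_derivative (\<lambda>_. 0)) (at x)"
    by (rule has_derivative_transform_within_open[of "\<lambda>_. 0" _ x UNIV "- K"]) (use assms in auto)
  thus ?thesis using assms(4) has_derivative_unique by blast
qed

lemma tr_cont: "(\<And>b. b \<in> Basis \<Longrightarrow> continuous_on S (\<lambda>x. A x b)) \<Longrightarrow> continuous_on S (\<lambda>x. tr (A x))"
  unfolding tr_def by (intro continuous_intros) auto

lemma divergence_smooth:
  fixes Y :: "'a::euclidean_space \<Rightarrow> 'a"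
  assumes contY: "continuous_on UNIV Y" and K: "compact K" and YK: "\<And>x. x \<notin> K \<Longrightarrow> Y x = 0"
    and der: "\<And>x. (Y has_derivative Y' x) (at x)"
    and cont: "\<And>b. b \<in> Basis \<Longrightarrow> continuous_on UNIV (\<lambda>x. Y' x b)"
  shows "integral\<^sup>L lborel (\<lambda>x. tr (Y' x)) = 0"
proof -
  have *: "integrable lborel (\<lambda>x. Y' x b \<bullet> b) \<and> integral\<^sup>L lborel (\<lambda>x. Y' x b \<bullet> b) = 0"
    if b: "b \<in> Basis" for b
  proof -
    have "bounded ((\<lambda>x. Y' x b) ` K)"
      by (intro compact_imp_bounded compact_continuous_image continuous_on_subset[OF cont[OF b]] K) auto
    then obtain M where M: "\<And>x. x \<in> K \<Longrightarrow> norm (Y' x b) \<le> M" by (auto simp: bounded_iff)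
    have MM: "\<bar>Y' x b \<bullet> b\<bar> \<le> \<bar>M\<bar>" for x
    proof (cases "x \<in> K")
      case True
      have "\<bar>Y' x b \<bullet> b\<bar> \<le> norm (Y' x b)" using b by (rule Basis_le_norm)
      also have "\<dots> \<le> \<bar>M\<bar>" using M[OF True] by simp
      finally show ?thesis .
    next
      case False
      thus ?thesis using derivative_zero_outside[OF compact_imp_closed[OF K] False YK der] by simp
    qed
    have dd: "((\<lambda>t. Y (x + t *\<^sub>R b) \<bullet> b) has_real_derivative Y' x b \<bullet> b) (at 0)" for x
    proof -
      have lin: "linear (Y' x)" using der has_derivative_linear by blast
      have "((\<lambda>t. x + t *\<^sub>R b) has_derivative (\<lambda>t. t *\<^sub>R b)) (at 0)"
        by (auto intro!: derivative_eq_intros)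
      from has_derivative_compose[OF this] der[of x]
      have "((\<lambda>t. Y (x + t *\<^sub>R b)) has_derivative (\<lambda>t. Y' x (t *\<^sub>R b))) (at 0)" by simp
      hence "((\<lambda>t. Y (x + t *\<^sub>R b) \<bullet> b) has_derivative (\<lambda>t. Y' x (t *\<^sub>R b) \<bullet> b)) (at 0)"
        by (rule has_derivative_inner_left)
      thus ?thesis using lin by (simp add: has_field_derivative_def linear_cmul mult_commute_abs)
    qed
    have c: "continuous_on UNIV (\<lambda>x. Y x \<bullet> b)" by (intro continuous_intros contY)
    show ?thesis
      using integral_directional_derivative_eq_0[OF c compact_imp_bounded[OF K] _ dd MM] YK by auto
  qed
  show ?thesis unfolding tr_def
    by (subst Bochner_Integration.integral_sum) (use * in auto)
qed

lemma fst_eq_sum: "(\<Sum>b\<in>Basis. fst b * (y \<bullet> b)) = fst y" for y :: "real \<times> 'b::euclidean_space"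
proof -
  have "fst y = (1, 0) \<bullet> y" by (simp add: inner_prod_def)
  also have "\<dots> = (\<Sum>b\<in>Basis. ((1, 0) \<bullet> b) * (y \<bullet> b))" by (rule euclidean_inner)
  also have "\<dots> = (\<Sum>b\<in>Basis. fst b * (y \<bullet> b))" by (simp add: inner_prod_def)
  finally show ?thesis by simp
qed

lemma open_fst_notin: "finite T \<Longrightarrow> open {x :: real \<times> 'b::topological_space. fst x \<notin> T}"
  using open_vimage_fst[of "- T"] by (simp add: finite_imp_closed open_Compl vimage_def)

text \<open>The difference of the two bumps is the derivative of a cutoff that removes the strip
\<open>\<bar>fst x - s\<bar> \<le> d\<close>. The two bumps are translates of each other by \<open>3 d\<close>, so the integral equals that
of one bump times \<open>F x - F (x - v)\<close> with \<open>\<bar>v\<bar> = 3 d\<close>. The bump has height at most \<open>2/d\<close> on a strip of width \<open>d\<close>,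
and the oscillation of \<open>F\<close> is small by uniform continuity.\<close>

lemma strip_integral_small:
  fixes F :: "real \<times> 'b::euclidean_space \<Rightarrow> real"
  assumes contF: "continuous_on UNIV F" and K: "compact K" and FK: "\<And>x. x \<notin> K \<Longrightarrow> F x = 0" and "e > 0"
  shows "\<exists>d0>0. \<forall>d. 0 < d \<and> d < d0 \<longrightarrow>
    \<bar>LINT x|lborel. (bump_at d (fst x - s) - bump_at d (s - fst x)) * F x\<bar> \<le> e"
proof -
  obtain R where R: "\<And>x. x \<in> K \<Longrightarrow> norm x \<le> R" using compact_imp_bounded[OF K] by (auto simp: bounded_iff)
  define m where "m = measure lborel (cball (0::'b) (R + 3))"
  have m0: "m \<ge> 0" by (simp add: m_def)
  define \<omega> where "\<omega> = e / (2 * m + 1)"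
  have \<omega>: "\<omega> > 0" using m0 \<open>e > 0\<close> by (simp add: \<omega>_def)
  have "uniformly_continuous_on (cball 0 (R + 6)) F"
    by (intro compact_uniformly_continuous continuous_on_subset[OF contF]) auto
  then obtain d1 where d1: "d1 > 0"
    "\<And>x y. x \<in> cball 0 (R + 6) \<Longrightarrow> y \<in> cball 0 (R + 6) \<Longrightarrow> dist y x < d1 \<Longrightarrow> dist (F y) (F x) < \<omega>"
    using \<omega> unfolding uniformly_continuous_on_def by metis
  define d0 where "d0 = min 1 (d1 / 3)"
  have "\<bar>LINT x|lborel. (bump_at d (fst x - s) - bump_at d (s - fst x)) * F x\<bar> \<le> e" if d: "0 < d" "d < d0" for d
  proof -
    define v :: "real \<times> 'b" where "v = (3 * d, 0)"
    have nv: "norm v = 3 * d"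
      using d real_sqrt_unique[of "3 * d" "9 * d\<^sup>2"] by (simp add: v_def norm_Pair power_mult_distrib)
    have dd: "d < 1" "3 * d < d1" using d by (auto simp: d0_def)
    have [measurable]: "F \<in> borel_measurable borel" using contF by (rule borel_measurable_continuous_onI)
    have [measurable]: "bump_at d \<in> borel_measurable borel" using bump_at_cont[OF d(1)] by (rule borel_measurable_continuous_onI)
    have mf[measurable]: "(fst :: real \<times> 'b \<Rightarrow> real) \<in> borel_measurable borel"
      by (intro borel_measurable_continuous_onI continuous_intros)
    have osc: "\<bar>F x - F (x - v)\<bar> \<le> \<omega>" for x
    proof (cases "norm x \<le> R + 3")
      case True
      have "norm (x - v) \<le> norm x + norm v" by (rule norm_triangle_ineq4)
      hence "x - v \<in> cball 0 (R + 6)" "x \<in> cball 0 (R + 6)" using True nv dd by auto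
      moreover have "dist x (x - v) < d1" using nv dd by (simp add: dist_norm)
      ultimately show ?thesis using d1(2)[of "x - v" x] by (simp add: dist_real_def)
    next
      case False
      have "norm x \<le> norm (x - v) + norm v" using norm_triangle_ineq[of "x - v" v] by simp
      hence "norm (x - v) > R" "norm x > R" using False nv dd by auto
      hence "x \<notin> K" "x - v \<notin> K" using R not_less by blast+
      thus ?thesis using \<omega> by (simp add: FK)
    qed
    have F0: "F x - F (x - v) = 0" if "norm x > R + 3" for x
    proof -
      have "norm x \<le> norm (x - v) + norm v" using norm_triangle_ineq[of "x - v" v] by simp
      hence "norm (x - v) > R" "norm x > R" using that nv dd by auto
      hence "x \<notin> K" "x - v \<notin> K" using R not_less by blast+
      thus ?thesis by (simp add: FK)
    qed
    define H where "H x = bump_at d (fst x - s) * F (x - v)" for x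
    have Hm[measurable]: "H \<in> borel_measurable borel" unfolding H_def by measurable
    have Hv: "H (x + v) = bump_at d (s - fst x) * F x" for x
      using bump_at_reflect[OF d(1), of "fst x - s"] by (simp add: H_def v_def algebra_simps)
    have B2: "\<bar>bump_at d r\<bar> \<le> 2 / d" for r using bump_at_nonneg[OF d(1)] bump_at_le[OF d(1)] by simp
    have boundF: "\<exists>M. \<forall>x. \<bar>F x\<bar> \<le> M"
    proof -
      have "bounded (F ` K)"
        by (intro compact_imp_bounded compact_continuous_image continuous_on_subset[OF contF] K) auto
      then obtain M where M: "\<And>x. x \<in> K \<Longrightarrow> \<bar>F x\<bar> \<le> M" by (auto simp: bounded_iff)
      have "\<bar>F x\<bar> \<le> \<bar>M\<bar>" for x
        using M[of x] FK[of x] by (cases "x \<in> K") auto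
      thus ?thesis by blast
    qed
    then obtain MF where MF: "\<And>x. \<bar>F x\<bar> \<le> MF" by blast
    have bp: "\<bar>bump_at d r * F x\<bar> \<le> 2 / d * MF" for r x
      unfolding abs_mult using B2 MF d by (intro mult_mono) auto
    have i1: "integrable lborel (\<lambda>x. bump_at d (fst x - s) * F x)"
      by (rule bounded_support_integrable[of _ K "2 / d * MF"]) (use bp FK compact_imp_bounded[OF K] in auto)
    have i3: "integrable lborel (\<lambda>x. bump_at d (s - fst x) * F x)"
      by (rule bounded_support_integrable[of _ K "2 / d * MF"]) (use bp FK compact_imp_bounded[OF K] in auto)
    have i2: "integrable lborel H"
    proof (rule bounded_support_integrable[of _ "cball 0 (R + 3)" "2 / d * MF"])
      show "H x = 0" if "x \<notin> cball 0 (R + 3)" for x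
      proof -
        have "norm x > R + 3" using that by auto
        hence "F x = F (x - v)" using F0 by fastforce
        moreover have "norm x > R" using \<open>norm x > R + 3\<close> by linarith
        hence "x \<notin> K" using R not_less by blast
        ultimately show ?thesis by (simp add: H_def FK)
      qed
    qed (use bp in \<open>auto simp: H_def\<close>)
    have "(LINT x|lborel. (bump_at d (fst x - s) - bump_at d (s - fst x)) * F x)
        = (LINT x|lborel. bump_at d (fst x - s) * F x) - (LINT x|lborel. bump_at d (s - fst x) * F x)"
      by (subst Bochner_Integration.integral_diff[OF i1 i3, symmetric]) (simp add: algebra_simps)
    also have "(LINT x|lborel. bump_at d (s - fst x) * F x) = (LINT x|lborel. H (x + v))"
      by (simp add: Hv)
    also have "\<dots> = integral\<^sup>L lborel H" by (rule lborel_integral_translate) simp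
    also have "(LINT x|lborel. bump_at d (fst x - s) * F x) - integral\<^sup>L lborel H
        = (LINT x|lborel. bump_at d (fst x - s) * (F x - F (x - v)))"
      by (subst Bochner_Integration.integral_diff[OF i1 i2, symmetric]) (simp add: algebra_simps H_def)
    also have "\<bar>\<dots>\<bar> \<le> (LINT x|lborel. 2 / d * \<omega> * indicator ({s+d..s+2*d} \<times> cball (0::'b) (R + 3)) x)"
    proof -
      have em: "emeasure lborel ({s+d..s+2*d} \<times> cball (0::'b) (R + 3)) < \<infinity>"
        by (intro emeasure_bounded_finite bounded_Times) auto
      have "norm (LINT x|lborel. bump_at d (fst x - s) * (F x - F (x - v)))
          \<le> (LINT x|lborel. 2 / d * \<omega> * indicator ({s+d..s+2*d} \<times> cball (0::'b) (R + 3)) x)"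
      proof (rule Bochner_Integration.integral_norm_bound_integral)
        show "integrable lborel (\<lambda>x. bump_at d (fst x - s) * (F x - F (x - v)))"
          using Bochner_Integration.integrable_diff[OF i1 i2] by (simp add: H_def algebra_simps)
        show "integrable lborel (\<lambda>x. 2 / d * \<omega> * indicator ({s+d..s+2*d} \<times> cball (0::'b) (R + 3)) x)"
          using em by (intro integrable_mult_right integrable_real_indicator) (auto intro!: borel_closed closed_Times)
        show "norm (bump_at d (fst x - s) * (F x - F (x - v))) \<le>
            2 / d * \<omega> * indicator ({s+d..s+2*d} \<times> cball (0::'b) (R + 3)) x" for x
        proof (cases "x \<in> {s+d..s+2*d} \<times> cball (0::'b) (R + 3)")
          case True
          have "\<bar>bump_at d (fst x - s)\<bar> * \<bar>F x - F (x - v)\<bar> \<le> 2 / d * \<omega>"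
            using B2 osc d by (intro mult_mono) auto
          thus ?thesis using True by (simp add: abs_mult)
        next
          case False
          consider "fst x - s < d" | "fst x - s > 2 * d" | "norm (snd x) > R + 3"
            using False by (cases x) force
          thus ?thesis
          proof cases
            case 3
            have "norm (snd x) \<le> norm x" by (metis norm_snd_le prod.collapse)
            thus ?thesis using F0[of x] 3 False by simp
          qed (use False cut_zero[OF d(1), of "fst x - s"] cut_large[OF d(1), of "fst x - s"] in auto)
        qed
      qed
      thus ?thesis by simp
    qed
    also have "\<dots> = 2 / d * \<omega> * (d * m)"
    proof -
      have "emeasure lborel ({s+d..s+2*d} \<times> cball (0::'b) (R + 3))
          = emeasure lborel {s+d..s+2*d} * emeasure lborel (cball (0::'b) (R + 3))"
        by (subst lborel_prod[symmetric], subst lborel.emeasure_pair_measure_Times) auto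
      hence "measure lborel ({s+d..s+2*d} \<times> cball (0::'b) (R + 3)) = d * m"
        using d by (simp add: measure_def m_def enn2real_mult)
      thus ?thesis by (simp)
    qed
    also have "\<dots> = 2 * m * \<omega>" using d by (simp add: field_simps)
    also have "\<dots> \<le> e" using m0 \<open>e > 0\<close> by (simp add: \<omega>_def field_simps)
    finally show ?thesis .
  qed
  moreover have "d0 > 0" using d1 by (simp add: d0_def)
  ultimately show ?thesis by blast
qed

text \<open>The field is continuous everywhere but differentiable only off finitely many hyperplanes, near
which its partial derivatives may be unbounded; only the divergence is bounded. The induction
removes one hyperplane at a time: a cutoff \<open>ch\<close> that vanishes near it leaves an error term
\<open>ch' d (fst x) * fst (Y x)\<close>, which tends to zero because the normal component of \<open>Y\<close> does not jump.\<close>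

lemma divergence_planes:
  fixes Y :: "real \<times> 'b::euclidean_space \<Rightarrow> real \<times> 'b"
  assumes "finite T" and K: "compact K"
    and "continuous_on UNIV Y" and "\<And>x. x \<notin> K \<Longrightarrow> Y x = 0"
    and "\<And>x. fst x \<notin> T \<Longrightarrow> (Y has_derivative Y' x) (at x)"
    and "\<And>b. b \<in> Basis \<Longrightarrow> continuous_on {x. fst x \<notin> T} (\<lambda>x. Y' x b)"
    and "\<And>x. fst x \<notin> T \<Longrightarrow> \<bar>tr (Y' x)\<bar> \<le> M"
  shows "integral\<^sup>L lborel (\<lambda>x. indicator {x. fst x \<notin> T} x * tr (Y' x)) = 0"
  using assms(1,3-)
proof (induction T arbitrary: Y Y' M rule: finite_induct)
  case empty
  thus ?case using divergence_smooth[of Y K Y'] K by simp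
next
  case (insert s T Y Y' M)
  note contY = insert.prems(1) and YK = insert.prems(2) and der = insert.prems(3)
    and cont = insert.prems(4) and M = insert.prems(5)
  let ?U = "{x :: real \<times> 'b. fst x \<notin> insert s T}"
  have oU: "open ?U" using insert.hyps by (intro open_fst_notin) simp
  define g where "g x = indicator ?U x * tr (Y' x)" for x
  have gm[measurable]: "g \<in> borel_measurable borel"
    using borel_measurable_continuous_on_indicator[OF borel_open[OF oU] tr_cont[OF cont]]
    by (simp add: g_def[abs_def])
  have gb: "\<bar>g x\<bar> \<le> \<bar>M\<bar>" for x using M[of x] by (auto simp: g_def indicator_def)
  have gK: "g x = 0" if "x \<notin> K" for x
  proof (cases "x \<in> ?U")
    case True
    have "Y' x = (\<lambda>_. 0)"
      by (rule derivative_zero_outside[OF compact_imp_closed[OF K] that YK der]) (use True in auto)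
    thus ?thesis by (simp add: g_def tr_def)
  qed (simp add: g_def)
  have gi: "integrable lborel g"
    by (rule bounded_support_integrable[OF gm compact_imp_bounded[OF K] gK gb])
  have "bounded (Y ` K)"
    by (intro compact_imp_bounded compact_continuous_image continuous_on_subset[OF contY] K) auto
  then obtain B where B: "\<And>x. x \<in> K \<Longrightarrow> norm (Y x) \<le> B" by (auto simp: bounded_iff)
  have BB: "\<bar>fst (Y x)\<bar> \<le> \<bar>B\<bar>" for x
  proof (cases "x \<in> K")
    case True
    have "\<bar>fst (Y x)\<bar> \<le> norm (Y x)" by (metis norm_fst_le prod.collapse real_norm_def)
    thus ?thesis using B[OF True] by linarith
  qed (simp add: YK)
  \<comment> \<open>For a strip narrower than \<open>d1\<close> the derivative of the cutoff vanishes on the other hyperplanes.\<close>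
  obtain d1 where d1: "d1 > 0" "\<And>t. t \<in> T \<Longrightarrow> d1 \<le> \<bar>t - s\<bar>"
    using finite_set_avoid[OF insert.hyps(1), of s] insert.hyps(2) by (force simp: dist_real_def abs_minus_commute)
  define ch where "ch d r = step_at d (r - s) + step_at d (s - r)" for d r
  define ch' where "ch' d r = bump_at d (r - s) - bump_at d (s - r)" for d r
  have ch_deriv: "(ch d has_real_derivative ch' d r) (at r)" if "d > 0" for d r
    unfolding ch_def[abs_def] ch'_def using that
    by (auto intro!: derivative_eq_intros DERIV_chain2[OF step_at_deriv])
  have ch_near: "ch d r = 0 \<and> ch' d r = 0" if "d > 0" "\<bar>r - s\<bar> \<le> d" for d r
    using that cut_zero[of d "r - s"] cut_zero[of d "s - r"] by (auto simp: ch_def ch'_def)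
  have ch_far: "ch d r = 1 \<and> ch' d r = 0" if "d > 0" "\<bar>r - s\<bar> \<ge> 2 * d" for d r
    using that cut_zero[of d "r - s"] cut_zero[of d "s - r"] cut_large[of d "r - s"] cut_large[of d "s - r"]
    by (cases "r \<ge> s") (auto simp: ch_def ch'_def)
  have ch01: "\<bar>ch d r\<bar> \<le> 1" if "d > 0" for d r
    using that cut_zero[of d "r - s"] cut_zero[of d "s - r"] step_at_nonneg[of d "r-s"] step_at_nonneg[of d "s-r"]
      step_at_le[of d "r-s"] step_at_le[of d "s-r"]
    by (cases "r \<ge> s") (auto simp: ch_def)
  have ch'_le: "\<bar>ch' d r\<bar> \<le> 2 / d" if "d > 0" for d r
    using bump_at_nonneg[OF that, of "r - s"] bump_at_nonneg[OF that, of "s - r"]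
      bump_at_le[OF that, of "r - s"] bump_at_le[OF that, of "s - r"] unfolding ch'_def by linarith
  have ch_cont: "continuous_on S (\<lambda>x. ch d (f x))" if "d > 0" "continuous_on S f" for d S and f :: "real \<times> 'b \<Rightarrow> real"
    unfolding ch_def using that
    by (intro continuous_intros continuous_on_compose2[OF step_at_cont[of d UNIV]]) auto
  have ch'_cont: "continuous_on S (\<lambda>x. ch' d (f x))" if "d > 0" "continuous_on S f" for d S and f :: "real \<times> 'b \<Rightarrow> real"
    unfolding ch'_def using that
    by (intro continuous_intros continuous_on_compose2[OF bump_at_cont[of d UNIV]]) auto
  have key: "(LINT x|lborel. ch d (fst x) * g x) = - (LINT x|lborel. ch' d (fst x) * fst (Y x))"
    if d: "0 < d" "2 * d < d1" for d
  proof -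
    define Z where "Z x = ch d (fst x) *\<^sub>R Y x" for x
    define Z' where "Z' x v = (if fst x = s then 0 else ch d (fst x) *\<^sub>R Y' x v + (ch' d (fst x) * fst v) *\<^sub>R Y x)" for x v
    have near: "\<bar>fst x - s\<bar> < d \<Longrightarrow> Z x = 0 \<and> (\<forall>v. fst x \<noteq> s \<longrightarrow> Z' x v = 0)" for x
      using ch_near[OF d(1), of "fst x"] by (auto simp: Z_def Z'_def)
    have near': "\<bar>fst x - s\<bar> < d \<Longrightarrow> Z' x v = 0" for x v
      using ch_near[OF d(1), of "fst x"] by (auto simp: Z'_def)
    have on: "open {x :: real \<times> 'b. \<bar>fst x - s\<bar> < d}"
      by (intro open_Collect_less continuous_intros)
    have t: "tr (Z' x) = ch d (fst x) * g x + ch' d (fst x) * fst (Y x)" if "fst x \<notin> T" for x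
    proof (cases "fst x = s")
      case True
      thus ?thesis using ch_near[OF d(1), of s] d by (simp add: Z'_def tr_def)
    next
      case False
      have "tr (Z' x) = ch d (fst x) * tr (Y' x) + ch' d (fst x) * (\<Sum>b\<in>Basis. fst b * (Y x \<bullet> b))"
        using False by (simp add: tr_def Z'_def inner_add_left sum.distrib sum_distrib_left mult.assoc)
      thus ?thesis using False that by (simp add: fst_eq_sum g_def)
    qed
    have "integral\<^sup>L lborel (\<lambda>x. indicator {x. fst x \<notin> T} x * tr (Z' x)) = 0"
    proof (rule insert.IH)
      show "continuous_on UNIV Z" unfolding Z_def
        by (intro continuous_intros ch_cont contY d)
      show "\<And>x. x \<notin> K \<Longrightarrow> Z x = 0" by (simp add: Z_def YK)
      fix x :: "real \<times> 'b" assume x: "fst x \<notin> T"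
      show "(Z has_derivative Z' x) (at x)"
      proof (cases "fst x = s")
        case True
        have "((\<lambda>_. 0) has_derivative (\<lambda>_. 0)) (at x)" by simp
        hence "(Z has_derivative (\<lambda>_. 0)) (at x)"
          by (rule has_derivative_transform_within_open[OF _ on]) (use near True d in auto)
        moreover have "Z' x = (\<lambda>_. 0)" using True by (simp add: Z'_def fun_eq_iff)
        ultimately show ?thesis by simp
      next
        case False
        have "((\<lambda>x. ch d (fst x)) has_derivative (\<lambda>v. ch' d (fst x) * fst v)) (at x)"
          using has_derivative_compose[of fst fst x UNIV "ch d" "\<lambda>v. ch' d (fst x) * v"] ch_deriv[OF d(1), of "fst x"]
          by (simp add: has_field_derivative_def bounded_linear_imp_has_derivative bounded_linear_fst mult_commute_abs)
        moreover have "(Y has_derivative Y' x) (at x)" using x False by (intro der) auto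
        ultimately have "(Z has_derivative (\<lambda>v. ch d (fst x) *\<^sub>R Y' x v + (ch' d (fst x) * fst v) *\<^sub>R Y x)) (at x)"
          unfolding Z_def by (rule has_derivative_scaleR)
        thus ?thesis using False by (simp add: Z'_def[abs_def])
      qed
      have bt: "\<bar>ch d (fst x) * g x + ch' d (fst x) * fst (Y x)\<bar> \<le> 1 * \<bar>M\<bar> + 2 / d * \<bar>B\<bar>"
        using ch01[OF d(1), of "fst x"] gb[of x] ch'_le[OF d(1), of "fst x"] BB[of x] d
        by (intro order_trans[OF abs_triangle_ineq] add_mono) (auto simp only: abs_mult intro!: mult_mono)
      show "\<bar>tr (Z' x)\<bar> \<le> 1 * \<bar>M\<bar> + 2 / d * \<bar>B\<bar>"
        unfolding t[OF x] by (rule bt)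
    next
      fix b :: "real \<times> 'b" assume b: "b \<in> Basis"
      have "continuous_on (?U \<union> {x. \<bar>fst x - s\<bar> < d}) (\<lambda>x. Z' x b)"
      proof (rule continuous_on_open_Un[OF oU on])
        have "continuous_on ?U (\<lambda>x. ch d (fst x) *\<^sub>R Y' x b + (ch' d (fst x) * fst b) *\<^sub>R Y x)"
          by (intro continuous_intros ch_cont ch'_cont d cont b continuous_on_subset[OF contY]) auto
        thus "continuous_on ?U (\<lambda>x. Z' x b)"
          by (rule continuous_on_eq) (auto simp: Z'_def)
        have "continuous_on {x. \<bar>fst x - s\<bar> < d} (\<lambda>x. 0 :: real \<times> 'b)" by simp
        thus "continuous_on {x. \<bar>fst x - s\<bar> < d} (\<lambda>x. Z' x b)"
          by (rule continuous_on_eq) (use near' in auto)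
      qed
      thus "continuous_on {x. fst x \<notin> T} (\<lambda>x. Z' x b)"
        by (rule continuous_on_subset) (use d in auto)
    qed
    also have "(\<lambda>x. indicator {x. fst x \<notin> T} x * tr (Z' x)) = (\<lambda>x. ch d (fst x) * g x + ch' d (fst x) * fst (Y x))"
    proof
      fix x :: "real \<times> 'b"
      show "indicator {x. fst x \<notin> T} x * tr (Z' x) = ch d (fst x) * g x + ch' d (fst x) * fst (Y x)"
      proof (cases "fst x \<in> T")
        case True
        hence "ch' d (fst x) = 0" using ch_far[OF d(1), of "fst x"] d1(2)[OF True] d by auto
        thus ?thesis using True by (simp add: g_def)
      next
        case False thus ?thesis using t by simp
      qed
    qed
    finally have sum0: "(LINT x|lborel. ch d (fst x) * g x + ch' d (fst x) * fst (Y x)) = 0" .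
    have m1[measurable]: "(\<lambda>x::real \<times> 'b. ch d (fst x)) \<in> borel_measurable borel"
         "(\<lambda>x::real \<times> 'b. ch' d (fst x)) \<in> borel_measurable borel" "(\<lambda>x. fst (Y x)) \<in> borel_measurable borel"
      by (intro borel_measurable_continuous_onI ch_cont ch'_cont d continuous_intros contY)+
    have i1: "integrable lborel (\<lambda>x. ch d (fst x) * g x)"
    proof (rule bounded_support_integrable[OF _ compact_imp_bounded[OF K], of _ "1 * \<bar>M\<bar>"])
      show "\<bar>ch d (fst x) * g x\<bar> \<le> 1 * \<bar>M\<bar>" for x
        unfolding abs_mult using ch01[OF d(1)] gb by (intro mult_mono) auto
    qed (use gK in auto)
    have i2: "integrable lborel (\<lambda>x. ch' d (fst x) * fst (Y x))"
    proof (rule bounded_support_integrable[OF _ compact_imp_bounded[OF K], of _ "2 / d * \<bar>B\<bar>"])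
      show "\<bar>ch' d (fst x) * fst (Y x)\<bar> \<le> 2 / d * \<bar>B\<bar>" for x
        unfolding abs_mult using ch'_le[OF d(1)] BB d by (intro mult_mono) auto
    qed (use YK in auto)
    show ?thesis using sum0 Bochner_Integration.integral_add[OF i1 i2] by simp
  qed
  have small: "\<bar>integral\<^sup>L lborel g\<bar> \<le> e" if "e > 0" for e
  proof -
    have cF: "continuous_on UNIV (\<lambda>x. fst (Y x))" by (intro continuous_intros contY)
    have FK: "fst (Y x) = 0" if "x \<notin> K" for x using YK that by simp
    obtain d0 where d0: "d0 > 0" "\<And>d. 0 < d \<Longrightarrow> d < d0 \<Longrightarrow>
        \<bar>LINT x|lborel. (bump_at d (fst x - s) - bump_at d (s - fst x)) * fst (Y x)\<bar> \<le> e"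
      using strip_integral_small[OF cF K FK \<open>e > 0\<close>, of s] by blast
    define dn where "dn n = min (d0 / 2) (d1 / 3) * inverse (real (Suc n))" for n
    have dnp: "0 < dn n" "dn n < d0" "2 * dn n < d1" for n
    proof -
      show "0 < dn n" using d0 d1 by (simp add: dn_def)
      have "dn n \<le> min (d0 / 2) (d1 / 3)" unfolding dn_def using d0 d1
        by (intro mult_left_le) (auto simp: divide_simps)
      thus "dn n < d0" "2 * dn n < d1" using d0 d1 by auto
    qed
    have dn0: "dn \<longlonglongrightarrow> 0"
      unfolding dn_def by (rule tendsto_mult_right_zero[OF LIMSEQ_inverse_real_of_nat])
    have [measurable]: "(\<lambda>x::real \<times> 'b. ch (dn n) (fst x)) \<in> borel_measurable borel" for n
      by (intro borel_measurable_continuous_onI ch_cont dnp continuous_intros)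
    have lim: "(\<lambda>n. LINT x|lborel. ch (dn n) (fst x) * g x) \<longlonglongrightarrow> integral\<^sup>L lborel g"
    proof (rule integral_dominated_convergence[where w = "\<lambda>x. \<bar>g x\<bar>"])
      show "integrable lborel (\<lambda>x. \<bar>g x\<bar>)" using gi by (rule integrable_abs)
      show "AE x in lborel. norm (ch (dn n) (fst x) * g x) \<le> \<bar>g x\<bar>" for n
      proof (rule AE_I2)
        fix x :: "real \<times> 'b"
        show "norm (ch (dn n) (fst x) * g x) \<le> \<bar>g x\<bar>"
          using mult_right_mono[OF ch01[OF dnp(1), of n "fst x"], of "\<bar>g x\<bar>"] by (simp add: abs_mult)
      qed
      show "AE x in lborel. (\<lambda>n. ch (dn n) (fst x) * g x) \<longlonglongrightarrow> g x"
      proof (rule AE_I2)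
        fix x :: "real \<times> 'b"
        show "(\<lambda>n. ch (dn n) (fst x) * g x) \<longlonglongrightarrow> g x"
        proof (cases "fst x = s")
          case True thus ?thesis by (simp add: g_def)
        next
          case False
          have "eventually (\<lambda>n. dn n < \<bar>fst x - s\<bar> / 2) sequentially"
            using order_tendstoD(2)[OF dn0, of "\<bar>fst x - s\<bar> / 2"] False by simp
          hence "eventually (\<lambda>n. ch (dn n) (fst x) * g x = g x) sequentially"
            by eventually_elim (use ch_far dnp in auto)
          thus ?thesis by (rule tendsto_eventually)
        qed
      qed
    qed auto
    have "\<bar>LINT x|lborel. ch (dn n) (fst x) * g x\<bar> \<le> e" for n
      using key[OF dnp(1,3)] d0(2)[OF dnp(1,2)] by (simp add: ch'_def)
    moreover have "(\<lambda>n. \<bar>LINT x|lborel. ch (dn n) (fst x) * g x\<bar>) \<longlonglongrightarrow> \<bar>integral\<^sup>L lborel g\<bar>"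
      using lim by (rule tendsto_rabs)
    ultimately show ?thesis by (intro LIMSEQ_le_const2) auto
  qed
  have "integral\<^sup>L lborel g = 0"
    using small[of "\<bar>integral\<^sup>L lborel g\<bar> / 2"] by (cases "integral\<^sup>L lborel g = 0") auto
  thus ?case by (simp add: g_def[abs_def])
qed

lemma plane_null: "finite T \<Longrightarrow> {x :: real \<times> 'b::euclidean_space. fst x \<in> T} \<in> null_sets lborel"
proof -
  assume T: "finite T"
  have eq: "{x :: real \<times> 'b. fst x \<in> T} = T \<times> UNIV" by auto
  have "emeasure lborel (T \<times> (UNIV :: 'b set)) = emeasure lborel T * emeasure lborel (UNIV :: 'b set)"
    using T by (subst lborel_prod[symmetric], subst lborel.emeasure_pair_measure_Times) (auto simp: finite_imp_closed)
  moreover have "emeasure lborel T = 0" using T by (simp add: emeasure_lborel_countable countable_finite)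
  ultimately show ?thesis unfolding eq null_sets_def using T
    by (auto intro!: borel_closed closed_Times simp: finite_imp_closed)
qed

lemma exists_off_plane:
  assumes "open S" "x \<in> S" shows "\<exists>y\<in>S. fst (y :: real \<times> 'b::euclidean_space) \<noteq> s"
proof (rule ccontr)
  assume "\<not> ?thesis"
  hence "S \<subseteq> {x. fst x \<in> {s}}" by auto
  moreover have "negligible {x :: real \<times> 'b. fst x \<in> {s}}"
    unfolding negligible_iff_null_sets by (rule null_sets_completionI[OF plane_null]) simp
  ultimately have "negligible S" by (rule negligible_subset[rotated])
  thus False using open_not_negligible assms by blast
qed

lemma nonneg_continuous_integral_zero:
  fixes g :: "'a::euclidean_space \<Rightarrow> real"
  assumes V: "open V" and c: "continuous_on V g" and nn: "\<And>x. x \<in> V \<Longrightarrow> g x \<ge> 0"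
    and i: "integrable lborel (\<lambda>x. indicator V x * g x)"
    and z: "integral\<^sup>L lborel (\<lambda>x. indicator V x * g x) = 0" and x: "x \<in> V"
  shows "g x = 0"
proof (rule ccontr)
  assume "g x \<noteq> 0"
  hence gx: "g x > 0" using nn[OF x] by simp
  let ?S = "{y\<in>V. g y > 0}"
  have oS: "open ?S"
  proof -
    have "open (g -` {0<..} \<inter> V)" using continuous_open_preimage[OF c V] by (simp add: Int_commute)
    moreover have "g -` {0<..} \<inter> V = ?S" by auto
    ultimately show ?thesis by simp
  qed
  have "AE x in lborel. indicator V x * g x = 0"
    using i z nn by (subst (asm) integral_nonneg_eq_0_iff_AE) (auto simp: indicator_def)
  then obtain N where N: "N \<in> null_sets lborel" "\<And>x. x \<in> space lborel - N \<Longrightarrow> indicator V x * g x = 0"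
    by (rule AE_E3) blast
  have "?S \<subseteq> N"
  proof
    fix y assume "y \<in> ?S"
    thus "y \<in> N" using N(2)[of y] by (cases "y \<in> N") auto
  qed
  moreover have "negligible N" using N(1) by (simp add: negligible_iff_null_sets null_sets_completionI)
  ultimately have "negligible ?S" by (rule negligible_subset[rotated])
  thus False using open_not_negligible[OF oS] gx x by blast
qed

text \<open>A field that vanishes on \<open>U\<close> outside a compact set is extended by zero to the whole space.\<close>

lemma divergence_open:
  fixes Z :: "real \<times> 'b::euclidean_space \<Rightarrow> real \<times> 'b"
  assumes T: "finite T" and U: "open U" and K: "compact K" "K \<subseteq> U"
    and cZ: "continuous_on U Z" and ZK: "\<And>x. x \<in> U \<Longrightarrow> x \<notin> K \<Longrightarrow> Z x = 0"
    and der: "\<And>x. x \<in> U \<Longrightarrow> fst x \<notin> T \<Longrightarrow> (Z has_derivative Z' x) (at x)"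
    and cont: "\<And>b. b \<in> Basis \<Longrightarrow> continuous_on {x\<in>U. fst x \<notin> T} (\<lambda>x. Z' x b)"
    and M: "\<And>x. x \<in> U \<Longrightarrow> fst x \<notin> T \<Longrightarrow> \<bar>tr (Z' x)\<bar> \<le> M"
  shows "integrable lborel (\<lambda>x. indicator {x\<in>U. fst x \<notin> T} x * tr (Z' x))"
    "integral\<^sup>L lborel (\<lambda>x. indicator {x\<in>U. fst x \<notin> T} x * tr (Z' x)) = 0"
proof -
  define Y where "Y x = (if x \<in> U then Z x else 0)" for x
  define Y' where "Y' x = (if x \<in> U then Z' x else (\<lambda>_. 0))" for x
  have cK: "open (- K)" using K by (simp add: compact_imp_closed open_Compl)
  have YK: "Y x = 0" if "x \<notin> K" for x using that ZK by (simp add: Y_def)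
  have univ: "UNIV = U \<union> - K" using K by auto
  have cY: "continuous_on UNIV Y"
    unfolding univ
  proof (rule continuous_on_open_Un[OF U cK])
    show "continuous_on U Y" using cZ by (rule continuous_on_eq) (simp add: Y_def)
    show "continuous_on (- K) Y" by (rule continuous_on_eq[OF continuous_on_const[of _ 0]]) (simp add: YK)
  qed
  have der0: "(Y has_derivative (\<lambda>_. 0)) (at x)" if "x \<notin> K" for x
    by (rule has_derivative_transform_within_open[OF has_derivative_const cK]) (use that YK in auto)
  have derY: "(Y has_derivative Y' x) (at x)" if "fst x \<notin> T" for x
  proof (cases "x \<in> U")
    case True
    have "(Y has_derivative Z' x) (at x)"
      by (rule has_derivative_transform_within_open[OF der[OF True that] U True]) (simp add: Y_def)
    thus ?thesis using True by (simp add: Y'_def)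
  next
    case False
    thus ?thesis using der0[of x] K by (auto simp: Y'_def)
  qed
  have Y'0: "Y' x = (\<lambda>_. 0)" if "x \<notin> K" "fst x \<notin> T" for x
    using has_derivative_unique[OF der0[OF that(1)] derY[OF that(2)]] by simp
  have "continuous_on {x. fst x \<notin> T} (\<lambda>x. Y' x b)" if b: "b \<in> Basis" for b
  proof -
    have o1: "open {x\<in>U. fst x \<notin> T}" and o2: "open (- K \<inter> {x. fst x \<notin> T})"
      using open_Int[OF U open_fst_notin[OF T]] open_Int[OF cK open_fst_notin[OF T]] by (auto simp: Int_def)
    have "{x. fst x \<notin> T} = {x\<in>U. fst x \<notin> T} \<union> (- K \<inter> {x. fst x \<notin> T})" using K by auto
    moreover have "continuous_on ({x\<in>U. fst x \<notin> T} \<union> (- K \<inter> {x. fst x \<notin> T})) (\<lambda>x. Y' x b)"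
    proof (rule continuous_on_open_Un[OF o1 o2])
      show "continuous_on {x\<in>U. fst x \<notin> T} (\<lambda>x. Y' x b)"
        using cont[OF b] by (rule continuous_on_eq) (simp add: Y'_def)
      show "continuous_on (- K \<inter> {x. fst x \<notin> T}) (\<lambda>x. Y' x b)"
        by (rule continuous_on_eq[OF continuous_on_const[of _ 0]]) (use Y'0 in auto)
    qed
    ultimately show ?thesis by simp
  qed note cY' = this
  have MY: "\<bar>tr (Y' x)\<bar> \<le> \<bar>M\<bar>" if "fst x \<notin> T" for x
    using M[of x] that by (cases "x \<in> U") (auto simp: Y'_def tr_def)
  have trY0: "tr (Y' x) = 0" if "x \<notin> K" "fst x \<notin> T" for x using Y'0[OF that] by (simp add: tr_def)
  have eq: "(\<lambda>x. indicator {x. fst x \<notin> T} x * tr (Y' x)) = (\<lambda>x. indicator {x\<in>U. fst x \<notin> T} x * tr (Z' x))"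
    by (auto simp: Y'_def tr_def indicator_def)
  have "integral\<^sup>L lborel (\<lambda>x. indicator {x. fst x \<notin> T} x * tr (Y' x)) = 0"
    by (rule divergence_planes[OF T K(1) cY YK derY cY' MY])
  thus "integral\<^sup>L lborel (\<lambda>x. indicator {x\<in>U. fst x \<notin> T} x * tr (Z' x)) = 0" by (simp add: eq)
  have "(\<lambda>x. indicator {x. fst x \<notin> T} x * tr (Y' x)) \<in> borel_measurable borel"
    using borel_measurable_continuous_on_indicator[OF borel_open[OF open_fst_notin[OF T]] tr_cont[OF cY']] by simp
  hence "integrable lborel (\<lambda>x. indicator {x. fst x \<notin> T} x * tr (Y' x))"
  proof (rule bounded_support_integrable[OF _ compact_imp_bounded[OF K(1)], of _ "\<bar>M\<bar>"])
    fix x :: "real \<times> 'b"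
    show "indicator {x. fst x \<notin> T} x * tr (Y' x) = 0" if "x \<notin> K"
      using trY0[OF that] by (cases "fst x \<in> T") auto
    show "\<bar>indicator {x. fst x \<notin> T} x * tr (Y' x)\<bar> \<le> \<bar>M\<bar>"
      using MY[of x] by (cases "fst x \<in> T") auto
  qed
  thus "integrable lborel (\<lambda>x. indicator {x\<in>U. fst x \<notin> T} x * tr (Z' x))" by (simp add: eq)
qed

section \<open>The weight and the weighted divergence theorem\<close>

text \<open>This is \<open>\<bar>r\<bar>\<^sup>a\<close>. The case \<open>a = 0\<close> is separate because \<open>0 powr 0 = 0\<close> would make the weight
discontinuous at \<open>r = 0\<close>.\<close>

definition wt :: "real \<Rightarrow> real \<Rightarrow> real" where "wt a r = (if a = 0 then 1 else \<bar>r\<bar> powr a)"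

lemma wt_nonneg: "wt a r \<ge> 0" by (simp add: wt_def)
lemma wt_pos: "r \<noteq> 0 \<Longrightarrow> wt a r > 0" by (simp add: wt_def)
lemma wt_0: "a > 0 \<Longrightarrow> wt a 0 = 0" by (simp add: wt_def)
lemma wt_cont: "a \<ge> 0 \<Longrightarrow> continuous_on S f \<Longrightarrow> continuous_on S (\<lambda>x. wt a (f x))"
  by (cases "a = 0") (simp_all add: wt_def continuous_on_powr' continuous_on_rabs)
lemma wt_deriv:
  assumes "r \<noteq> 0" shows "(wt a has_real_derivative a / r * wt a r) (at r)"
proof (cases "a = 0")
  case True thus ?thesis by (simp add: wt_def[abs_def])
next
  case False
  have "((\<lambda>r. \<bar>r\<bar> powr a) has_real_derivative a / r * \<bar>r\<bar> powr a) (at r)"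
  proof (cases "r > 0")
    case True
    have "((\<lambda>r. r powr a) has_real_derivative a * r powr (a - 1)) (at r)"
      using True by (rule has_real_derivative_powr)
    hence "((\<lambda>r. \<bar>r\<bar> powr a) has_real_derivative a * r powr (a - 1)) (at r)"
      by (rule has_field_derivative_transform_within_open[of _ _ _ "{0<..}"]) (use True in auto)
    thus ?thesis using True by (simp add: powr_diff)
  next
    case F: False
    hence r: "r < 0" using assms by simp
    have "((\<lambda>r. (- r) powr a) has_real_derivative a * (- r) powr (a - 1) * (- 1)) (at r)"
      using r by (intro DERIV_chain2[OF has_real_derivative_powr]) (auto intro!: derivative_eq_intros)
    hence "((\<lambda>r. \<bar>r\<bar> powr a) has_real_derivative a * (- r) powr (a - 1) * (- 1)) (at r)"
      by (rule has_field_derivative_transform_within_open[of _ _ _ "{..<0}"]) (use r in auto)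
    thus ?thesis using r by (simp add: powr_diff)
  qed
  thus ?thesis using False by (simp add: wt_def[abs_def])
qed

text \<open>For a field \<open>Z\<close>, the divergence of \<open>wt a r *\<^sub>R Z\<close> is \<open>wt a r\<close> times \<open>div Z + (a / r) Z\<^sub>r\<close>. Continuity is
asked of the product and not of \<open>Z\<close> itself, so that for \<open>a > 0\<close> a field may be set to zero on one side
of the hyperplane \<open>r = 0\<close>, where the weight vanishes.\<close>

lemma divergence_weighted_bounded:
  fixes Z :: "real \<times> 'b::euclidean_space \<Rightarrow> real \<times> 'b"
  assumes a: "0 \<le> a" and T: "finite T" "0 \<in> T" and U: "open U" and K: "compact K" "K \<subseteq> U"
    and cZ: "continuous_on U (\<lambda>x. wt a (fst x) *\<^sub>R Z x)" and ZK: "\<And>x. x \<in> U \<Longrightarrow> x \<notin> K \<Longrightarrow> Z x = 0"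
    and der: "\<And>x. x \<in> U \<Longrightarrow> fst x \<notin> T \<Longrightarrow> (Z has_derivative Z' x) (at x)"
    and cont: "\<And>b. b \<in> Basis \<Longrightarrow> continuous_on {x\<in>U. fst x \<notin> T} (\<lambda>x. Z' x b)"
    and d: "\<And>x. x \<in> U \<Longrightarrow> fst x \<notin> T \<Longrightarrow> tr (Z' x) + a / fst x * fst (Z x) = d x"
    and M: "\<And>x. x \<in> U \<Longrightarrow> fst x \<notin> T \<Longrightarrow> \<bar>d x\<bar> \<le> M"
  shows "integrable lborel (\<lambda>x. indicator {x\<in>U. fst x \<notin> T} x * (wt a (fst x) * d x))"
    "integral\<^sup>L lborel (\<lambda>x. indicator {x\<in>U. fst x \<notin> T} x * (wt a (fst x) * d x)) = 0"
proof -
  define Y where "Y x = wt a (fst x) *\<^sub>R Z x" for x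
  define Y' where "Y' x v = wt a (fst x) *\<^sub>R Z' x v + (a / fst x * wt a (fst x) * fst v) *\<^sub>R Z x" for x v
  have cw: "continuous_on S (\<lambda>x::real \<times> 'b. wt a (fst x))" for S by (intro wt_cont a continuous_intros)
  have t: "tr (Y' x) = wt a (fst x) * d x" if "x \<in> U" "fst x \<notin> T" for x
  proof -
    have "tr (Y' x) = wt a (fst x) * tr (Z' x) + a / fst x * wt a (fst x) * (\<Sum>b\<in>Basis. fst b * (Z x \<bullet> b))"
      by (simp add: tr_def Y'_def inner_add_left sum.distrib sum_distrib_left mult.assoc)
    also have "\<dots> = wt a (fst x) * (tr (Z' x) + a / fst x * fst (Z x))"
      by (simp add: fst_eq_sum algebra_simps)
    finally show ?thesis using d[OF that] by simp
  qed
  have "bounded ((\<lambda>x. wt a (fst x)) ` K)" by (intro compact_imp_bounded compact_continuous_image cw K)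
  then obtain B where B: "\<And>x. x \<in> K \<Longrightarrow> \<bar>wt a (fst x)\<bar> \<le> B" by (auto simp: bounded_iff)
  have d0: "d x = 0" if "x \<in> U" "fst x \<notin> T" "x \<notin> K" for x
  proof -
    have "open (U - K)" using U K by (simp add: open_Diff compact_imp_closed)
    hence "(Z has_derivative (\<lambda>_. 0)) (at x)"
      by (rule has_derivative_transform_within_open[OF has_derivative_const]) (use that ZK in auto)
    from has_derivative_unique[OF this der[OF that(1,2)]] have "Z' x = (\<lambda>_. 0)" by simp
    thus ?thesis using d[OF that(1,2)] ZK[OF that(1,3)] by (simp add: tr_def)
  qed
  have bt: "\<bar>tr (Y' x)\<bar> \<le> \<bar>B\<bar> * \<bar>M\<bar>" if "x \<in> U" "fst x \<notin> T" for x
  proof (cases "x \<in> K")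
    case True
    have "\<bar>wt a (fst x)\<bar> * \<bar>d x\<bar> \<le> \<bar>B\<bar> * \<bar>M\<bar>"
      using B[OF True] M[OF that] by (intro mult_mono) auto
    thus ?thesis by (simp add: t[OF that] abs_mult)
  next
    case False
    thus ?thesis using t[OF that] d0[OF that] by simp
  qed
  have derY: "(Y has_derivative Y' x) (at x)" if "x \<in> U" "fst x \<notin> T" for x
  proof -
    have "fst x \<noteq> 0" using that T by auto
    hence "(wt a has_derivative (*) (a / fst x * wt a (fst x))) (at (fst x))"
      using wt_deriv[of "fst x" a] unfolding has_field_derivative_def by simp
    with bounded_linear_imp_has_derivative[OF bounded_linear_fst]
    have "((\<lambda>x. wt a (fst x)) has_derivative (\<lambda>v. a / fst x * wt a (fst x) * fst v)) (at x)"
      by (rule has_derivative_compose)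
    from has_derivative_scaleR[OF this der[OF that]] show ?thesis
      by (simp add: Y_def[abs_def] Y'_def[abs_def])
  qed
  have cZ0: "continuous_on {x\<in>U. fst x \<notin> T} Z"
    by (rule continuous_at_imp_continuous_on) (auto intro!: has_derivative_continuous[OF der])
  have cY': "continuous_on {x\<in>U. fst x \<notin> T} (\<lambda>x. Y' x b)" if "b \<in> Basis" for b
    unfolding Y'_def using T
    by (intro continuous_intros cw cont that cZ0) auto
  have cY: "continuous_on U Y" unfolding Y_def by (rule cZ)
  have YK: "Y x = 0" if "x \<in> U" "x \<notin> K" for x using ZK that by (simp add: Y_def)
  have eq: "(\<lambda>x. indicator {x\<in>U. fst x \<notin> T} x * tr (Y' x)) = (\<lambda>x. indicator {x\<in>U. fst x \<notin> T} x * (wt a (fst x) * d x))"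
  proof
    fix x :: "real \<times> 'b"
    show "indicator {x\<in>U. fst x \<notin> T} x * tr (Y' x) = indicator {x\<in>U. fst x \<notin> T} x * (wt a (fst x) * d x)"
      using t[of x] by (cases "x \<in> U \<and> fst x \<notin> T") auto
  qed
  show "integrable lborel (\<lambda>x. indicator {x\<in>U. fst x \<notin> T} x * (wt a (fst x) * d x))"
    unfolding eq[symmetric] by (rule divergence_open(1)[OF T(1) U K cY YK derY cY' bt])
  show "integral\<^sup>L lborel (\<lambda>x. indicator {x\<in>U. fst x \<notin> T} x * (wt a (fst x) * d x)) = 0"
    unfolding eq[symmetric] by (rule divergence_open(2)[OF T(1) U K cY YK derY cY' bt])
qed

text \<open>If the weighted divergence extends continuously across the hyperplanes, these can be put back
into the domain of integration, being null sets. This frees later limits from the hyperplanes that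
move with the parameter.\<close>

lemma divergence_weighted:
  fixes Z :: "real \<times> 'b::euclidean_space \<Rightarrow> real \<times> 'b"
  assumes a: "0 \<le> a" and T: "finite T" "0 \<in> T" and U: "open U" and K: "compact K" "K \<subseteq> U"
    and cZ: "continuous_on U Z" and ZK: "\<And>x. x \<in> U \<Longrightarrow> x \<notin> K \<Longrightarrow> Z x = 0"
    and der: "\<And>x. x \<in> U \<Longrightarrow> fst x \<notin> T \<Longrightarrow> (Z has_derivative Z' x) (at x)"
    and cont: "\<And>b. b \<in> Basis \<Longrightarrow> continuous_on {x\<in>U. fst x \<notin> T} (\<lambda>x. Z' x b)"
    and d: "\<And>x. x \<in> U \<Longrightarrow> fst x \<notin> T \<Longrightarrow> tr (Z' x) + a / fst x * fst (Z x) = d x"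
    and cd: "continuous_on U d"
  shows "set_integrable lborel U (\<lambda>x. wt a (fst x) * d x)"
    "(LINT x:U|lborel. wt a (fst x) * d x) = 0"
proof -
  have "bounded (d ` K)" by (intro compact_imp_bounded compact_continuous_image continuous_on_subset[OF cd] K)
  then obtain M where M: "\<And>x. x \<in> K \<Longrightarrow> \<bar>d x\<bar> \<le> M" by (auto simp: bounded_iff)
  have d0: "d x = 0" if "x \<in> U" "fst x \<notin> T" "x \<notin> K" for x
  proof -
    have "open (U - K)" using U K by (simp add: open_Diff compact_imp_closed)
    hence "(Z has_derivative (\<lambda>_. 0)) (at x)"
      by (rule has_derivative_transform_within_open[OF has_derivative_const]) (use that ZK in auto)
    from has_derivative_unique[OF this der[OF that(1,2)]] have "Z' x = (\<lambda>_. 0)" by simp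
    thus ?thesis using d[OF that(1,2)] ZK[OF that(1,3)] by (simp add: tr_def)
  qed
  have MM: "\<bar>d x\<bar> \<le> \<bar>M\<bar>" if "x \<in> U" "fst x \<notin> T" for x
    using M[of x] d0[OF that] by (cases "x \<in> K") auto
  have cZw: "continuous_on U (\<lambda>x. wt a (fst x) *\<^sub>R Z x)" by (intro continuous_intros wt_cont a cZ)
  have I: "integrable lborel (\<lambda>x. indicator {x\<in>U. fst x \<notin> T} x * (wt a (fst x) * d x))"
    "integral\<^sup>L lborel (\<lambda>x. indicator {x\<in>U. fst x \<notin> T} x * (wt a (fst x) * d x)) = 0"
    by (rule divergence_weighted_bounded[OF a T U K cZw ZK der cont d MM]; assumption)+
  have m: "(\<lambda>x. indicator U x *\<^sub>R (wt a (fst x) * d x)) \<in> borel_measurable lborel"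
    using borel_measurable_continuous_on_indicator[OF borel_open[OF U], of "\<lambda>x. wt a (fst x) * d x"]
    by (simp add: continuous_on_mult wt_cont a continuous_on_fst continuous_on_id cd)
  have ae: "AE x in lborel. indicator {x\<in>U. fst x \<notin> T} x * (wt a (fst x) * d x) = indicator U x *\<^sub>R (wt a (fst x) * d x)"
    by (rule AE_I'[OF plane_null[OF T(1)]]) (auto simp: indicator_def)
  show "set_integrable lborel U (\<lambda>x. wt a (fst x) * d x)"
    unfolding set_integrable_def using I(1) by (rule integrable_cong_AE_imp[OF _ m ae])
  show "(LINT x:U|lborel. wt a (fst x) * d x) = 0"
    unfolding set_lebesgue_integral_def using I(2) integral_cong_AE[OF borel_measurable_integrable[OF I(1)] m ae] by simp
qed

section \<open>Symmetry of the Hessian\<close>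

text \<open>The mixed second difference of \<open>f\<close> is symmetric in \<open>v\<close> and \<open>w\<close>, and the mean value theorem in the
direction \<open>v\<close> compares it with \<open>t\<^sup>2 * (A w \<bullet> v)\<close>.\<close>

lemma hessian_symmetric_aux:
  fixes f :: "'a::real_inner \<Rightarrow> real"
  assumes r: "r > 0" and G: "\<And>y. y \<in> ball x r \<Longrightarrow> GDERIV f y :> G y"
    and e: "\<And>h. norm h < r \<Longrightarrow> norm (G (x + h) - G x - A h) \<le> e * norm h"
    and lin: "linear A" and t: "0 < t" "t * (norm v + norm w) < r" and e0: "e \<ge> 0"
  shows "\<bar>f (x + t *\<^sub>R v + t *\<^sub>R w) - f (x + t *\<^sub>R v) - f (x + t *\<^sub>R w) + f x - t\<^sup>2 * (A w \<bullet> v)\<bar>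
    \<le> t\<^sup>2 * (e * (2 * (norm v + norm w) * norm v))"
proof -
  define ph where "ph s = f (x + s *\<^sub>R v + t *\<^sub>R w) - f (x + s *\<^sub>R v)" for s
  have nrm: "norm (s *\<^sub>R v + t *\<^sub>R w) \<le> t * (norm v + norm w)" "norm (s *\<^sub>R v) \<le> t * (norm v + norm w)"
    if "0 \<le> s" "s \<le> t" for s
  proof -
    have "norm (s *\<^sub>R v + t *\<^sub>R w) \<le> s * norm v + t * norm w"
      using norm_triangle_ineq[of "s *\<^sub>R v" "t *\<^sub>R w"] that t by simp
    moreover have "s * norm v \<le> t * norm v" using that by (intro mult_right_mono) auto
    moreover have "norm (s *\<^sub>R v) = s * norm v" using that by simp
    moreover have "0 \<le> t * norm w" using t by simp
    ultimately show "norm (s *\<^sub>R v + t *\<^sub>R w) \<le> t * (norm v + norm w)" "norm (s *\<^sub>R v) \<le> t * (norm v + norm w)"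
      by (auto simp: distrib_left)
  qed
  have d: "(ph has_real_derivative (G (x + s *\<^sub>R v + t *\<^sub>R w) - G (x + s *\<^sub>R v)) \<bullet> v) (at s)"
    if s: "0 \<le> s" "s \<le> t" for s
  proof -
    have *: "((\<lambda>s. f (x + s *\<^sub>R v + z)) has_real_derivative G (x + s *\<^sub>R v + z) \<bullet> v) (at s)"
      if "x + s *\<^sub>R v + z \<in> ball x r" for z
    proof -
      have "((\<lambda>s. x + s *\<^sub>R v + z) has_derivative (\<lambda>h. h *\<^sub>R v)) (at s)"
        by (auto intro!: derivative_eq_intros)
      from has_derivative_compose[OF this G[OF that, unfolded gderiv_def]]
      show ?thesis by (simp add: has_field_derivative_def inner_commute mult_commute_abs)
    qed
    have "x + s *\<^sub>R v + t *\<^sub>R w \<in> ball x r" "x + s *\<^sub>R v + 0 \<in> ball x r"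
      using nrm[OF s] t by (auto simp: dist_norm norm_minus_commute algebra_simps)
    from DERIV_diff[OF *[OF this(1)] *[OF this(2)]] show ?thesis
      by (simp add: ph_def[abs_def] inner_diff_left)
  qed
  obtain z where z: "0 < z" "z < t" "ph t - ph 0 = (t - 0) * ((G (x + z *\<^sub>R v + t *\<^sub>R w) - G (x + z *\<^sub>R v)) \<bullet> v)"
    using MVT2[of 0 t ph "\<lambda>s. (G (x + s *\<^sub>R v + t *\<^sub>R w) - G (x + s *\<^sub>R v)) \<bullet> v"] d t by auto
  let ?h1 = "z *\<^sub>R v + t *\<^sub>R w" and ?h2 = "z *\<^sub>R v"
  let ?r1 = "G (x + ?h1) - G x - A ?h1" and ?r2 = "G (x + ?h2) - G x - A ?h2"
  have n1: "norm ?r1 \<le> e * (t * (norm v + norm w))"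
    using e[of ?h1] nrm(1)[of z] z t mult_left_mono[OF nrm(1)[of z] e0] by fastforce
  have n2: "norm ?r2 \<le> e * (t * (norm v + norm w))"
    using e[of ?h2] nrm(2)[of z] z t mult_left_mono[OF nrm(2)[of z] e0] by fastforce
  have Ah: "t *\<^sub>R A w = A ?h1 - A ?h2" using lin by (simp add: linear_add linear_cmul)
  have "G (x + z *\<^sub>R v + t *\<^sub>R w) - G (x + z *\<^sub>R v) - t *\<^sub>R A w = ?r1 - ?r2"
    unfolding Ah by (simp add: add.assoc)
  hence "\<bar>(G (x + z *\<^sub>R v + t *\<^sub>R w) - G (x + z *\<^sub>R v)) \<bullet> v - t * (A w \<bullet> v)\<bar> = \<bar>(?r1 - ?r2) \<bullet> v\<bar>"
    by (metis inner_diff_left inner_scaleR_left)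
  also have "\<dots> \<le> norm (?r1 - ?r2) * norm v" by (rule Cauchy_Schwarz_ineq2)
  also have "\<dots> \<le> (norm ?r1 + norm ?r2) * norm v" by (intro mult_right_mono norm_triangle_ineq4) auto
  also have "\<dots> \<le> (e * (t * (norm v + norm w)) + e * (t * (norm v + norm w))) * norm v"
    using n1 n2 by (intro mult_right_mono add_mono) auto
  finally have *: "\<bar>(G (x + z *\<^sub>R v + t *\<^sub>R w) - G (x + z *\<^sub>R v)) \<bullet> v - t * (A w \<bullet> v)\<bar>
     \<le> t * (e * (2 * (norm v + norm w) * norm v))" by (simp add: algebra_simps)
  have "f (x + t *\<^sub>R v + t *\<^sub>R w) - f (x + t *\<^sub>R v) - f (x + t *\<^sub>R w) + f x - t\<^sup>2 * (A w \<bullet> v)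
     = t * ((G (x + z *\<^sub>R v + t *\<^sub>R w) - G (x + z *\<^sub>R v)) \<bullet> v - t * (A w \<bullet> v))"
    using z(3) by (simp add: ph_def power2_eq_square algebra_simps)
  hence "\<bar>f (x + t *\<^sub>R v + t *\<^sub>R w) - f (x + t *\<^sub>R v) - f (x + t *\<^sub>R w) + f x - t\<^sup>2 * (A w \<bullet> v)\<bar>
     = t * \<bar>(G (x + z *\<^sub>R v + t *\<^sub>R w) - G (x + z *\<^sub>R v)) \<bullet> v - t * (A w \<bullet> v)\<bar>"
    using t by (simp add: abs_mult)
  also have "\<dots> \<le> t * (t * (e * (2 * (norm v + norm w) * norm v)))" using * t by (intro mult_left_mono) auto
  finally show ?thesis by (simp add: power2_eq_square mult.assoc)
qed

lemma hessian_symmetric: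
  fixes f :: "'a::real_inner \<Rightarrow> real"
  assumes U: "open U" "x \<in> U" and G: "\<And>y. y \<in> U \<Longrightarrow> GDERIV f y :> G y" and A: "(G has_derivative A) (at x)"
  shows "A v \<bullet> w = v \<bullet> A w"
proof -
  define C where "C = 2 * (norm v + norm w) * norm v + 2 * (norm w + norm v) * norm w"
  have lin: "linear A" using A has_derivative_linear by blast
  have le: "\<bar>A w \<bullet> v - A v \<bullet> w\<bar> \<le> e * C" if e: "e > 0" for e
  proof -
    obtain r1 where r1: "r1 > 0" "ball x r1 \<subseteq> U" using U open_contains_ball by blast
    obtain r2 where r2: "r2 > 0" "\<And>y. norm (y - x) < r2 \<Longrightarrow> norm (G y - G x - A (y - x)) \<le> e * norm (y - x)"
      using A e unfolding has_derivative_at_alt by blast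
    define r where "r = min r1 r2"
    have r: "r > 0" using r1 r2 by (simp add: r_def)
    have Gr: "\<And>y. y \<in> ball x r \<Longrightarrow> GDERIV f y :> G y" using G r1 by (auto simp: r_def)
    have er: "\<And>h. norm h < r \<Longrightarrow> norm (G (x + h) - G x - A h) \<le> e * norm h"
      using r2(2)[of "x + h" for h] by (simp add: r_def)
    define t where "t = r / (2 * (norm v + norm w + 1))"
    have np: "norm v + norm w + 1 > 0" by (smt (verit) norm_ge_zero)
    have t: "t > 0" using r np by (simp add: t_def)
    have "t * (norm v + norm w) < t * (2 * (norm v + norm w + 1))" using t np
      by (intro mult_strict_left_mono) auto
    also have "\<dots> = r" using np by (simp add: t_def)
    finally have room: "t * (norm v + norm w) < r" "t * (norm w + norm v) < r" by (auto simp: add.commute)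
    define D where "D = f (x + t *\<^sub>R v + t *\<^sub>R w) - f (x + t *\<^sub>R v) - f (x + t *\<^sub>R w) + f x"
    have 1: "\<bar>D - t\<^sup>2 * (A w \<bullet> v)\<bar> \<le> t\<^sup>2 * (e * (2 * (norm v + norm w) * norm v))"
      unfolding D_def by (rule hessian_symmetric_aux[OF r Gr er lin t room(1)]) (use e in auto)
    have 2: "\<bar>D - t\<^sup>2 * (A v \<bullet> w)\<bar> \<le> t\<^sup>2 * (e * (2 * (norm w + norm v) * norm w))"
      using hessian_symmetric_aux[OF r Gr er lin t room(2)] e unfolding D_def by (simp add: algebra_simps)
    have "\<bar>t\<^sup>2 * (A w \<bullet> v) - t\<^sup>2 * (A v \<bullet> w)\<bar> \<le>
       t\<^sup>2 * (e * (2 * (norm v + norm w) * norm v)) + t\<^sup>2 * (e * (2 * (norm w + norm v) * norm w))"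
      using 1 2 by linarith
    also have "\<dots> = t\<^sup>2 * (e * C)" by (simp add: C_def algebra_simps)
    finally have "t\<^sup>2 * \<bar>A w \<bullet> v - A v \<bullet> w\<bar> \<le> t\<^sup>2 * (e * C)"
      by (simp add: abs_mult flip: right_diff_distrib)
    thus ?thesis using t by simp
  qed
  have C0: "C \<ge> 0" by (simp add: C_def)
  have "\<bar>A w \<bullet> v - A v \<bullet> w\<bar> \<le> 0"
  proof (rule field_le_epsilon)
    fix e :: real assume "e > 0"
    have "e / (C + 1) * C \<le> e" using C0 \<open>e > 0\<close> by (simp add: field_simps)
    thus "\<bar>A w \<bullet> v - A v \<bullet> w\<bar> \<le> 0 + e" using le[of "e / (C + 1)"] C0 \<open>e > 0\<close> by simp
  qed
  thus ?thesis by (simp add: inner_commute)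
qed

section \<open>The minimum principle\<close>

lemma cut_deriv:
  "GDERIV u x :> g \<Longrightarrow> (\<phi> has_real_derivative D) (at (u x)) \<Longrightarrow>
   ((\<lambda>x. \<phi> (u x)) has_derivative (\<lambda>h. D * (h \<bullet> g))) (at x)"
  using GDERIV_DERIV_compose[of u x g \<phi> D] by (simp add: gderiv_def)

lemma tr_add: "tr (\<lambda>v. A v + B v) = tr A + tr B"
  by (simp add: tr_def inner_add_left sum.distrib)
lemma tr_diff: "tr (\<lambda>v. A v - B v) = tr A - tr B"
  by (simp add: tr_def inner_diff_left sum_subtractf)
lemma tr_scaleR: "tr (\<lambda>v. k *\<^sub>R A v) = k * tr A"
  by (simp add: tr_def sum_distrib_left)
lemma tr_rank_one: "tr (\<lambda>v. (v \<bullet> g) *\<^sub>R z) = g \<bullet> z"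
  by (simp add: tr_def euclidean_inner[of g z] inner_commute)
lemma tr_rank_one': "tr (\<lambda>v. (k * (v \<bullet> g)) *\<^sub>R z) = k * (g \<bullet> z)"
  using tr_scaleR[of k "\<lambda>v. (v \<bullet> g) *\<^sub>R z"] by (simp add: tr_rank_one)
lemma tr_ident: "tr (\<lambda>v::'a::euclidean_space. v) = real DIM('a)"
  by (simp add: tr_def)
lemmas tr_simps = tr_add tr_diff tr_scaleR tr_rank_one tr_rank_one' tr_ident

lemma ramp_at_pos: "e > 0 \<Longrightarrow> t > 2 * e \<Longrightarrow> ramp_at e t > 0"
  using ramp_at_ge[of e t] by linarith

lemma open_superlevel:
  fixes u :: "'a::topological_space \<Rightarrow> real"
  assumes "open S" "continuous_on S u" shows "open {x\<in>S. u x > t}"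
proof -
  have "open (u -` {t<..} \<inter> S)" using continuous_open_preimage[OF assms(2,1)] by (simp add: Int_commute)
  moreover have "u -` {t<..} \<inter> S = {x\<in>S. u x > t}" by auto
  ultimately show ?thesis by simp
qed

lemma compact_superlevel:
  fixes u :: "'a::euclidean_space \<Rightarrow> real"
  assumes "bounded S" "continuous_on (closure S) u" shows "compact {x\<in>closure S. u x \<ge> t}"
proof -
  have "closed (closure S \<inter> u -` {t..})"
    by (rule continuous_closed_preimage[OF assms(2)]) auto
  moreover have "closure S \<inter> u -` {t..} = {x\<in>closure S. u x \<ge> t}" by auto
  moreover have "bounded {x\<in>closure S. u x \<ge> t}"
    by (rule bounded_subset[OF bounded_closure[OF assms(1)]]) auto
  ultimately show ?thesis by (simp add: compact_eq_bounded_closed)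
qed

text \<open>The field \<open>ramp_at e (- v) *\<^sub>R G\<close> is supported where \<open>v \<le> - e\<close>, hence compactly in \<open>\<Omega>\<close>. Its weighted
divergence is the sum of \<open>ramp_at e (- v)\<close> times \<open>L v\<close>, with \<open>L v < 0\<close>, and of \<open>- step_at e (- v) * (G \<bullet> G)\<close>. Both terms are
nonpositive and the total integral is zero, so \<open>v\<close> cannot fall below \<open>- 2 e\<close>.\<close>

lemma minimum_principle:
  fixes v :: "real \<times> 'b::euclidean_space \<Rightarrow> real"
  assumes a: "0 \<le> a" and \<Omega>: "bounded \<Omega>" "open \<Omega>" and cv: "continuous_on (closure \<Omega>) v"
    and G: "\<And>x. x \<in> \<Omega> \<Longrightarrow> GDERIV v x :> G x" and cG: "continuous_on \<Omega> G"
    and H: "\<And>x. x \<in> \<Omega> \<Longrightarrow> fst x \<noteq> 0 \<Longrightarrow> (G has_derivative H x) (at x)"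
    and cH: "\<And>b. continuous_on {x\<in>\<Omega>. fst x \<noteq> 0} (\<lambda>x. H x b)"
    and neg: "\<And>x. x \<in> \<Omega> \<Longrightarrow> fst x \<noteq> 0 \<Longrightarrow> tr (H x) + a / fst x * fst (G x) < 0"
    and M: "\<And>x. x \<in> \<Omega> \<Longrightarrow> fst x \<noteq> 0 \<Longrightarrow> - M \<le> tr (H x) + a / fst x * fst (G x)"
    and bd: "\<And>x. x \<in> frontier \<Omega> \<Longrightarrow> v x \<ge> 0" and x0: "x0 \<in> \<Omega>"
  shows "v x0 \<ge> 0"
proof (rule ccontr)
  assume "\<not> v x0 \<ge> 0"
  \<comment> \<open>With a quarter of the depth, \<open>- v > 3 * e\<close> still holds at points near \<open>x0\<close> off the hyperplane.\<close>
  define e where "e = - v x0 / 4"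
  have e: "e > 0" "v x0 = - 4 * e" using \<open>\<not> v x0 \<ge> 0\<close> by (auto simp: e_def)
  have cv': "continuous_on \<Omega> v" using cv closure_subset continuous_on_subset by blast
  define U where "U = {x\<in>\<Omega>. - v x > e / 2}"
  define K where "K = {x\<in>closure \<Omega>. - v x \<ge> e}"
  have oU: "open U" unfolding U_def using open_superlevel[OF \<Omega>(2), of "\<lambda>x. - v x" "e/2"] cv' by (simp add: continuous_on_minus)
  have K: "compact K" unfolding K_def using compact_superlevel[OF \<Omega>(1), of "\<lambda>x. - v x" e] cv by (simp add: continuous_on_minus)
  have KU: "K \<subseteq> U"
  proof
    fix x assume x: "x \<in> K"
    hence "x \<notin> frontier \<Omega>" using bd[of x] e by (auto simp: K_def)
    hence "x \<in> \<Omega>" using x \<Omega>(2) by (auto simp: K_def frontier_def interior_open)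
    thus "x \<in> U" using x e by (auto simp: K_def U_def)
  qed
  have U\<Omega>: "U \<subseteq> \<Omega>" by (auto simp: U_def)
  have UT: "{x\<in>U. fst x \<notin> {0}} \<subseteq> {x\<in>\<Omega>. fst x \<noteq> 0}" using U\<Omega> by auto
  have cvU: "continuous_on U v" using cv' U\<Omega> by (rule continuous_on_subset)
  have cGU: "continuous_on U G" using cG U\<Omega> by (rule continuous_on_subset)
  have cS: "continuous_on U (\<lambda>x. step_at e (- v x))" "continuous_on U (\<lambda>x. ramp_at e (- v x))"
    using e cvU by (auto intro!: continuous_on_compose2[OF step_at_cont[of e UNIV]]
        continuous_on_compose2[OF ramp_at_cont[of e UNIV]] continuous_intros)
  define L where "L x = tr (H x) + a / fst x * fst (G x)" for x
  define d where "d x = ramp_at e (- v x) * L x - step_at e (- v x) * (G x \<bullet> G x)" for x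
  define Z where "Z x = ramp_at e (- v x) *\<^sub>R G x" for x
  define Z' where "Z' x h = ramp_at e (- v x) *\<^sub>R H x h + (- step_at e (- v x) * (h \<bullet> G x)) *\<^sub>R G x" for x h
  have off: "ramp_at e (- v x) = 0 \<and> step_at e (- v x) = 0" if "x \<in> U" "x \<notin> K" for x
  proof -
    have "- v x < e" using that closure_subset[of \<Omega>] by (auto simp: U_def K_def)
    thus ?thesis using cut_zero[of e "- v x"] e by simp
  qed
  have dZ: "(Z has_derivative Z' x) (at x)" if x: "x \<in> U" "fst x \<notin> {0}" for x
  proof -
    have "((\<lambda>t. ramp_at e (- t)) has_real_derivative - step_at e (- v x)) (at (v x))"
    proof -
      have "(uminus has_real_derivative - 1) (at (v x))" by (auto intro!: derivative_eq_intros)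
      from DERIV_chain2[OF ramp_at_deriv[OF e(1)] this] show ?thesis by simp
    qed
    moreover have x\<Omega>: "x \<in> \<Omega>" "fst x \<noteq> 0" using x U\<Omega> by auto
    ultimately have "((\<lambda>x. ramp_at e (- v x)) has_derivative (\<lambda>h. - step_at e (- v x) * (h \<bullet> G x))) (at x)"
      using cut_deriv[of v x "G x" "\<lambda>t. ramp_at e (- t)" "- step_at e (- v x)"] G by blast
    from has_derivative_scaleR[OF this H[OF x\<Omega>]] show ?thesis
      unfolding Z_def[abs_def] Z'_def[abs_def] .
  qed
  have "bounded ((\<lambda>x. (v x, G x)) ` K)"
    using KU by (intro compact_imp_bounded compact_continuous_image K continuous_intros
       continuous_on_subset[OF cvU] continuous_on_subset[OF cGU])
  then obtain B where B: "\<And>x. x \<in> K \<Longrightarrow> norm (v x, G x) \<le> B" by (auto simp: bounded_iff)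
  have bdd: "\<bar>d x\<bar> \<le> B * \<bar>M\<bar> + 1 * (B * B) \<or> x \<notin> K" if x: "x \<in> U" "fst x \<notin> {0}" for x
  proof (cases "x \<in> K")
    case True
    have nb: "\<bar>v x\<bar> \<le> B" "norm (G x) \<le> B"
      using B[OF True] norm_fst_le[of "v x" "G x"] norm_snd_le[of "G x" "v x"] by auto
    have B0: "B \<ge> 0" using nb(1) by linarith
    have r: "\<bar>ramp_at e (- v x)\<bar> \<le> B"
      using ramp_at_nonneg[of e "- v x"] ramp_at_le[of e "- v x"] e x nb by (auto simp: U_def)
    have l: "\<bar>L x\<bar> \<le> \<bar>M\<bar>" using neg[of x] M[of x] x U\<Omega> by (auto simp: L_def)
    have s: "\<bar>step_at e (- v x)\<bar> \<le> 1" using step_at_nonneg step_at_le by (simp add: abs_of_nonneg)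
    have g: "\<bar>G x \<bullet> G x\<bar> \<le> B * B" using nb(2) B0
      by (simp add: dot_square_norm power2_eq_square mult_mono)
    have "\<bar>d x\<bar> \<le> \<bar>ramp_at e (- v x)\<bar> * \<bar>L x\<bar> + \<bar>step_at e (- v x)\<bar> * \<bar>G x \<bullet> G x\<bar>"
      unfolding d_def abs_mult[symmetric] by (rule abs_triangle_ineq4)
    also have "\<dots> \<le> B * \<bar>M\<bar> + 1 * (B * B)"
      using r l s g B0 by (intro add_mono mult_mono) auto
    finally show ?thesis by simp
  qed simp
  have bdd': "\<bar>d x\<bar> \<le> \<bar>B * \<bar>M\<bar> + 1 * (B * B)\<bar>" if x: "x \<in> U" "fst x \<notin> {0}" for x
    using bdd[OF x] off[OF x(1)] by (cases "x \<in> K") (auto simp: d_def)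
  have cZ': "continuous_on {x\<in>U. fst x \<notin> {0}} (\<lambda>x. Z' x b)" for b
    unfolding Z'_def
    by (intro continuous_intros continuous_on_subset[OF cH UT] continuous_on_subset[OF cGU]
      continuous_on_subset[OF cS(1)] continuous_on_subset[OF cS(2)]) auto
  have trd: "tr (Z' x) + a / fst x * fst (Z x) = d x" for x
    unfolding Z'_def tr_simps by (simp add: Z_def d_def L_def algebra_simps)
  have T: "finite {0::real}" "0 \<in> {0::real}" by auto
  have cZ: "continuous_on U (\<lambda>x. wt a (fst x) *\<^sub>R Z x)" unfolding Z_def by (intro continuous_intros wt_cont a cS cGU)
  have ZK: "Z x = 0" if "x \<in> U" "x \<notin> K" for x using off[OF that] by (simp add: Z_def)
  have I: "integrable lborel (\<lambda>x. indicator {x\<in>U. fst x \<notin> {0}} x * (wt a (fst x) * d x))"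
    "integral\<^sup>L lborel (\<lambda>x. indicator {x\<in>U. fst x \<notin> {0}} x * (wt a (fst x) * d x)) = 0"
    by (rule divergence_weighted_bounded[OF a T oU K KU cZ ZK dZ cZ' trd bdd']; assumption)+
  let ?V = "{x\<in>U. fst x \<notin> {0}}"
  have oV: "open ?V" using open_Int[OF oU open_fst_notin[of "{0}"]] by (simp add: Int_def)
  have dle: "d x \<le> 0" if "x \<in> ?V" for x
  proof -
    have "L x < 0" using neg[of x] that U\<Omega> by (auto simp: L_def)
    hence "ramp_at e (- v x) * L x \<le> 0" using ramp_at_nonneg[OF e(1)] by (simp add: mult_nonneg_nonpos)
    moreover have "step_at e (- v x) * (G x \<bullet> G x) \<ge> 0" using step_at_nonneg by simp
    ultimately show ?thesis by (simp add: d_def)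
  qed
  have cd: "continuous_on ?V (\<lambda>x. - (wt a (fst x) * d x))"
  proof -
    have "continuous_on ?V (\<lambda>x. tr (H x))" by (rule tr_cont) (rule continuous_on_subset[OF cH UT])
    thus ?thesis unfolding d_def L_def
      by (intro continuous_intros wt_cont a continuous_on_subset[OF cGU]
      continuous_on_subset[OF cS(1)] continuous_on_subset[OF cS(2)]) auto
  qed
  have z: "- (wt a (fst x) * d x) = 0" if "x \<in> ?V" for x
  proof (rule nonneg_continuous_integral_zero[OF oV cd _ _ _ that])
    show "0 \<le> - (wt a (fst x) * d x)" if "x \<in> ?V" for x
      using dle[OF that] wt_nonneg[of a "fst x"] by (simp add: mult_nonneg_nonpos)
    show "integrable lborel (\<lambda>x. indicator ?V x * - (wt a (fst x) * d x))" using I(1) by simp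
    show "integral\<^sup>L lborel (\<lambda>x. indicator ?V x * - (wt a (fst x) * d x)) = 0" using I(2) by simp
  qed
  have "open {x\<in>\<Omega>. - v x > 3 * e}" using open_superlevel[OF \<Omega>(2), of "\<lambda>x. - v x" "3*e"] cv' by (simp add: continuous_on_minus)
  moreover have "x0 \<in> {x\<in>\<Omega>. - v x > 3 * e}" using x0 e by simp
  ultimately obtain y where y: "y \<in> \<Omega>" "- v y > 3 * e" "fst y \<noteq> 0" using exists_off_plane[of _ x0 0] by blast
  have yV: "y \<in> ?V" using y e by (simp add: U_def)
  have "ramp_at e (- v y) > 0" using y e by (intro ramp_at_pos) auto
  hence "ramp_at e (- v y) * L y < 0" using neg[OF y(1,3)] by (simp add: L_def mult_pos_neg)
  moreover have "step_at e (- v y) * (G y \<bullet> G y) \<ge> 0" using step_at_nonneg by simp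
  ultimately have "d y < 0" by (simp add: d_def)
  thus False using z[OF yV] wt_pos[OF y(3), of a] by simp
qed

section \<open>The overdetermined problem\<close>

text \<open>Solutions of the overdetermined problem with their gradient \<open>G\<close> (continuous up to the boundary) and
Hessian \<open>H\<close> (continuous off the hyperplane \<open>r = 0\<close>), over a Euclidean space \<open>'b\<close> of any dimension.\<close>

locale overdetermined =
  fixes a c :: real and \<Omega> :: "(real \<times> 'b::euclidean_space) set" and u :: "real \<times> 'b \<Rightarrow> real"
    and G :: "real \<times> 'b \<Rightarrow> real \<times> 'b" and H :: "real \<times> 'b \<Rightarrow> real \<times> 'b \<Rightarrow> real \<times> 'b"
  assumes a_nonneg: "0 \<le> a" and bounded_\<Omega>: "bounded \<Omega>" and open_\<Omega>: "open \<Omega>"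
    and u_cont: "continuous_on (closure \<Omega>) u" and G_cont: "continuous_on (closure \<Omega>) G"
    and u_grad: "\<And>x. x \<in> \<Omega> \<Longrightarrow> GDERIV u x :> G x"
    and G_deriv: "\<And>x. x \<in> \<Omega> \<Longrightarrow> fst x \<noteq> 0 \<Longrightarrow> (G has_derivative H x) (at x)"
    and H_cont: "\<And>v. continuous_on {x\<in>\<Omega>. fst x \<noteq> 0} (\<lambda>x. H x v)"
    and pde: "\<And>x. x \<in> \<Omega> \<Longrightarrow> fst x \<noteq> 0 \<Longrightarrow> tr (H x) + a / fst x * fst (G x) = - 1"
    and u_bdry: "\<And>x. x \<in> frontier \<Omega> \<Longrightarrow> u x = 0"
    and G_bdry: "\<And>x. x \<in> frontier \<Omega> \<Longrightarrow> norm (G x) = c"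
begin

lemma u_nonneg: "x \<in> \<Omega> \<Longrightarrow> u x \<ge> 0"
  by (rule minimum_principle[OF a_nonneg bounded_\<Omega> open_\<Omega> u_cont u_grad
      continuous_on_subset[OF G_cont closure_subset] G_deriv H_cont, where M = 1])
    (use pde u_bdry in auto)

text \<open>For integral \<open>a\<close> this is the dimension of the space in which \<open>L\<^sub>a\<close> is the Laplacian of functions
that are radial in \<open>a + 1\<close> variables.\<close>

definition N :: real where "N = a + 1 + real DIM('b)"

lemma N_pos: "N > 0" "N > 1"
proof -
  have "real DIM('b) > 0" by simp
  thus "N > 0" "N > 1" using a_nonneg unfolding N_def by linarith+
qed

lemma H_sym: "x \<in> \<Omega> \<Longrightarrow> fst x \<noteq> 0 \<Longrightarrow> H x v \<bullet> w = v \<bullet> H x w"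
  using hessian_symmetric[OF open_\<Omega> _ u_grad G_deriv] by blast

lemma H_linear: "x \<in> \<Omega> \<Longrightarrow> fst x \<noteq> 0 \<Longrightarrow> linear (H x)"
  using G_deriv has_derivative_linear by blast

text \<open>Half of the explicit solution on a small ball around \<open>x0\<close> is a barrier from below. The factor one
half makes the differential inequality for the difference strict. For centres off the hyperplane the
ball is so small that \<open>(r - r\<^sub>0) / r\<close> stays within \<open>[- 1, 1]\<close>; for centres on it this quotient is \<open>1\<close>.\<close>

lemma u_pos: assumes x0: "x0 \<in> \<Omega>" shows "u x0 > 0"
proof -
  obtain r1 where r1: "r1 > 0" "cball x0 r1 \<subseteq> \<Omega>" using open_\<Omega> x0 open_contains_cball by blast
  define r where "r = (if fst x0 = 0 then r1 else min r1 (\<bar>fst x0\<bar> / 2))"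
  have r: "r > 0" "r \<le> r1" using r1 by (auto simp: r_def)
  have rb: "cball x0 r \<subseteq> \<Omega>" using r1 r by auto
  define B where "B = ball x0 r"
  have B: "B \<subseteq> \<Omega>" "closure B = cball x0 r" using rb r by (auto simp: B_def)
  define s where "s = 1 / (4 * N)"
  have s: "s > 0" using N_pos by (simp add: s_def)
  define v where "v x = u x - s * (r\<^sup>2 - (x - x0) \<bullet> (x - x0))" for x
  define Gv where "Gv x = G x + (2 * s) *\<^sub>R (x - x0)" for x
  define Hv where "Hv x h = H x h + (2 * s) *\<^sub>R h" for x h
  define qq where "qq x = (fst x - fst x0) / fst x" for x :: "real \<times> 'b"
  have q: "\<bar>qq x\<bar> \<le> 1" if "x \<in> B" "fst x \<noteq> 0" for x
  proof (cases "fst x0 = 0")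
    case False
    have "\<bar>fst x - fst x0\<bar> \<le> dist x x0" using dist_fst_le[of x x0] by (simp add: dist_real_def)
    also have "\<dots> < r" using that by (simp add: B_def dist_commute)
    also have "\<dots> \<le> \<bar>fst x0\<bar> / 2" using False by (simp add: r_def)
    finally have "\<bar>fst x - fst x0\<bar> < \<bar>fst x0\<bar> / 2" .
    hence "\<bar>fst x - fst x0\<bar> \<le> \<bar>fst x\<bar>" by linarith
    thus ?thesis using that by (simp add: field_simps qq_def)
  qed (use that in \<open>simp add: qq_def\<close>)
  have L: "tr (Hv x) + a / fst x * fst (Gv x) = - 1 + 2 * s * (1 + real DIM('b) + a * qq x)"
    if "x \<in> B" "fst x \<noteq> 0" for x
  proof -
    have "tr (Hv x) = tr (H x) + 2 * s * (1 + real DIM('b))" unfolding Hv_def tr_simps by simp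
    moreover have "a / fst x * fst (Gv x) = a / fst x * fst (G x) + 2 * s * (a * qq x)"
      unfolding Gv_def qq_def by (simp add: distrib_left)
    moreover have "tr (H x) + a / fst x * fst (G x) = - 1" using pde[of x] that B(1) by blast
    ultimately show ?thesis unfolding distrib_left by linarith
  qed
  have aq: "\<bar>a * qq x\<bar> \<le> a" if "x \<in> B" "fst x \<noteq> 0" for x
    using mult_left_mono[OF q[OF that] a_nonneg] a_nonneg by (simp add: abs_mult)
  have "v x0 \<ge> 0"
  proof (rule minimum_principle[OF a_nonneg, of B v Gv Hv "1 + 2 * s * a" x0])
    show "bounded B" "open B" "x0 \<in> B" using r by (auto simp: B_def)
    show "continuous_on (closure B) v" unfolding v_def B
      using rb closure_subset[of \<Omega>] by (intro continuous_intros continuous_on_subset[OF u_cont]) auto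
    show "continuous_on B Gv" unfolding Gv_def
      using B closure_subset[of \<Omega>] by (intro continuous_intros continuous_on_subset[OF G_cont]) auto
    show "continuous_on {x\<in>B. fst x \<noteq> 0} (\<lambda>x. Hv x b)" for b unfolding Hv_def
      using B by (intro continuous_intros continuous_on_subset[OF H_cont]) auto
    show "v x \<ge> 0" if "x \<in> frontier B" for x
    proof -
      have "dist x0 x = r" using that r by (auto simp: B_def frontier_ball)
      hence "(x - x0) \<bullet> (x - x0) = r\<^sup>2" by (metis dist_norm dist_commute power2_norm_eq_inner)
      moreover have "x \<in> \<Omega>" using \<open>dist x0 x = r\<close> rb by auto
      ultimately show ?thesis using u_nonneg by (simp add: v_def)
    qed
    fix x assume x: "x \<in> B"
    show "GDERIV v x :> Gv x"
      unfolding gderiv_def v_def[abs_def] Gv_def using u_grad[of x] x B(1) unfolding gderiv_def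
      by (auto intro!: derivative_eq_intros simp: inner_add_right algebra_simps inner_commute)
    assume x': "fst x \<noteq> 0"
    show "(Gv has_derivative Hv x) (at x)"
      unfolding Gv_def[abs_def] Hv_def[abs_def] using x x' B(1)
      by (auto intro!: derivative_eq_intros G_deriv)
    have "2 * s * (1 + real DIM('b) + a * qq x) \<le> 2 * s * N"
      using aq[OF x x'] s by (intro mult_left_mono) (auto simp: N_def)
    also have "\<dots> = 1 / 2" using N_pos by (simp add: s_def)
    finally show "tr (Hv x) + a / fst x * fst (Gv x) < 0" unfolding L[OF x x'] by simp
    have "2 * s * (1 + real DIM('b) + a * qq x) \<ge> 2 * s * (- a)"
      using aq[OF x x'] s by (intro mult_left_mono) (auto)
    thus "- (1 + 2 * s * a) \<le> tr (Hv x) + a / fst x * fst (Gv x)" unfolding L[OF x x'] by simp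
  qed
  hence "u x0 \<ge> s * r\<^sup>2" by (simp add: v_def)
  moreover have "s * r\<^sup>2 > 0" using s r by simp
  ultimately show ?thesis by linarith
qed

text \<open>\<open>Q\<close> and \<open>HQ\<close> are the gradient and the Hessian of \<open>q = u + \<bar>x\<bar>\<^sup>2 / (2 N)\<close>, which solves \<open>L\<^sub>a q = 0\<close> and is
affine exactly when \<open>u\<close> is one of the quadratic polynomials of the conclusion.\<close>

definition Q where "Q x = G x + (1 / N) *\<^sub>R x"
definition HQ where "HQ x v = H x v + (1 / N) *\<^sub>R v"

lemma Q_cont: "continuous_on (closure \<Omega>) Q" unfolding Q_def by (intro continuous_intros G_cont)
lemma Q_deriv: "x \<in> \<Omega> \<Longrightarrow> fst x \<noteq> 0 \<Longrightarrow> (Q has_derivative HQ x) (at x)"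
  unfolding Q_def[abs_def] HQ_def[abs_def] by (auto intro!: derivative_eq_intros G_deriv)
lemma HQ_cont: "continuous_on {x\<in>\<Omega>. fst x \<noteq> 0} (\<lambda>x. HQ x v)"
  unfolding HQ_def by (intro continuous_intros H_cont)
lemma Q_pde: "x \<in> \<Omega> \<Longrightarrow> fst x \<noteq> 0 \<Longrightarrow> tr (HQ x) + a / fst x * fst (Q x) = 0"
proof -
  assume x: "x \<in> \<Omega>" "fst x \<noteq> 0"
  have "tr (HQ x) + a / fst x * fst (Q x) = (tr (H x) + a / fst x * fst (G x)) + (1 / N) * (a + 1 + real DIM('b))"
    unfolding HQ_def Q_def tr_simps using x by (simp add: algebra_simps add_divide_distrib)
  thus ?thesis using pde[OF x] N_pos by (simp add: N_def)
qed
lemma HQ_sym: "x \<in> \<Omega> \<Longrightarrow> fst x \<noteq> 0 \<Longrightarrow> HQ x v \<bullet> w = v \<bullet> HQ x w"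
  unfolding HQ_def by (simp add: inner_add_left inner_add_right H_sym)

text \<open>Fields cut off by functions of \<open>u\<close> at scale \<open>e\<close> vanish on \<open>U e\<close> outside the compact set \<open>K e \<subseteq> U e\<close>.\<close>

definition U where "U e = {x\<in>\<Omega>. u x > e / 2}"
definition K where "K e = {x\<in>closure \<Omega>. u x \<ge> e}"

lemma U_open: "open (U e)" unfolding U_def
  by (rule open_superlevel[OF open_\<Omega> continuous_on_subset[OF u_cont closure_subset]])
lemma U_sub: "U e \<subseteq> \<Omega>" by (auto simp: U_def)
lemma K_compact: "compact (K e)" unfolding K_def by (rule compact_superlevel[OF bounded_\<Omega> u_cont])
lemma K_sub: "e > 0 \<Longrightarrow> K e \<subseteq> \<Omega>"
  using u_bdry open_\<Omega> by (fastforce simp: K_def frontier_def interior_open)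
lemma K_sub_U: "e > 0 \<Longrightarrow> K e \<subseteq> U e"
  using K_sub[of e] by (auto simp: K_def U_def)
lemma U_sub_K: "U e \<subseteq> K (e / 2)" using closure_subset[of \<Omega>] by (auto simp: K_def U_def)
lemma off_K: "e > 0 \<Longrightarrow> x \<in> U e \<Longrightarrow> x \<notin> K e \<Longrightarrow> ramp_at e (u x) = 0 \<and> step_at e (u x) = 0 \<and> bump_at e (u x) = 0"
  using closure_subset[of \<Omega>] by (intro cut_zero) (auto simp: K_def U_def)
lemma U_cont:
  shows "continuous_on (U e) u" "continuous_on (U e) G" "continuous_on (U e) Q"
  by (rule continuous_on_subset[OF u_cont] continuous_on_subset[OF G_cont] continuous_on_subset[OF Q_cont],
      rule subset_trans[OF U_sub closure_subset])+
lemma UH_cont: "finite T \<Longrightarrow> 0 \<in> T \<Longrightarrow> continuous_on {x\<in>U e. fst x \<notin> T} (\<lambda>x. HQ x v)"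
    "finite T \<Longrightarrow> 0 \<in> T \<Longrightarrow> continuous_on {x\<in>U e. fst x \<notin> T} (\<lambda>x. H x v)"
  using U_sub by (intro continuous_on_subset[OF HQ_cont] continuous_on_subset[OF H_cont], fastforce)+
lemma cut_cont:
  assumes "e > 0"
  shows "continuous_on (U e) (\<lambda>x. ramp_at e (u x))" "continuous_on (U e) (\<lambda>x. step_at e (u x))" "continuous_on (U e) (\<lambda>x. bump_at e (u x))"
  by (rule continuous_on_compose2[OF ramp_at_cont[OF assms, of UNIV] U_cont(1)]
      continuous_on_compose2[OF step_at_cont[OF assms, of UNIV] U_cont(1)]
      continuous_on_compose2[OF bump_at_cont[OF assms, of UNIV] U_cont(1)], simp)+
lemma ramp_at_u_deriv: "e > 0 \<Longrightarrow> x \<in> \<Omega> \<Longrightarrow> ((\<lambda>x. ramp_at e (u x)) has_derivative (\<lambda>h. step_at e (u x) * (h \<bullet> G x))) (at x)"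
  by (rule cut_deriv[OF u_grad ramp_at_deriv])
lemma step_at_u_deriv: "e > 0 \<Longrightarrow> x \<in> \<Omega> \<Longrightarrow> ((\<lambda>x. step_at e (u x)) has_derivative (\<lambda>h. bump_at e (u x) * (h \<bullet> G x))) (at x)"
  by (rule cut_deriv[OF u_grad step_at_deriv])

section \<open>Integral identities\<close>

lemma G_inner_deriv:
  assumes x: "x \<in> \<Omega>" "fst x \<noteq> 0"
  shows "((\<lambda>x. G x \<bullet> G x) has_derivative (\<lambda>h. 2 * (h \<bullet> H x (G x)))) (at x)"
  by (rule has_derivative_eq_rhs[OF has_derivative_inner[OF G_deriv[OF x] G_deriv[OF x]]])
     (simp add: fun_eq_iff H_sym[OF x] inner_commute[of "G x"])

lemma Q_inner_deriv:
  assumes x: "x \<in> \<Omega>" "fst x \<noteq> 0"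
  shows "((\<lambda>x. Q x \<bullet> Q x) has_derivative (\<lambda>h. 2 * (h \<bullet> HQ x (Q x)))) (at x)"
  by (rule has_derivative_eq_rhs[OF has_derivative_inner[OF Q_deriv[OF x] Q_deriv[OF x]]])
     (simp add: fun_eq_iff HQ_sym[OF x] inner_commute[of "Q x"])

lemma zero_plane: "finite {0::real}" "0 \<in> {0::real}" by auto

text \<open>The integrand is the weighted divergence of
\<open>step_at e u *\<^sub>R ((c\<^sup>2 - \<bar>G\<bar>\<^sup>2) *\<^sub>R Q + \<bar>Q\<bar>\<^sup>2 *\<^sub>R G) - (2 / N) *\<^sub>R (ramp_at e u *\<^sub>R Q)\<close>, which is Pohozaev's
multiplier argument in one field. The second derivatives cancel because the Hessian is symmetric:
the two products leave \<open>2 ((HQ Q) \<bullet> G - (H G) \<bullet> Q) = (2 / N) (G \<bullet> Q)\<close>, which the last term removes.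
On the boundary, where \<open>\<bar>G\<bar> = c\<close> and \<open>u = 0\<close>, the field reduces to \<open>\<bar>Q\<bar>\<^sup>2 *\<^sub>R G\<close>.\<close>

lemma key_identity:
  assumes e: "e > 0"
  defines "d \<equiv> \<lambda>x. bump_at e (u x) * ((c\<^sup>2 - G x \<bullet> G x) * (G x \<bullet> Q x) + (Q x \<bullet> Q x) * (G x \<bullet> G x)) - step_at e (u x) * (Q x \<bullet> Q x)"
  shows "set_integrable lborel (U e) (\<lambda>x. wt a (fst x) * d x)"
    and "(LINT x:U e|lborel. wt a (fst x) * d x) = 0"
proof -
  define Y where "Y x = (c\<^sup>2 - G x \<bullet> G x) *\<^sub>R Q x + (Q x \<bullet> Q x) *\<^sub>R G x" for x
  define Y' where "Y' x h = (c\<^sup>2 - G x \<bullet> G x) *\<^sub>R HQ x h + (- 2 * (h \<bullet> H x (G x))) *\<^sub>R Q x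
      + ((Q x \<bullet> Q x) *\<^sub>R H x h + (2 * (h \<bullet> HQ x (Q x))) *\<^sub>R G x)" for x h
  define Z where "Z x = step_at e (u x) *\<^sub>R Y x - (2 / N) *\<^sub>R (ramp_at e (u x) *\<^sub>R Q x)" for x
  define Z' where "Z' x h = step_at e (u x) *\<^sub>R Y' x h + (bump_at e (u x) * (h \<bullet> G x)) *\<^sub>R Y x
      - (2 / N) *\<^sub>R (ramp_at e (u x) *\<^sub>R HQ x h + (step_at e (u x) * (h \<bullet> G x)) *\<^sub>R Q x)" for x h
  have dZ: "(Z has_derivative Z' x) (at x)" if "x \<in> U e" "fst x \<notin> {0}" for x
  proof -
    have x: "x \<in> \<Omega>" "fst x \<noteq> 0" using that U_sub by auto
    have 1: "((\<lambda>x. c\<^sup>2 - G x \<bullet> G x) has_derivative (\<lambda>h. - 2 * (h \<bullet> H x (G x)))) (at x)"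
      using has_derivative_diff[OF has_derivative_const[of "c\<^sup>2"] G_inner_deriv[OF x]] by simp
    have "(Y has_derivative Y' x) (at x)"
      unfolding Y_def[abs_def] Y'_def[abs_def]
      by (intro has_derivative_add has_derivative_scaleR 1 Q_deriv G_deriv Q_inner_deriv x)
    thus ?thesis
      unfolding Z_def[abs_def] Z'_def[abs_def] using e x
      by (intro has_derivative_diff has_derivative_scaleR has_derivative_scaleR_right Q_deriv ramp_at_u_deriv step_at_u_deriv)
  qed
  have cZ: "continuous_on (U e) Z" unfolding Z_def Y_def by (intro continuous_intros U_cont cut_cont e)
  have sub: "{x\<in>U e. fst x \<notin> {0}} \<subseteq> U e" by auto
  \<comment> \<open>\<open>H x v\<close> is continuous in \<open>x\<close> for fixed \<open>v\<close>; linearity allows \<open>v\<close> to vary with \<open>x\<close>.\<close>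
  have cHv: "continuous_on {x\<in>U e. fst x \<notin> {0}} (\<lambda>x. H x (f x))"
    if "continuous_on {x\<in>U e. fst x \<notin> {0}} f" for f :: "real \<times> 'b \<Rightarrow> real \<times> 'b"
  proof -
    have "continuous_on {x\<in>U e. fst x \<notin> {0}} (\<lambda>x. \<Sum>b\<in>Basis. (f x \<bullet> b) *\<^sub>R H x b)"
      by (intro continuous_intros that UH_cont zero_plane)
    thus ?thesis
    proof (rule continuous_on_eq)
      fix x assume "x \<in> {x\<in>U e. fst x \<notin> {0}}"
      hence "x \<in> \<Omega>" "fst x \<noteq> 0" using U_sub by auto
      hence lin: "linear (H x)" by (rule H_linear)
      have "H x (f x) = H x (\<Sum>b\<in>Basis. (f x \<bullet> b) *\<^sub>R b)" by (simp add: euclidean_representation)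
      also have "\<dots> = (\<Sum>b\<in>Basis. (f x \<bullet> b) *\<^sub>R H x b)"
        by (simp add: linear_sum[OF lin] linear_cmul[OF lin])
      finally show "(\<Sum>b\<in>Basis. (f x \<bullet> b) *\<^sub>R H x b) = H x (f x)" by simp
    qed
  qed
  have cHQv: "continuous_on {x\<in>U e. fst x \<notin> {0}} (\<lambda>x. HQ x (f x))"
    if "continuous_on {x\<in>U e. fst x \<notin> {0}} f" for f :: "real \<times> 'b \<Rightarrow> real \<times> 'b"
    unfolding HQ_def by (intro continuous_intros cHv that)
  have cZ': "continuous_on {x\<in>U e. fst x \<notin> {0}} (\<lambda>x. Z' x b)" for b
    unfolding Z'_def Y'_def Y_def
    by (intro continuous_intros cHv cHQv continuous_on_subset[OF U_cont(1) sub] continuous_on_subset[OF U_cont(2) sub]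
       continuous_on_subset[OF U_cont(3) sub] continuous_on_subset[OF cut_cont(1)[OF e] sub]
       continuous_on_subset[OF cut_cont(2)[OF e] sub] continuous_on_subset[OF cut_cont(3)[OF e] sub])
  have ZK: "Z x = 0" if "x \<in> U e" "x \<notin> K e" for x using off_K[OF e that] by (simp add: Z_def)
  have trd: "tr (Z' x) + a / fst x * fst (Z x) = d x" if "x \<in> U e" "fst x \<notin> {0}" for x
  proof -
    have x: "x \<in> \<Omega>" "fst x \<noteq> 0" using that U_sub by auto
    define tq where "tq = a / fst x * fst (Q x)"
    define tg where "tg = a / fst x * fst (G x)"
    have s: "HQ x (Q x) \<bullet> G x = H x (G x) \<bullet> Q x + (1 / N) * (G x \<bullet> Q x)"
      using H_sym[OF x, of "Q x" "G x"] by (simp add: HQ_def inner_add_left inner_add_right inner_commute)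
    have 1: "tr (Z' x) = step_at e (u x) * ((c\<^sup>2 - G x \<bullet> G x) * tr (HQ x) - 2 * (H x (G x) \<bullet> Q x)
        + ((Q x \<bullet> Q x) * tr (H x) + 2 * (HQ x (Q x) \<bullet> G x))) + bump_at e (u x) * (G x \<bullet> Y x)
        - (2 / N) * (ramp_at e (u x) * tr (HQ x) + step_at e (u x) * (G x \<bullet> Q x))"
      unfolding Z'_def Y'_def tr_simps by simp
    have 2: "a / fst x * fst (Z x) = step_at e (u x) * ((c\<^sup>2 - G x \<bullet> G x) * tq + (Q x \<bullet> Q x) * tg) - (2 / N) * (ramp_at e (u x) * tq)"
      unfolding Z_def Y_def tq_def tg_def by (simp add: algebra_simps)
    have 3: "tr (HQ x) = - tq" "tr (H x) = - 1 - tg"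
      using Q_pde[OF x] pde[OF x] by (simp_all add: tq_def tg_def)
    have 4: "G x \<bullet> Y x = (c\<^sup>2 - G x \<bullet> G x) * (G x \<bullet> Q x) + (Q x \<bullet> Q x) * (G x \<bullet> G x)"
      by (simp add: Y_def inner_add_right)
    show ?thesis unfolding 1 2 3 4 s d_def by (simp add: algebra_simps)
  qed
  have cd: "continuous_on (U e) d" unfolding d_def by (intro continuous_intros U_cont cut_cont e)
  show "set_integrable lborel (U e) (\<lambda>x. wt a (fst x) * d x)" "(LINT x:U e|lborel. wt a (fst x) * d x) = 0"
    by (rule divergence_weighted[OF a_nonneg zero_plane U_open K_compact K_sub_U[OF e] cZ ZK dZ cZ' trd cd]; assumption)+
qed

text \<open>The field \<open>step_at e u *\<^sub>R G\<close> gives a bound for the mass of \<open>bump_at e u * \<bar>G\<bar>\<^sup>2\<close>, a smeared-out boundary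
integral, that does not depend on \<open>e\<close>.\<close>

lemma mass_identity:
  assumes e: "e > 0"
  defines "d \<equiv> \<lambda>x. bump_at e (u x) * (G x \<bullet> G x) - step_at e (u x)"
  shows "set_integrable lborel (U e) (\<lambda>x. wt a (fst x) * d x)"
    and "(LINT x:U e|lborel. wt a (fst x) * d x) = 0"
proof -
  define Z where "Z x = step_at e (u x) *\<^sub>R G x" for x
  define Z' where "Z' x h = step_at e (u x) *\<^sub>R H x h + (bump_at e (u x) * (h \<bullet> G x)) *\<^sub>R G x" for x h
  have dZ: "(Z has_derivative Z' x) (at x)" if "x \<in> U e" "fst x \<notin> {0}" for x
    unfolding Z_def[abs_def] Z'_def[abs_def] using e that U_sub
    by (intro has_derivative_scaleR G_deriv step_at_u_deriv) auto
  have cZ: "continuous_on (U e) Z" unfolding Z_def by (intro continuous_intros U_cont cut_cont e)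
  have sub: "{x\<in>U e. fst x \<notin> {0}} \<subseteq> U e" by auto
  have cZ': "continuous_on {x\<in>U e. fst x \<notin> {0}} (\<lambda>x. Z' x b)" for b
    unfolding Z'_def
    by (intro continuous_intros UH_cont zero_plane continuous_on_subset[OF U_cont(2) sub]
       continuous_on_subset[OF cut_cont(2)[OF e] sub] continuous_on_subset[OF cut_cont(3)[OF e] sub])
  have ZK: "Z x = 0" if "x \<in> U e" "x \<notin> K e" for x using off_K[OF e that] by (simp add: Z_def)
  have trd: "tr (Z' x) + a / fst x * fst (Z x) = d x" if "x \<in> U e" "fst x \<notin> {0}" for x
  proof -
    have x: "x \<in> \<Omega>" "fst x \<noteq> 0" using that U_sub by auto
    define tg where "tg = a / fst x * fst (G x)"
    have 1: "tr (Z' x) = step_at e (u x) * tr (H x) + bump_at e (u x) * (G x \<bullet> G x)"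
      unfolding Z'_def tr_simps by simp
    have 2: "a / fst x * fst (Z x) = step_at e (u x) * tg" by (simp add: Z_def tg_def)
    have 3: "tr (H x) = - 1 - tg" using pde[OF x] by (simp add: tg_def)
    show ?thesis unfolding 1 2 3 d_def by (simp add: algebra_simps)
  qed
  have cd: "continuous_on (U e) d" unfolding d_def by (intro continuous_intros U_cont cut_cont e)
  show "set_integrable lborel (U e) (\<lambda>x. wt a (fst x) * d x)" "(LINT x:U e|lborel. wt a (fst x) * d x) = 0"
    by (rule divergence_weighted[OF a_nonneg zero_plane U_open K_compact K_sub_U[OF e] cZ ZK dZ cZ' trd cd]; assumption)+
qed

text \<open>Green's identity for \<open>\<theta> \<circ> v\<close> and \<open>ramp_at e \<circ> u\<close>, from the field
\<open>(ramp_at e u * \<theta>' v) *\<^sub>R g - (\<theta> v * step_at e u) *\<^sub>R G\<close>; here \<open>l\<close> is \<open>L v\<close>. For convex \<open>\<theta>\<close> the term with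
\<open>\<theta>''\<close> has a sign. The sets \<open>S\<close> and \<open>C\<close> allow \<open>v\<close> to be badly behaved near the hyperplane if \<open>\<theta> \<circ> v\<close>
vanishes there.\<close>

lemma green_convex:
  assumes e: "e > 0" and T: "finite T" "0 \<in> T" and S: "open S" and C: "closed C" "C \<subseteq> S"
    and v: "\<And>x. x \<in> U e \<inter> S \<Longrightarrow> GDERIV v x :> g x" and cg: "continuous_on (U e \<inter> S) g"
    and g': "\<And>x. x \<in> U e \<inter> S \<Longrightarrow> fst x \<notin> T \<Longrightarrow> (g has_derivative g' x) (at x)"
    and cg': "\<And>b. continuous_on {x\<in>U e \<inter> S. fst x \<notin> T} (\<lambda>x. g' x b)"
    and l: "\<And>x. x \<in> U e \<inter> S \<Longrightarrow> fst x \<notin> T \<Longrightarrow> tr (g' x) + a / fst x * fst (g x) = l x"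
    and cl: "continuous_on (U e \<inter> S) l"
    and \<theta>: "\<And>t. (\<theta> has_real_derivative \<theta>' t) (at t)" "\<And>t. (\<theta>' has_real_derivative \<theta>'' t) (at t)"
       "continuous_on UNIV \<theta>''"
    and off: "\<And>x. x \<in> U e \<inter> S \<Longrightarrow> x \<notin> C \<Longrightarrow> \<theta> (v x) = 0 \<and> \<theta>' (v x) = 0"
  defines "d \<equiv> \<lambda>x. ramp_at e (u x) * (\<theta>'' (v x) * (g x \<bullet> g x) + \<theta>' (v x) * l x)
      - \<theta> (v x) * (bump_at e (u x) * (G x \<bullet> G x) - step_at e (u x))"
  shows "set_integrable lborel (U e \<inter> S) (\<lambda>x. wt a (fst x) * d x)"
    and "(LINT x:U e \<inter> S|lborel. wt a (fst x) * d x) = 0"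
proof -
  let ?U = "U e \<inter> S" and ?K = "K e \<inter> C"
  define Z where "Z x = (ramp_at e (u x) * \<theta>' (v x)) *\<^sub>R g x - (\<theta> (v x) * step_at e (u x)) *\<^sub>R G x" for x
  define Z' where "Z' x h = (ramp_at e (u x) * \<theta>' (v x)) *\<^sub>R g' x h
      + (ramp_at e (u x) * (\<theta>'' (v x) * (h \<bullet> g x)) + step_at e (u x) * (h \<bullet> G x) * \<theta>' (v x)) *\<^sub>R g x
      - ((\<theta> (v x) * step_at e (u x)) *\<^sub>R H x h
      + (\<theta> (v x) * (bump_at e (u x) * (h \<bullet> G x)) + \<theta>' (v x) * (h \<bullet> g x) * step_at e (u x)) *\<^sub>R G x)" for x h
  have dZ: "(Z has_derivative Z' x) (at x)" if x: "x \<in> ?U" "fst x \<notin> T" for x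
  proof -
    have x\<Omega>: "x \<in> \<Omega>" "fst x \<noteq> 0" using x U_sub T by auto
    show ?thesis unfolding Z_def[abs_def] Z'_def[abs_def]
      by (intro has_derivative_diff has_derivative_scaleR has_derivative_mult g' x G_deriv x\<Omega> ramp_at_u_deriv step_at_u_deriv e
          cut_deriv[OF v \<theta>(1)] cut_deriv[OF v \<theta>(2)])
  qed
  have cv: "continuous_on ?U v"
    by (rule continuous_at_imp_continuous_on) (use v in \<open>auto simp: gderiv_def intro: has_derivative_continuous\<close>)
  have cth: "continuous_on ?U (\<lambda>x. \<theta> (v x))" "continuous_on ?U (\<lambda>x. \<theta>' (v x))" "continuous_on ?U (\<lambda>x. \<theta>'' (v x))"
    using DERIV_continuous_on[OF has_field_derivative_at_within[OF \<theta>(1)], of UNIV]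
      DERIV_continuous_on[OF has_field_derivative_at_within[OF \<theta>(2)], of UNIV] \<theta>(3) cv
    by (auto intro: continuous_on_compose2)
  have US: "?U \<subseteq> U e" by auto
  note cU = continuous_on_subset[OF U_cont(1) US] continuous_on_subset[OF U_cont(2) US]
    continuous_on_subset[OF cut_cont(1)[OF e] US] continuous_on_subset[OF cut_cont(2)[OF e] US]
    continuous_on_subset[OF cut_cont(3)[OF e] US]
  have sub: "{x\<in>?U. fst x \<notin> T} \<subseteq> ?U" by auto
  note cUT = continuous_on_subset[OF cU(1) sub] continuous_on_subset[OF cU(2) sub] continuous_on_subset[OF cU(3) sub]
    continuous_on_subset[OF cU(4) sub] continuous_on_subset[OF cU(5) sub] continuous_on_subset[OF cth(1) sub]
    continuous_on_subset[OF cth(2) sub] continuous_on_subset[OF cth(3) sub] continuous_on_subset[OF cg sub]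
  have cH': "continuous_on {x\<in>?U. fst x \<notin> T} (\<lambda>x. H x b)" for b
    by (rule continuous_on_subset[OF UH_cont(2)[OF T, of e]]) auto
  have cZ: "continuous_on ?U Z" unfolding Z_def by (intro continuous_intros cU cth cg)
  have cZ': "continuous_on {x\<in>?U. fst x \<notin> T} (\<lambda>x. Z' x b)" for b
    unfolding Z'_def by (intro continuous_intros cUT cg' cH')
  have ZK: "Z x = 0" if "x \<in> ?U" "x \<notin> ?K" for x
    using off_K[OF e, of x] off[OF that(1)] that by (auto simp: Z_def)
  have trd: "tr (Z' x) + a / fst x * fst (Z x) = d x" if x: "x \<in> ?U" "fst x \<notin> T" for x
  proof -
    have x\<Omega>: "x \<in> \<Omega>" "fst x \<noteq> 0" using x U_sub T by auto
    define tg where "tg = a / fst x * fst (G x)"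
    define tl where "tl = a / fst x * fst (g x)"
    have Z'': "Z' x = (\<lambda>h. (ramp_at e (u x) * \<theta>' (v x)) *\<^sub>R g' x h
      + ((ramp_at e (u x) * \<theta>'' (v x) * (h \<bullet> g x)) *\<^sub>R g x + (step_at e (u x) * \<theta>' (v x) * (h \<bullet> G x)) *\<^sub>R g x)
      - ((\<theta> (v x) * step_at e (u x)) *\<^sub>R H x h
      + ((\<theta> (v x) * bump_at e (u x) * (h \<bullet> G x)) *\<^sub>R G x + (\<theta>' (v x) * step_at e (u x) * (h \<bullet> g x)) *\<^sub>R G x)))"
      by (simp add: fun_eq_iff Z'_def scaleR_add_left mult_ac)
    have 1: "tr (Z' x) = ramp_at e (u x) * \<theta>' (v x) * tr (g' x)
      + (ramp_at e (u x) * \<theta>'' (v x) * (g x \<bullet> g x) + step_at e (u x) * \<theta>' (v x) * (G x \<bullet> g x))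
      - (\<theta> (v x) * step_at e (u x) * tr (H x)
      + (\<theta> (v x) * bump_at e (u x) * (G x \<bullet> G x) + \<theta>' (v x) * step_at e (u x) * (g x \<bullet> G x)))"
      unfolding Z'' tr_simps by simp
    have 2: "a / fst x * fst (Z x) = ramp_at e (u x) * \<theta>' (v x) * tl - \<theta> (v x) * step_at e (u x) * tg"
      by (simp add: Z_def tg_def tl_def algebra_simps)
    have 3: "tr (H x) = - 1 - tg" "tr (g' x) = l x - tl" using pde[OF x\<Omega>] l[OF x] by (auto simp: tg_def tl_def)
    show ?thesis unfolding 1 2 3 d_def by (simp add: algebra_simps inner_commute)
  qed
  have cd: "continuous_on ?U d" unfolding d_def by (intro continuous_intros cU cth cg cl)
  have KU: "?K \<subseteq> ?U" using K_sub_U[OF e] C by auto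
  show "set_integrable lborel ?U (\<lambda>x. wt a (fst x) * d x)" "(LINT x:?U|lborel. wt a (fst x) * d x) = 0"
    by (rule divergence_weighted[OF a_nonneg T open_Int[OF U_open S] compact_Int_closed[OF K_compact C(1)] KU cZ ZK dZ cZ' trd cd]; assumption)+
qed

lemma level_integrable:
  assumes e: "e > 0" and c: "continuous_on (U e) f" and z: "\<And>x. x \<in> U e \<Longrightarrow> x \<notin> K e \<Longrightarrow> f x = 0"
  shows "set_integrable lborel (U e) (f :: real \<times> 'b \<Rightarrow> real)"
proof -
  have "bounded (f ` K e)"
    by (intro compact_imp_bounded compact_continuous_image continuous_on_subset[OF c] K_compact K_sub_U e)
  then obtain M where M: "\<And>x. x \<in> K e \<Longrightarrow> \<bar>f x\<bar> \<le> M" by (auto simp: bounded_iff)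
  show ?thesis unfolding set_integrable_def
  proof (rule bounded_support_integrable[OF _ compact_imp_bounded[OF K_compact[of e]], of _ "\<bar>M\<bar>"])
    show "(\<lambda>x. indicator (U e) x *\<^sub>R f x) \<in> borel_measurable borel"
      using c by (rule borel_measurable_continuous_on_indicator[OF borel_open[OF U_open]])
    show "indicator (U e) x *\<^sub>R f x = 0" if "x \<notin> K e" for x using z[of x] that by (cases "x \<in> U e") auto
    show "\<bar>indicator (U e) x *\<^sub>R f x\<bar> \<le> \<bar>M\<bar>" for x
      using z[of x] M[of x] by (cases "x \<in> U e"; cases "x \<in> K e") auto
  qed
qed

lemma weight_integrable: "set_integrable lborel \<Omega> (\<lambda>x. wt a (fst x))"
proof -
  have cw: "continuous_on S (\<lambda>x::real \<times> 'b. wt a (fst x))" for S by (intro wt_cont a_nonneg continuous_intros)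
  have "bounded ((\<lambda>x. wt a (fst x)) ` closure \<Omega>)"
    using bounded_\<Omega> by (intro compact_imp_bounded compact_continuous_image cw) (simp add: compact_closure)
  then obtain M where M: "\<And>x. x \<in> closure \<Omega> \<Longrightarrow> \<bar>wt a (fst x)\<bar> \<le> M" by (auto simp: bounded_iff)
  show ?thesis unfolding set_integrable_def
  proof (rule bounded_support_integrable[OF _ bounded_\<Omega>, of _ "\<bar>M\<bar>"])
    show "(\<lambda>x. indicator \<Omega> x *\<^sub>R wt a (fst x)) \<in> borel_measurable borel"
      using cw by (rule borel_measurable_continuous_on_indicator[OF borel_open[OF open_\<Omega>]])
    show "\<bar>indicator \<Omega> x *\<^sub>R wt a (fst x)\<bar> \<le> \<bar>M\<bar>" for x
      using M[of x] closure_subset[of \<Omega>] by (cases "x \<in> \<Omega>") auto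
  qed auto
qed

text \<open>Since \<open>u > 0\<close> in \<open>\<Omega>\<close>, points where \<open>u\<close> is small are close to the boundary, where \<open>\<bar>G\<bar>\<^sup>2 - c\<^sup>2\<close> is small. The
factor \<open>\<bar>G\<bar>\<^sup>2\<close> on the right is what the mass identity controls. If \<open>c \<noteq> 0\<close>, it is bounded below
there; if \<open>c = 0\<close>, the left-hand side is itself a product of \<open>\<bar>G\<bar>\<^sup>2\<close> with a small factor.\<close>

lemma near_boundary:
  assumes "\<tau> > 0"
  shows "\<exists>e0>0. \<forall>x\<in>\<Omega>. u x \<le> e0 \<longrightarrow> \<bar>(G x \<bullet> G x - c\<^sup>2) * (G x \<bullet> Q x)\<bar> \<le> \<tau> * (G x \<bullet> G x)"
proof -
  have near: "\<exists>e0>0. \<forall>x\<in>\<Omega>. u x \<le> e0 \<longrightarrow> \<bar>G x \<bullet> G x - c\<^sup>2\<bar> \<le> s" if s: "s > 0" for s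
  proof -
    define C where "C = {x\<in>closure \<Omega>. \<bar>G x \<bullet> G x - c\<^sup>2\<bar> \<ge> s}"
    have C: "compact C" unfolding C_def
      by (rule compact_superlevel[OF bounded_\<Omega>]) (intro continuous_intros G_cont)
    have "C \<subseteq> \<Omega>"
    proof
      fix x assume x: "x \<in> C"
      have "x \<notin> frontier \<Omega>" using G_bdry[of x] x s by (auto simp: C_def power2_norm_eq_inner[symmetric])
      thus "x \<in> \<Omega>" using x open_\<Omega> by (auto simp: C_def frontier_def interior_open)
    qed
    show ?thesis
    proof (cases "C = {}")
      case True
      have "\<bar>G x \<bullet> G x - c\<^sup>2\<bar> \<le> s" if "x \<in> \<Omega>" for x
      proof (rule ccontr)
        assume "\<not> ?thesis"
        hence "x \<in> C" using that closure_subset[of \<Omega>] by (auto simp: C_def)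
        thus False using True by simp
      qed
      thus ?thesis by (intro exI[of _ 1]) auto
    next
      case False
      obtain z where z: "z \<in> C" "\<And>y. y \<in> C \<Longrightarrow> u z \<le> u y"
      proof -
        have "C \<subseteq> closure \<Omega>" by (auto simp: C_def)
        from continuous_attains_inf[OF C False continuous_on_subset[OF u_cont this]] that show thesis by blast
      qed
      have "u z > 0" using z \<open>C \<subseteq> \<Omega>\<close> u_pos by blast
      moreover have "\<bar>G x \<bullet> G x - c\<^sup>2\<bar> \<le> s" if "x \<in> \<Omega>" "u x \<le> u z / 2" for x
      proof (rule ccontr)
        assume "\<not> ?thesis"
        hence "x \<in> C" using that closure_subset[of \<Omega>] by (auto simp: C_def)
        thus False using z(2)[of x] that \<open>u z > 0\<close> by simp
      qed
      ultimately show ?thesis by (intro exI[of _ "u z / 2"]) auto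
    qed
  qed
  have "bounded (Q ` closure \<Omega>)"
    using bounded_\<Omega> by (intro compact_imp_bounded compact_continuous_image Q_cont) (simp add: compact_closure)
  then obtain B0 where B0: "\<And>x. x \<in> closure \<Omega> \<Longrightarrow> norm (Q x) \<le> B0" by (auto simp: bounded_iff)
  define B where "B = \<bar>B0\<bar> + 1"
  have B: "B > 0" by (simp add: B_def)
  have GQ: "\<bar>G x \<bullet> Q x\<bar> \<le> norm (G x) * B" if "x \<in> \<Omega>" for x
  proof -
    have "\<bar>G x \<bullet> Q x\<bar> \<le> norm (G x) * norm (Q x)" by (rule Cauchy_Schwarz_ineq2)
    also have "\<dots> \<le> norm (G x) * B" using B0[of x] that closure_subset[of \<Omega>]
      by (intro mult_left_mono) (auto simp: B_def)
    finally show ?thesis .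
  qed
  show ?thesis
  proof (cases "c = 0")
    case True
    obtain e0 where e0: "e0 > 0" "\<And>x. x \<in> \<Omega> \<Longrightarrow> u x \<le> e0 \<Longrightarrow> \<bar>G x \<bullet> G x - c\<^sup>2\<bar> \<le> (\<tau> / B)\<^sup>2"
      using near[of "(\<tau> / B)\<^sup>2"] assms B by auto
    have "\<bar>(G x \<bullet> G x - c\<^sup>2) * (G x \<bullet> Q x)\<bar> \<le> \<tau> * (G x \<bullet> G x)" if x: "x \<in> \<Omega>" "u x \<le> e0" for x
    proof -
      have "(norm (G x))\<^sup>2 \<le> (\<tau> / B)\<^sup>2" using e0(2)[OF x] True by (simp add: power2_norm_eq_inner)
      hence "norm (G x) \<le> \<tau> / B" by (rule power2_le_imp_le) (use assms B in simp)
      hence nB: "norm (G x) * B \<le> \<tau>" using B by (simp add: field_simps)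
      have "\<bar>(G x \<bullet> G x - c\<^sup>2) * (G x \<bullet> Q x)\<bar> = (G x \<bullet> G x) * \<bar>G x \<bullet> Q x\<bar>" using True by (simp add: abs_mult)
      also have "\<dots> \<le> (G x \<bullet> G x) * \<tau>" using GQ[OF x(1)] nB by (intro mult_left_mono) auto
      finally show ?thesis by (simp add: mult.commute)
    qed
    thus ?thesis using e0 by blast
  next
    case False
    define s where "s = min (c\<^sup>2 / 2) (\<tau> * \<bar>c\<bar> / (2 * B))"
    have "s > 0" using False assms B by (simp add: s_def)
    then obtain e0 where e0: "e0 > 0" "\<And>x. x \<in> \<Omega> \<Longrightarrow> u x \<le> e0 \<Longrightarrow> \<bar>G x \<bullet> G x - c\<^sup>2\<bar> \<le> s" using near by blast
    have "\<bar>(G x \<bullet> G x - c\<^sup>2) * (G x \<bullet> Q x)\<bar> \<le> \<tau> * (G x \<bullet> G x)" if x: "x \<in> \<Omega>" "u x \<le> e0" for x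
    proof -
      have "\<bar>G x \<bullet> G x - c\<^sup>2\<bar> \<le> c\<^sup>2 / 2" using e0(2)[OF x] by (simp add: s_def)
      hence "G x \<bullet> G x \<ge> c\<^sup>2 / 2" by linarith
      moreover have "(\<bar>c\<bar> / 2)\<^sup>2 \<le> c\<^sup>2 / 2" by (simp add: power2_eq_square)
      ultimately have "(\<bar>c\<bar> / 2)\<^sup>2 \<le> (norm (G x))\<^sup>2" by (simp add: power2_norm_eq_inner)
      hence cG: "\<bar>c\<bar> / 2 \<le> norm (G x)" by (rule power2_le_imp_le) simp
      have "\<bar>(G x \<bullet> G x - c\<^sup>2) * (G x \<bullet> Q x)\<bar> \<le> (\<tau> * \<bar>c\<bar> / (2 * B)) * (norm (G x) * B)"
        unfolding abs_mult using e0(2)[OF x] GQ[OF x(1)] \<open>s > 0\<close> by (intro mult_mono) (auto simp: s_def)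
      also have "\<dots> = \<tau> * (\<bar>c\<bar> / 2 * norm (G x))" using B by simp
      also have "\<dots> \<le> \<tau> * (norm (G x) * norm (G x))" using cG assms by (intro mult_left_mono mult_right_mono) auto
      finally show ?thesis by (simp add: dot_square_norm power2_eq_square)
    qed
    thus ?thesis using e0 by blast
  qed
qed

text \<open>The key identity turns the integrand into \<open>bump_at e u * ((\<bar>G\<bar>\<^sup>2 - c\<^sup>2) * (G \<bullet> Q))\<close>. Near the boundary
this is at most \<open>s * bump_at e u * \<bar>G\<bar>\<^sup>2\<close>, whose integral is at most \<open>s\<close> times the total
weight of \<open>\<Omega>\<close>.\<close>

lemma total_small:
  assumes "\<tau> > 0"
  shows "\<exists>e0>0. \<forall>e. 0 < e \<and> e \<le> e0 \<longrightarrow>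
    (LINT x:U e|lborel. wt a (fst x) * ((Q x \<bullet> Q x) * (bump_at e (u x) * (G x \<bullet> G x) - step_at e (u x)))) \<le> \<tau>"
proof -
  define W where "W = (LINT x:\<Omega>|lborel. wt a (fst x))"
  have W0: "W \<ge> 0" unfolding W_def set_lebesgue_integral_def
    by (intro integral_nonneg_AE AE_I2) (simp add: wt_nonneg)
  define s where "s = \<tau> / (W + 1)"
  have s: "s > 0" using assms W0 by (simp add: s_def)
  obtain e1 where e1: "e1 > 0" "\<And>x. x \<in> \<Omega> \<Longrightarrow> u x \<le> e1 \<Longrightarrow> \<bar>(G x \<bullet> G x - c\<^sup>2) * (G x \<bullet> Q x)\<bar> \<le> s * (G x \<bullet> G x)"
    using near_boundary[OF s] by blast
  have "(LINT x:U e|lborel. wt a (fst x) * ((Q x \<bullet> Q x) * (bump_at e (u x) * (G x \<bullet> G x) - step_at e (u x)))) \<le> \<tau>"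
    if e: "e > 0" "e \<le> e1 / 2" for e
  proof -
    let ?E = "\<lambda>x. wt a (fst x) * (bump_at e (u x) * ((G x \<bullet> G x - c\<^sup>2) * (G x \<bullet> Q x)))"
    let ?B = "\<lambda>x. wt a (fst x) * (bump_at e (u x) * (G x \<bullet> G x))"
    let ?S = "\<lambda>x. wt a (fst x) * step_at e (u x)"
    let ?d = "\<lambda>x. wt a (fst x) * (bump_at e (u x) * ((c\<^sup>2 - G x \<bullet> G x) * (G x \<bullet> Q x) + (Q x \<bullet> Q x) * (G x \<bullet> G x)) - step_at e (u x) * (Q x \<bullet> Q x))"
    have cw: "continuous_on (U e) (\<lambda>x. wt a (fst x))" by (intro wt_cont a_nonneg continuous_intros)
    have iE: "set_integrable lborel (U e) ?E" and iB: "set_integrable lborel (U e) ?B" and iS: "set_integrable lborel (U e) ?S"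
      by (rule level_integrable[OF e(1)], intro continuous_intros cw U_cont cut_cont e(1), simp add: off_K[OF e(1)])+
    have iw: "set_integrable lborel (U e) (\<lambda>x. wt a (fst x))"
      using weight_integrable by (rule set_integrable_subset) (auto simp: U_sub U_open)
    have "(LINT x:U e|lborel. wt a (fst x) * ((Q x \<bullet> Q x) * (bump_at e (u x) * (G x \<bullet> G x) - step_at e (u x))))
        = (LINT x:U e|lborel. ?d x + ?E x)"
      by (intro arg_cong[where f="set_lebesgue_integral lborel (U e)"] ext) (simp add: algebra_simps)
    also have "\<dots> = (LINT x:U e|lborel. ?E x)"
      using set_integral_add(2)[OF key_identity(1)[OF e(1)] iE] key_identity(2)[OF e(1)] by simp
    also have "\<dots> \<le> (LINT x:U e|lborel. s * ?B x)"
    proof (rule set_integral_mono[OF iE])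
      show "set_integrable lborel (U e) (\<lambda>x. s * ?B x)" using iB by simp
      fix x assume x: "x \<in> U e"
      have "bump_at e (u x) * ((G x \<bullet> G x - c\<^sup>2) * (G x \<bullet> Q x)) \<le> bump_at e (u x) * (s * (G x \<bullet> G x))"
      proof (cases "u x \<le> e1")
        case True
        thus ?thesis using e1(2)[of x] x U_sub bump_at_nonneg[OF e(1)] by (intro mult_left_mono) force+
      next
        case False
        hence "bump_at e (u x) = 0" using cut_large[OF e(1), of "u x"] e by simp
        thus ?thesis by simp
      qed
      from mult_left_mono[OF this wt_nonneg[of a "fst x"]]
      show "?E x \<le> s * ?B x" by (simp add: mult_ac)
    qed
    also have "\<dots> = s * (LINT x:U e|lborel. ?B x)" by simp
    also have "(LINT x:U e|lborel. ?B x) = (LINT x:U e|lborel. ?S x)"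
    proof -
      have "(LINT x:U e|lborel. ?B x) - (LINT x:U e|lborel. ?S x) = (LINT x:U e|lborel. ?B x - ?S x)"
        by (rule set_integral_diff(2)[OF iB iS, symmetric])
      also have "\<dots> = 0" using mass_identity(2)[OF e(1)] by (simp add: right_diff_distrib)
      finally show ?thesis by simp
    qed
    also have "(LINT x:U e|lborel. ?S x) \<le> (LINT x:U e|lborel. wt a (fst x))"
      using iS iw by (rule set_integral_mono) (simp add: step_at_le wt_nonneg mult_left_le)
    also have "\<dots> \<le> W" unfolding W_def set_lebesgue_integral_def
      using iw weight_integrable U_sub by (intro integral_mono) (auto simp: set_integrable_def indicator_def wt_nonneg)
    finally have "(LINT x:U e|lborel. wt a (fst x) * ((Q x \<bullet> Q x) * (bump_at e (u x) * (G x \<bullet> G x) - step_at e (u x)))) \<le> s * W"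
      using s by (simp add: mult_left_mono)
    also have "\<dots> \<le> \<tau>" using W0 assms by (simp add: s_def field_simps)
    finally show ?thesis .
  qed
  thus ?thesis using e1 by (intro exI[of _ "e1 / 2"]) auto
qed

end

section \<open>Bounded convergence\<close>

lemma set_integral_bounded_limit:
  fixes f :: "nat \<Rightarrow> 'a::euclidean_space \<Rightarrow> real"
  assumes A: "A \<in> sets borel" "bounded A" and c: "\<And>n. continuous_on A (f n)"
    and M: "\<And>n x. x \<in> A \<Longrightarrow> \<bar>f n x\<bar> \<le> M" and lim: "\<And>x. x \<in> A \<Longrightarrow> (\<lambda>n. f n x) \<longlonglongrightarrow> g x"
  shows "(\<lambda>n. LINT x:A|lborel. f n x) \<longlonglongrightarrow> (LINT x:A|lborel. g x)" "set_integrable lborel A g"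
proof -
  have m: "(\<lambda>x. indicator A x *\<^sub>R f n x) \<in> borel_measurable lborel" for n
    using borel_measurable_continuous_on_indicator[OF A(1) c] by simp
  have l: "(\<lambda>n. indicator A x *\<^sub>R f n x) \<longlonglongrightarrow> indicator A x *\<^sub>R g x" for x
    using lim[of x] by (cases "x \<in> A") auto
  have m': "(\<lambda>x. indicator A x *\<^sub>R g x) \<in> borel_measurable lborel"
    by (rule borel_measurable_LIMSEQ_metric[OF m l])
  have w: "integrable lborel (\<lambda>x. indicator A x * M)"
    by (intro integrable_mult_left integrable_real_indicator emeasure_bounded_finite A) (use A in simp)
  have b: "AE x in lborel. norm (indicator A x *\<^sub>R f n x) \<le> indicator A x * M" for n
  proof (rule AE_I2)
    fix x show "norm (indicator A x *\<^sub>R f n x) \<le> indicator A x * M"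
      using M[of x n] by (cases "x \<in> A") auto
  qed
  have l': "AE x in lborel. (\<lambda>n. indicator A x *\<^sub>R f n x) \<longlonglongrightarrow> indicator A x *\<^sub>R g x" using l by auto
  show "(\<lambda>n. LINT x:A|lborel. f n x) \<longlonglongrightarrow> (LINT x:A|lborel. g x)"
    unfolding set_lebesgue_integral_def
    by (rule integral_dominated_convergence[where s="\<lambda>n x. indicator A x *\<^sub>R f n x", OF m' m w l' b])
  show "set_integrable lborel A g" unfolding set_integrable_def
    by (rule integrable_dominated_convergence[where s="\<lambda>n x. indicator A x *\<^sub>R f n x", OF m' m w l' b])
qed

lemma compact_bounded_image:
  "compact S \<Longrightarrow> continuous_on S f \<Longrightarrow> \<exists>B>0. \<forall>x\<in>S. norm (f x) \<le> B"
  using compact_imp_bounded[OF compact_continuous_image] by (force simp: bounded_pos)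

context overdetermined
begin

section \<open>Directions of translation invariance\<close>

definition q where "q x = u x + (1 / (2 * N)) * (x \<bullet> x)"

lemma q_grad: "x \<in> \<Omega> \<Longrightarrow> GDERIV q x :> Q x"
proof -
  assume x: "x \<in> \<Omega>"
  have "(q has_derivative (\<lambda>h. h \<bullet> G x + (1 / (2 * N)) * (x \<bullet> h + h \<bullet> x))) (at x)"
    unfolding q_def[abs_def] using u_grad[OF x] unfolding gderiv_def
    by (intro has_derivative_add has_derivative_mult_right has_derivative_inner has_derivative_ident)
  moreover have "(\<lambda>h. h \<bullet> G x + (1 / (2 * N)) * (x \<bullet> h + h \<bullet> x)) = (\<lambda>h. h \<bullet> Q x)"
    using N_pos by (simp add: fun_eq_iff Q_def inner_add_right inner_commute field_simps)
  ultimately show ?thesis by (simp add: gderiv_def)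
qed

text \<open>Room for the difference quotients: points of \<open>U e\<close> can be moved by \<open>h0\<close> in any direction within a
compact subset of \<open>\<Omega>\<close>.\<close>

lemma shift_room:
  assumes e: "e > 0"
  obtains h0 K1 where "h0 > 0" "compact K1" "K1 \<subseteq> \<Omega>" "U e \<subseteq> K1"
    "\<And>x y. x \<in> U e \<Longrightarrow> norm y \<le> h0 \<Longrightarrow> x + y \<in> K1"
proof -
  have "K (e / 2) \<subseteq> \<Omega>" using e by (intro K_sub) auto
  then obtain h0 where h0: "h0 > 0" "(\<Union>x\<in>K (e / 2). cball x h0) \<subseteq> \<Omega>"
    using compact_subset_open_imp_cball_epsilon_subset[OF K_compact open_\<Omega>] by blast
  define K1 where "K1 = {x + y |x y. x \<in> K (e / 2) \<and> y \<in> cball 0 h0}"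
  have "compact K1" unfolding K1_def by (intro compact_sums K_compact compact_cball)
  moreover have "K1 \<subseteq> \<Omega>"
  proof
    fix z assume "z \<in> K1"
    then obtain x y where xy: "x \<in> K (e / 2)" "norm y \<le> h0" "z = x + y" by (auto simp: K1_def)
    hence "z \<in> cball x h0" by (simp add: dist_norm)
    thus "z \<in> \<Omega>" using xy h0 by blast
  qed
  moreover have m: "x + y \<in> K1" if "x \<in> U e" "norm y \<le> h0" for x y
    unfolding K1_def mem_Collect_eq using that U_sub_K by (intro exI[of _ x] exI[of _ y]) auto
  moreover have "U e \<subseteq> K1" using m[of _ 0] h0 by auto
  ultimately show ?thesis using h0 that by blast
qed

text \<open>Difference quotients of \<open>q\<close>, \<open>Q\<close> and \<open>HQ\<close>. They stand in for derivatives in the direction \<open>b\<close>, since the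
third derivatives of \<open>u\<close> that a Bochner formula requires need not exist.\<close>

definition dq where "dq b h x = (q (x + h *\<^sub>R b) - q x) / h"
definition dQ where "dQ b h x = (1 / h) *\<^sub>R (Q (x + h *\<^sub>R b) - Q x)"
definition dHQ where "dHQ b h x v = (1 / h) *\<^sub>R (HQ (x + h *\<^sub>R b) v - HQ x v)"

lemma dq_grad: "x \<in> \<Omega> \<Longrightarrow> x + h *\<^sub>R b \<in> \<Omega> \<Longrightarrow> GDERIV (dq b h) x :> dQ b h x"
proof -
  assume x: "x \<in> \<Omega>" "x + h *\<^sub>R b \<in> \<Omega>"
  have s: "((\<lambda>x. x + h *\<^sub>R b) has_derivative (\<lambda>v. v)) (at x)" by (auto intro!: derivative_eq_intros)
  have "((\<lambda>x. q (x + h *\<^sub>R b)) has_derivative (\<lambda>v. v \<bullet> Q (x + h *\<^sub>R b))) (at x)"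
    using has_derivative_compose[OF s q_grad[OF x(2), unfolded gderiv_def]] .
  from has_derivative_diff[OF this q_grad[OF x(1), unfolded gderiv_def]]
  have "((\<lambda>x. (1 / h) * (q (x + h *\<^sub>R b) - q x)) has_derivative (\<lambda>v. (1 / h) * (v \<bullet> Q (x + h *\<^sub>R b) - v \<bullet> Q x))) (at x)"
    by (rule has_derivative_mult_right)
  thus ?thesis unfolding gderiv_def dq_def[abs_def] dQ_def by (simp add: inner_diff_right)
qed

lemma dQ_deriv: "x \<in> \<Omega> \<Longrightarrow> x + h *\<^sub>R b \<in> \<Omega> \<Longrightarrow> fst x \<noteq> 0 \<Longrightarrow> fst x + h * fst b \<noteq> 0
  \<Longrightarrow> (dQ b h has_derivative dHQ b h x) (at x)"
proof -
  assume x: "x \<in> \<Omega>" "x + h *\<^sub>R b \<in> \<Omega>" "fst x \<noteq> 0" "fst x + h * fst b \<noteq> 0"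
  have s: "((\<lambda>x. x + h *\<^sub>R b) has_derivative (\<lambda>v. v)) (at x)" by (auto intro!: derivative_eq_intros)
  have "((\<lambda>x. Q (x + h *\<^sub>R b)) has_derivative HQ (x + h *\<^sub>R b)) (at x)"
    using has_derivative_compose[OF s Q_deriv[OF x(2)]] x by simp
  from has_derivative_scaleR_right[OF has_derivative_diff[OF this Q_deriv[OF x(1,3)]], of "1/h"]
  show ?thesis unfolding dQ_def[abs_def] dHQ_def[abs_def] .
qed

lemma dq_tendsto:
  assumes x: "x \<in> \<Omega>" and h: "\<And>n. h n \<noteq> 0" "h \<longlonglongrightarrow> 0"
  shows "(\<lambda>n. dq b (h n) x) \<longlonglongrightarrow> Q x \<bullet> b"
proof -
  have "((\<lambda>t. x + t *\<^sub>R b) has_derivative (\<lambda>t. t *\<^sub>R b)) (at 0)" by (auto intro!: derivative_eq_intros)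
  from has_derivative_compose[OF this, of q "\<lambda>v. v \<bullet> Q x"] q_grad[OF x]
  have "((\<lambda>t. q (x + t *\<^sub>R b)) has_real_derivative (Q x \<bullet> b)) (at 0)"
    by (simp add: gderiv_def has_field_derivative_def inner_commute mult_commute_abs)
  hence "((\<lambda>t. (q (x + t *\<^sub>R b) - q x) / t) \<longlongrightarrow> Q x \<bullet> b) (at 0)" by (simp add: DERIV_def)
  moreover have "filterlim h (at 0) sequentially" using h by (simp add: filterlim_at)
  ultimately show ?thesis unfolding dq_def by (rule filterlim_compose)
qed

lemma dQ_tendsto:
  assumes x: "x \<in> \<Omega>" "fst x \<noteq> 0" and h: "\<And>n. h n \<noteq> 0" "h \<longlonglongrightarrow> 0"
  shows "(\<lambda>n. dQ b (h n) x) \<longlonglongrightarrow> HQ x b"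
proof -
  have lin: "linear (HQ x)" using Q_deriv[OF x] has_derivative_linear by blast
  have "((\<lambda>t. x + t *\<^sub>R b) has_derivative (\<lambda>t. t *\<^sub>R b)) (at 0)" by (auto intro!: derivative_eq_intros)
  from has_derivative_compose[OF this, of Q "HQ x"] Q_deriv[OF x]
  have "((\<lambda>t. Q (x + t *\<^sub>R b)) has_vector_derivative HQ x b) (at 0)"
    by (simp add: has_vector_derivative_def linear_cmul[OF lin])
  hence "((\<lambda>t. (Q (x + t *\<^sub>R b) - Q x - t *\<^sub>R HQ x b) /\<^sub>R \<bar>t\<bar>) \<longlongrightarrow> 0) (at 0)"
    by (simp add: has_vector_derivative_def has_derivative_at_within)
  hence "((\<lambda>t. norm ((Q (x + t *\<^sub>R b) - Q x - t *\<^sub>R HQ x b) /\<^sub>R \<bar>t\<bar>)) \<longlongrightarrow> 0) (at 0)"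
    by (rule tendsto_norm_zero)
  moreover have "\<forall>\<^sub>F t in at 0. norm ((Q (x + t *\<^sub>R b) - Q x - t *\<^sub>R HQ x b) /\<^sub>R \<bar>t\<bar>)
      = norm ((1 / t) *\<^sub>R (Q (x + t *\<^sub>R b) - Q x) - HQ x b)"
  proof (rule eventually_at_filter[THEN iffD2], rule always_eventually, intro allI impI)
    fix t :: real assume t: "t \<noteq> 0"
    have "(1 / t) *\<^sub>R (Q (x + t *\<^sub>R b) - Q x) - HQ x b = (1 / t) *\<^sub>R (Q (x + t *\<^sub>R b) - Q x - t *\<^sub>R HQ x b)"
      using t by (simp add: scaleR_diff_right)
    thus "norm ((Q (x + t *\<^sub>R b) - Q x - t *\<^sub>R HQ x b) /\<^sub>R \<bar>t\<bar>)
      = norm ((1 / t) *\<^sub>R (Q (x + t *\<^sub>R b) - Q x) - HQ x b)" by (simp add: divide_inverse)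
  qed
  ultimately have "((\<lambda>t. norm ((1 / t) *\<^sub>R (Q (x + t *\<^sub>R b) - Q x) - HQ x b)) \<longlongrightarrow> 0) (at 0)"
    by (rule Lim_transform_eventually)
  hence "((\<lambda>t. (1 / t) *\<^sub>R (Q (x + t *\<^sub>R b) - Q x)) \<longlongrightarrow> HQ x b) (at 0)"
    by (rule LIM_zero_cancel[OF tendsto_norm_zero_cancel])
  moreover have "filterlim h (at 0) sequentially" using h by (simp add: filterlim_at)
  ultimately show ?thesis unfolding dQ_def by (rule filterlim_compose)
qed

lemma dq_bound:
  assumes h: "h > 0" and seg: "\<And>t. 0 \<le> t \<Longrightarrow> t \<le> h \<Longrightarrow> x + t *\<^sub>R b \<in> \<Omega>"
  obtains t where "0 < t" "t < h" "dq b h x = Q (x + t *\<^sub>R b) \<bullet> b"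
proof -
  have d: "((\<lambda>t. q (x + t *\<^sub>R b)) has_real_derivative (Q (x + t *\<^sub>R b) \<bullet> b)) (at t)" if "0 \<le> t" "t \<le> h" for t
  proof -
    have "((\<lambda>t. x + t *\<^sub>R b) has_derivative (\<lambda>t. t *\<^sub>R b)) (at t)" by (auto intro!: derivative_eq_intros)
    from has_derivative_compose[OF this q_grad[OF seg[OF that], unfolded gderiv_def]]
    show ?thesis by (simp add: has_field_derivative_def inner_commute mult_commute_abs)
  qed
  obtain t where "0 < t" "t < h" "q (x + h *\<^sub>R b) - q (x + 0 *\<^sub>R b) = (h - 0) * (Q (x + t *\<^sub>R b) \<bullet> b)"
    using MVT2[of 0 h "\<lambda>t. q (x + t *\<^sub>R b)" "\<lambda>t. Q (x + t *\<^sub>R b) \<bullet> b"] d h by auto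
  thus ?thesis using that h by (auto simp: dq_def)
qed

lemma dQ_bound:
  assumes h: "h > 0" and seg: "\<And>t. 0 \<le> t \<Longrightarrow> t \<le> h \<Longrightarrow> x + t *\<^sub>R b \<in> \<Omega> \<and> fst (x + t *\<^sub>R b) \<noteq> 0 \<and> norm (HQ (x + t *\<^sub>R b) b) \<le> B"
  shows "norm (dQ b h x) \<le> B"
proof -
  have d: "((\<lambda>t. Q (x + t *\<^sub>R b)) has_derivative (\<lambda>s. s *\<^sub>R HQ (x + t *\<^sub>R b) b)) (at t)" if "0 \<le> t" "t \<le> h" for t
  proof -
    have x: "x + t *\<^sub>R b \<in> \<Omega>" "fst (x + t *\<^sub>R b) \<noteq> 0" using seg[OF that] by auto
    have lin: "linear (HQ (x + t *\<^sub>R b))" using Q_deriv[OF x] has_derivative_linear by blast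
    have "((\<lambda>t. x + t *\<^sub>R b) has_derivative (\<lambda>t. t *\<^sub>R b)) (at t)" by (auto intro!: derivative_eq_intros)
    from has_derivative_compose[OF this Q_deriv[OF x]]
    show ?thesis by (simp add: linear_cmul[OF lin])
  qed
  have "continuous_on {0..h} (\<lambda>t. Q (x + t *\<^sub>R b))"
    by (rule continuous_at_imp_continuous_on) (use d has_derivative_continuous in fastforce)
  then obtain t where t: "0 < t" "t < h"
    "norm (Q (x + h *\<^sub>R b) - Q (x + 0 *\<^sub>R b)) \<le> norm ((h - 0) *\<^sub>R HQ (x + t *\<^sub>R b) b)"
    using mvt_general[OF h, of "\<lambda>t. Q (x + t *\<^sub>R b)" "\<lambda>t s. s *\<^sub>R HQ (x + t *\<^sub>R b) b"] d by auto
  have "norm (HQ (x + t *\<^sub>R b) b) \<le> B" using seg[of t] t by auto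
  hence "h * norm (HQ (x + t *\<^sub>R b) b) \<le> h * B" using h by (intro mult_left_mono) auto
  moreover have "norm (Q (x + h *\<^sub>R b) - Q x) \<le> h * norm (HQ (x + t *\<^sub>R b) b)" using t h by simp
  ultimately have "norm (Q (x + h *\<^sub>R b) - Q x) \<le> h * B" by linarith
  thus ?thesis using h unfolding dQ_def norm_scaleR by (simp add: field_simps)
qed

lemma shift_cont:
  fixes f :: "'x::real_normed_vector \<Rightarrow> 'y::real_normed_vector"
  assumes "continuous_on S f" "(\<lambda>x. x + v) ` A \<subseteq> S" shows "continuous_on A (\<lambda>x. f (x + v))"
  by (rule continuous_on_compose2[OF assms(1) _ assms(2)]) (intro continuous_intros)

text \<open>This is Bochner's formula \<open>L (Q \<bullet> b)\<^sup>2 / 2 = \<bar>HQ b\<bar>\<^sup>2\<close> tested with \<open>ramp_at e u\<close>, for directions \<open>b\<close> under whose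
translations the operator is invariant. The difference quotient of \<open>q\<close> solves the same equation, so
Green's identity holds for its square. As the step tends to zero, \<open>Q \<bullet> b\<close> appears on the right, and on the
left only a compact set \<open>C\<close> off the hyperplane is kept, where the second derivatives are bounded.\<close>

lemma directional_inequality:
  assumes e: "e > 0" and b: "b \<in> Basis" "fst b = 0 \<or> a = 0" and C: "compact C" "C \<subseteq> U e" "C \<subseteq> {x. fst x \<noteq> 0}"
  shows "2 * (LINT x:C|lborel. wt a (fst x) * (ramp_at e (u x) * (HQ x b \<bullet> HQ x b)))
    \<le> (LINT x:U e|lborel. wt a (fst x) * ((Q x \<bullet> b)\<^sup>2 * (bump_at e (u x) * (G x \<bullet> G x) - step_at e (u x))))"
proof -
  obtain h0 K1 where h0: "h0 > 0" "compact K1" "K1 \<subseteq> \<Omega>" "U e \<subseteq> K1"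
    "\<And>x y. x \<in> U e \<Longrightarrow> norm y \<le> h0 \<Longrightarrow> x + y \<in> K1" using shift_room[OF e] by blast
  define V where "V = {x\<in>\<Omega>. fst x \<noteq> 0}"
  have oV: "open V" using open_Int[OF open_\<Omega> open_fst_notin[of "{0}"]] by (simp add: V_def Int_def)
  have "C \<subseteq> V" using C U_sub by (auto simp: V_def)
  then obtain h1 where h1: "h1 > 0" "(\<Union>x\<in>C. cball x h1) \<subseteq> V"
    using compact_subset_open_imp_cball_epsilon_subset[OF C(1) oV] by blast
  define C2 where "C2 = {x + y |x y. x \<in> C \<and> y \<in> cball 0 h1}"
  have C2: "compact C2" unfolding C2_def by (intro compact_sums C compact_cball)
  have C2V: "C2 \<subseteq> V"
  proof
    fix z assume "z \<in> C2"
    then obtain x y where xy: "x \<in> C" "norm y \<le> h1" "z = x + y" by (auto simp: C2_def)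
    hence "z \<in> cball x h1" by (simp add: dist_norm)
    thus "z \<in> V" using xy h1 by blast
  qed
  have C2m: "x + y \<in> C2" if "x \<in> C" "norm y \<le> h1" for x y
    unfolding C2_def mem_Collect_eq using that by (intro exI[of _ x] exI[of _ y]) auto
  have nb: "norm b = 1" using b by simp
  obtain BQ where BQ: "BQ > 0" "\<And>x. x \<in> K1 \<Longrightarrow> norm (Q x) \<le> BQ"
    using compact_bounded_image[OF h0(2) continuous_on_subset[OF Q_cont]] h0(3) closure_subset by (metis subset_trans)
  obtain BH where BH: "BH > 0" "\<And>x. x \<in> C2 \<Longrightarrow> norm (HQ x b) \<le> BH"
    using compact_bounded_image[OF C2 continuous_on_subset[OF HQ_cont[of b]]] C2V by (auto simp: V_def)
  define h where "h n = min h0 h1 * inverse (real (Suc n))" for n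
  have hp: "h n > 0" "h n \<le> h0" "h n \<le> h1" "h n \<noteq> 0" for n
  proof -
    show "h n > 0" "h n \<noteq> 0" using h0 h1 by (auto simp: h_def)
    have "h n \<le> min h0 h1" unfolding h_def using h0 h1 by (intro mult_left_le) (auto simp: divide_simps)
    thus "h n \<le> h0" "h n \<le> h1" by auto
  qed
  have hl: "h \<longlonglongrightarrow> 0" unfolding h_def by (rule tendsto_mult_right_zero[OF LIMSEQ_inverse_real_of_nat])
  have seg: "x + t *\<^sub>R b \<in> K1" if "x \<in> U e" "0 \<le> t" "t \<le> h n" for x t n
    using that h0(5)[of x "t *\<^sub>R b"] hp(2)[of n] nb by simp
  have seg\<Omega>: "x + t *\<^sub>R b \<in> \<Omega>" if "x \<in> U e" "0 \<le> t" "t \<le> h n" for x t n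
    using seg[OF that] h0 by blast
  have sh: "x + h n *\<^sub>R b \<in> \<Omega>" if "x \<in> U e" for x n using seg\<Omega>[OF that, of "h n" n] hp(1)[of n] by simp
  have cQ: "continuous_on \<Omega> Q" by (rule continuous_on_subset[OF Q_cont closure_subset])
  have cdQ: "continuous_on (U e) (dQ b (h n))" for n
    unfolding dQ_def using sh U_sub
    by (intro continuous_intros shift_cont[OF cQ] continuous_on_subset[OF cQ]) auto
  have cdq: "continuous_on (U e) (dq b (h n))" for n
  proof (rule continuous_at_imp_continuous_on, rule ballI)
    fix x assume "x \<in> U e"
    thus "isCont (dq b (h n)) x"
      using dq_grad[of x "h n" b] sh[of x n] U_sub has_derivative_continuous unfolding gderiv_def by blast
  qed
  have cw: "continuous_on S (\<lambda>x::real \<times> 'b. wt a (fst x))" for S by (intro wt_cont a_nonneg continuous_intros)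
  let ?F = "\<lambda>x. bump_at e (u x) * (G x \<bullet> G x) - step_at e (u x)"
  have id: "2 * (LINT x:U e|lborel. wt a (fst x) * (ramp_at e (u x) * (dQ b (h n) x \<bullet> dQ b (h n) x)))
     = (LINT x:U e|lborel. wt a (fst x) * ((dq b (h n) x)\<^sup>2 * ?F x))" for n
  proof -
    \<comment> \<open>For \<open>b = (1, 0)\<close> and \<open>a = 0\<close> the translated function is irregular on a second hyperplane.\<close>
    let ?T = "{0, - (h n * fst b)}"
    let ?d = "\<lambda>x. ramp_at e (u x) * (2 * (dQ b (h n) x \<bullet> dQ b (h n) x) + (2 * dq b (h n) x) * 0) - (dq b (h n) x)\<^sup>2 * ?F x"
    have T: "finite ?T" "0 \<in> ?T" by auto
    have oS: "open (UNIV :: (real \<times> 'b) set)" "closed (UNIV :: (real \<times> 'b) set)" "(UNIV :: (real \<times> 'b) set) \<subseteq> UNIV" by auto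
    have inT: "x \<in> \<Omega> \<and> x + h n *\<^sub>R b \<in> \<Omega> \<and> fst x \<noteq> 0 \<and> fst x + h n * fst b \<noteq> 0"
      if "x \<in> U e \<inter> UNIV" "fst x \<notin> ?T" for x
      using that sh[of x n] subsetD[OF U_sub, of x e] by auto
    have z: "(LINT x:U e \<inter> UNIV|lborel. wt a (fst x) * ?d x) = 0"
    proof (rule green_convex(2)[OF e T oS, where g' = "dHQ b (h n)"])
      show "GDERIV (dq b (h n)) x :> dQ b (h n) x" if "x \<in> U e \<inter> UNIV" for x
        using dq_grad that sh U_sub by blast
      show "continuous_on (U e \<inter> UNIV) (dQ b (h n))" using cdQ by simp
      show "(dQ b (h n) has_derivative dHQ b (h n) x) (at x)" if "x \<in> U e \<inter> UNIV" "fst x \<notin> ?T" for x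
        using inT[OF that] dQ_deriv by blast
      show "continuous_on {x \<in> U e \<inter> UNIV. fst x \<notin> ?T} (\<lambda>x. dHQ b (h n) x v)" for v
        unfolding dHQ_def using inT
        by (intro continuous_intros shift_cont[OF HQ_cont] continuous_on_subset[OF HQ_cont]) auto
      show "tr (dHQ b (h n) x) + a / fst x * fst (dQ b (h n) x) = 0" if "x \<in> U e \<inter> UNIV" "fst x \<notin> ?T" for x
      proof -
        note i = inT[OF that]
        have 1: "tr (HQ x) + a / fst x * fst (Q x) = 0" using Q_pde i by blast
        have eq: "a / fst (x + h n *\<^sub>R b) = a / fst x" using b(2) by auto
        have 2: "tr (HQ (x + h n *\<^sub>R b)) + a / fst x * fst (Q (x + h n *\<^sub>R b)) = 0"
          unfolding eq[symmetric] using i by (intro Q_pde) auto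
        have "tr (dHQ b (h n) x) + a / fst x * fst (dQ b (h n) x) =
          (1 / h n) * ((tr (HQ (x + h n *\<^sub>R b)) + a / fst x * fst (Q (x + h n *\<^sub>R b))) - (tr (HQ x) + a / fst x * fst (Q x)))"
          unfolding dHQ_def dQ_def tr_simps by (simp add: algebra_simps)
        thus ?thesis using 1 2 by simp
      qed
      show "((\<lambda>t. t\<^sup>2) has_real_derivative 2 * t) (at t)" for t :: real by (auto intro!: derivative_eq_intros)
      show "((\<lambda>t. 2 * t) has_real_derivative 2) (at t)" for t :: real by (auto intro!: derivative_eq_intros)
    qed auto
    let ?A = "\<lambda>x. wt a (fst x) * (ramp_at e (u x) * (dQ b (h n) x \<bullet> dQ b (h n) x))"
    let ?B = "\<lambda>x. wt a (fst x) * ((dq b (h n) x)\<^sup>2 * ?F x)"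
    have i: "set_integrable lborel (U e) ?A" "set_integrable lborel (U e) ?B"
      by (rule level_integrable[OF e], intro continuous_intros cw U_cont cut_cont e cdQ cdq, simp add: off_K[OF e])+
    have i2: "set_integrable lborel (U e) (\<lambda>x. 2 * ?A x)" using i(1) by simp
    have "2 * (LINT x:U e|lborel. ?A x) - (LINT x:U e|lborel. ?B x) = (LINT x:U e|lborel. 2 * ?A x) - (LINT x:U e|lborel. ?B x)"
      by simp
    also have "\<dots> = (LINT x:U e|lborel. 2 * ?A x - ?B x)" by (rule set_integral_diff(2)[OF i2 i(2), symmetric])
    also have "\<dots> = (LINT x:U e \<inter> UNIV|lborel. wt a (fst x) * ?d x)" by (simp add: algebra_simps)
    finally show ?thesis using z by simp
  qed
  have le: "2 * (LINT x:C|lborel. wt a (fst x) * (ramp_at e (u x) * (dQ b (h n) x \<bullet> dQ b (h n) x)))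
     \<le> (LINT x:U e|lborel. wt a (fst x) * ((dq b (h n) x)\<^sup>2 * ?F x))" for n
  proof -
    let ?A = "\<lambda>x. wt a (fst x) * (ramp_at e (u x) * (dQ b (h n) x \<bullet> dQ b (h n) x))"
    have i: "set_integrable lborel (U e) ?A"
      by (rule level_integrable[OF e], intro continuous_intros cw U_cont cut_cont e cdQ cdq, simp add: off_K[OF e])
    have iC: "set_integrable lborel C ?A" using i by (rule set_integrable_subset) (use C in \<open>auto simp: compact_imp_closed\<close>)
    have "(LINT x:C|lborel. ?A x) \<le> (LINT x:U e|lborel. ?A x)"
      unfolding set_lebesgue_integral_def
    proof (rule integral_mono)
      show "integrable lborel (\<lambda>x. indicat_real C x *\<^sub>R ?A x)" "integrable lborel (\<lambda>x. indicat_real (U e) x *\<^sub>R ?A x)"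
        using i iC by (auto simp: set_integrable_def)
      fix x
      have "?A x \<ge> 0" using wt_nonneg ramp_at_nonneg[OF e] by (intro mult_nonneg_nonneg) auto
      thus "indicat_real C x *\<^sub>R ?A x \<le> indicat_real (U e) x *\<^sub>R ?A x" using C(2) by (auto simp: indicator_def)
    qed
    thus ?thesis using id[of n] by linarith
  qed
  have lim1: "(\<lambda>n. LINT x:C|lborel. wt a (fst x) * (ramp_at e (u x) * (dQ b (h n) x \<bullet> dQ b (h n) x)))
      \<longlonglongrightarrow> (LINT x:C|lborel. wt a (fst x) * (ramp_at e (u x) * (HQ x b \<bullet> HQ x b)))"
  proof -
    have cwR: "continuous_on C (\<lambda>x. wt a (fst x) * ramp_at e (u x))"
      by (intro continuous_intros cw continuous_on_subset[OF cut_cont(1)[OF e] C(2)])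
    obtain M where M: "M > 0" "\<And>x. x \<in> C \<Longrightarrow> norm (wt a (fst x) * ramp_at e (u x)) \<le> M"
      using compact_bounded_image[OF C(1) cwR] by blast
    show ?thesis
    proof (rule set_integral_bounded_limit(1)[where M = "M * (BH * BH)"])
      show "C \<in> sets borel" "bounded C" using C by (auto simp: compact_imp_closed compact_imp_bounded)
      show "continuous_on C (\<lambda>x. wt a (fst x) * (ramp_at e (u x) * (dQ b (h n) x \<bullet> dQ b (h n) x)))" for n
        by (rule continuous_on_subset[OF _ C(2)], intro continuous_intros cw cut_cont e cdQ)
      fix x assume x: "x \<in> C"
      have xV: "x \<in> \<Omega>" "fst x \<noteq> 0" using x C U_sub by auto
      show "\<bar>wt a (fst x) * (ramp_at e (u x) * (dQ b (h n) x \<bullet> dQ b (h n) x))\<bar> \<le> M * (BH * BH)" for n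
      proof -
        have nd: "norm (dQ b (h n) x) \<le> BH"
        proof (rule dQ_bound[OF hp(1)])
          fix t assume t: "0 \<le> t" "t \<le> h n"
          have "x + t *\<^sub>R b \<in> C2" using x t hp(3)[of n] nb by (intro C2m) auto
          thus "x + t *\<^sub>R b \<in> \<Omega> \<and> fst (x + t *\<^sub>R b) \<noteq> 0 \<and> norm (HQ (x + t *\<^sub>R b) b) \<le> BH"
            using C2V BH by (auto simp: V_def)
        qed
        have "\<bar>wt a (fst x) * ramp_at e (u x)\<bar> * (norm (dQ b (h n) x) * norm (dQ b (h n) x)) \<le> M * (BH * BH)"
          using M(2)[OF x] nd M(1) BH(1) by (intro mult_mono) auto
        thus ?thesis by (simp add: abs_mult dot_square_norm power2_eq_square mult.assoc)
      qed
      show "(\<lambda>n. wt a (fst x) * (ramp_at e (u x) * (dQ b (h n) x \<bullet> dQ b (h n) x))) \<longlonglongrightarrow> wt a (fst x) * (ramp_at e (u x) * (HQ x b \<bullet> HQ x b))"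
        by (intro tendsto_intros dQ_tendsto xV hp hl)
    qed
  qed
  have bU: "bounded (U e)" using bounded_subset[OF bounded_\<Omega> U_sub] .
  have cwF: "continuous_on (K e) (\<lambda>x. wt a (fst x) * ?F x)"
    by (rule continuous_on_subset[OF _ K_sub_U[OF e]]) (intro continuous_intros cw U_cont cut_cont e)
  obtain M where M: "M > 0" "\<And>x. x \<in> K e \<Longrightarrow> norm (wt a (fst x) * ?F x) \<le> M"
    using compact_bounded_image[OF K_compact cwF] by blast
  have lim2: "(\<lambda>n. LINT x:U e|lborel. wt a (fst x) * ((dq b (h n) x)\<^sup>2 * ?F x))
      \<longlonglongrightarrow> (LINT x:U e|lborel. wt a (fst x) * ((Q x \<bullet> b)\<^sup>2 * ?F x))"
  proof (rule set_integral_bounded_limit(1)[where M = "M * (BQ * BQ)"])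
    show "U e \<in> sets borel" using U_open by auto
    show "continuous_on (U e) (\<lambda>x. wt a (fst x) * ((dq b (h n) x)\<^sup>2 * ?F x))" for n
      by (intro continuous_intros cw cdq U_cont cut_cont e)
    fix x assume x: "x \<in> U e"
    show "\<bar>wt a (fst x) * ((dq b (h n) x)\<^sup>2 * ?F x)\<bar> \<le> M * (BQ * BQ)" for n
    proof (cases "x \<in> K e")
      case True
      obtain t where t: "0 < t" "t < h n" "dq b (h n) x = Q (x + t *\<^sub>R b) \<bullet> b"
        using dq_bound[OF hp(1)[of n] seg\<Omega>[OF x, of _ n]] by blast
      have "\<bar>Q (x + t *\<^sub>R b) \<bullet> b\<bar> \<le> norm (Q (x + t *\<^sub>R b))" using b(1) by (rule Basis_le_norm)
      also have "\<dots> \<le> BQ" using seg[OF x, of t n] t BQ by auto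
      finally have "\<bar>dq b (h n) x\<bar> \<le> BQ" using t by simp
      hence "\<bar>wt a (fst x) * ?F x\<bar> * (\<bar>dq b (h n) x\<bar> * \<bar>dq b (h n) x\<bar>) \<le> M * (BQ * BQ)"
        using M(2)[OF True] M(1) BQ(1) by (intro mult_mono) auto
      thus ?thesis by (simp add: abs_mult power2_eq_square mult_ac)
    next
      case False
      thus ?thesis using off_K[OF e x] M(1) BQ(1) by simp
    qed
    show "(\<lambda>n. wt a (fst x) * ((dq b (h n) x)\<^sup>2 * ?F x)) \<longlonglongrightarrow> wt a (fst x) * ((Q x \<bullet> b)\<^sup>2 * ?F x)"
      using x U_sub by (intro tendsto_intros dq_tendsto hp hl) auto
  qed (rule bU)
  show ?thesis
    by (rule LIMSEQ_le[OF tendsto_mult_left[OF lim1] lim2]) (use le in auto)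
qed

end

section \<open>The radial derivative on the hyperplane\<close>

lemma pos_part_nonneg: "pos_part t \<ge> 0" by (simp add: pos_part_def)
lemma pos_part_cont: "continuous_on S f \<Longrightarrow> continuous_on S (\<lambda>x. pos_part (f x))"
  unfolding pos_part_def by (intro continuous_intros)

lemma tr_snd: "tr (\<lambda>h :: real \<times> 'b::euclidean_space. (0, snd h)) = real DIM('b)"
proof -
  have "(\<lambda>h :: real \<times> 'b. (0, snd h)) = (\<lambda>h. h - (h \<bullet> (1, 0)) *\<^sub>R (1, 0))"
    by (auto simp: fun_eq_iff inner_prod_def)
  thus ?thesis by (simp only: tr_simps) (simp add: inner_prod_def)
qed

context overdetermined
begin

text \<open>If \<open>\<partial>\<^sub>r u\<close> did not vanish at \<open>x0\<close>, the flux through the hyperplane at height \<open>\<delta>\<close> would be of order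
\<open>\<delta>\<^sup>a\<close>, while by the equation it has to balance an integral of order \<open>\<delta>\<^sup>a\<^sup>+\<^sup>1\<close>. This is made precise on the
side \<open>r > 0\<close> with the test function \<open>pc\<^sup>2 * ps\<^sup>3\<close>, a cutoff at height \<open>\<delta>\<close> times a bump of radius
\<open>\<rho>1\<close> in \<open>y\<close>, and with the derivatives in \<open>y\<close> moved from \<open>u\<close> to the bump. The constants are such that the
weighted divergence of the resulting field has a strict sign at every point where the test function is positive.\<close>

lemma radial_derivative_zero:
  assumes apos: "a > 0" and x0: "x0 \<in> \<Omega>" "fst x0 = 0"
  shows "fst (G x0) = 0"
proof (rule ccontr)
  assume nz: "fst (G x0) \<noteq> 0"
  define m where "m = \<bar>fst (G x0)\<bar>"
  define \<sigma> where "\<sigma> = sgn (fst (G x0))"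
  have m: "m > 0" "\<sigma> * fst (G x0) = m" "\<sigma> * \<sigma> = 1"
    using nz by (auto simp: m_def \<sigma>_def sgn_if)
  have cG: "continuous_on \<Omega> G" by (rule continuous_on_subset[OF G_cont closure_subset])
  have cu: "continuous_on \<Omega> u" by (rule continuous_on_subset[OF u_cont closure_subset])
  define S where "S = {x\<in>\<Omega>. \<sigma> * fst (G x) > m / 2}"
  have "open S" unfolding S_def by (rule open_superlevel[OF open_\<Omega>]) (intro continuous_intros cG)
  moreover have "x0 \<in> S" using x0 m by (simp add: S_def)
  ultimately obtain r1 where r1: "r1 > 0" "cball x0 r1 \<subseteq> S" using open_contains_cball by blast
  define \<rho> where "\<rho> = r1 / 2"
  define y0 where "y0 = snd x0"
  have \<rho>: "\<rho> > 0" using r1 by (simp add: \<rho>_def)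
  have boxS: "{- \<rho>..\<rho>} \<times> cball y0 \<rho> \<subseteq> S"
  proof
    fix x assume x: "x \<in> {- \<rho>..\<rho>} \<times> cball y0 \<rho>"
    have "norm (x - x0) \<le> \<bar>fst x\<bar> + norm (snd x - y0)"
      using norm_Pair_le[of "fst x" "snd x - y0"] x0(2) by (cases x; cases x0) (auto simp: y0_def)
    also have "\<dots> \<le> \<rho> + \<rho>" using x by (intro add_mono) (auto simp: dist_norm norm_minus_commute)
    finally have "x \<in> cball x0 r1" by (simp add: \<rho>_def dist_norm norm_minus_commute)
    thus "x \<in> S" using r1(2) by blast
  qed
  have S\<Omega>: "S \<subseteq> \<Omega>" by (auto simp: S_def)
  have "compact (closure \<Omega>)" using bounded_\<Omega> by (simp add: compact_closure)
  then obtain B where B: "B > 0" "\<And>x. x \<in> closure \<Omega> \<Longrightarrow> \<bar>u x\<bar> \<le> B"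
    using compact_bounded_image[OF _ u_cont] by auto
  define n where "n = real DIM('b)"
  define \<rho>1 where "\<rho>1 = \<rho> / 2"
  have \<rho>1: "\<rho>1 > 0" "\<rho>1 < \<rho>" using \<rho> by (auto simp: \<rho>1_def)
  \<comment> \<open>The Laplacian of the bump \<open>ps\<^sup>3\<close> is \<open>24 ps \<bar>E\<bar>\<^sup>2 - 6 n ps\<^sup>2\<close>. Completing a square shows that it is at least
    \<open>- C' * ps\<^sup>3\<close>, although the bump vanishes at the rim.\<close>
  define k where "k = (24 + 6 * n) / (48 * \<rho>1\<^sup>2)"
  define C' where "C' = 24 * \<rho>1\<^sup>2 * k\<^sup>2"
  have C'0: "C' \<ge> 0" by (simp add: C'_def)
  define K2 where "K2 = 1 + 2 * B * C'"
  have K2: "K2 > 0" using B C'0 by (simp add: K2_def add_pos_nonneg)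
  define \<delta> where "\<delta> = min (\<rho> / 2) (m / (2 * K2))"
  have \<delta>: "\<delta> > 0" "\<delta> < \<rho>" using \<rho> m K2 by (auto simp: \<delta>_def)
  have "K2 * \<delta> \<le> K2 * (m / (2 * K2))" using K2 by (intro mult_left_mono) (auto simp: \<delta>_def)
  hence K2\<delta>: "K2 * \<delta> < m" using K2 m by simp
  define E where "E x = (0::real, snd x - y0)" for x :: "real \<times> 'b"
  define ps where "ps x = pos_part (\<rho>1\<^sup>2 - E x \<bullet> E x)" for x
  define pc where "pc x = pos_part (\<delta> - fst x)" for x :: "real \<times> 'b"
  define e1 where "e1 = (1::real, 0::'b)"
  have e1: "h \<bullet> e1 = fst h" "e1 \<bullet> h = fst h" for h by (auto simp: e1_def inner_prod_def)
  \<comment> \<open>Adding \<open>\<sigma> * B\<close> to \<open>u\<close> gives the factor of the Laplacian of the bump the sign \<open>\<sigma>\<close>.\<close>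
  define W where "W x = (pc x ^ 2 * ps x ^ 3) *\<^sub>R G x + ((u x + \<sigma> * B) * (6 * (pc x ^ 2 * ps x ^ 2))) *\<^sub>R E x" for x
  define W' where "W' x h = (pc x ^ 2 * ps x ^ 3) *\<^sub>R H x h
      + (pc x ^ 2 * (3 * ps x ^ 2 * (- 2 * (h \<bullet> E x))) + 2 * pc x * (- (h \<bullet> e1)) * ps x ^ 3) *\<^sub>R G x
      + (((u x + \<sigma> * B) * (6 * (pc x ^ 2 * ps x ^ 2))) *\<^sub>R (0, snd h)
      + ((u x + \<sigma> * B) * (6 * (pc x ^ 2 * (2 * ps x * (- 2 * (h \<bullet> E x))) + 2 * pc x * (- (h \<bullet> e1)) * ps x ^ 2))
         + (h \<bullet> G x) * (6 * (pc x ^ 2 * ps x ^ 2))) *\<^sub>R E x)" for x h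
  define D where "D x = - (pc x ^ 2 * ps x ^ 3) - 2 * pc x * ps x ^ 3 * fst (G x)
      + (u x + \<sigma> * B) * (pc x ^ 2 * (6 * n * ps x ^ 2 - 24 * ps x * (E x \<bullet> E x)))" for x
  have dE: "(E has_derivative (\<lambda>h. (0, snd h))) (at x)" for x
    unfolding E_def[abs_def] by (auto intro!: derivative_eq_intros)
  have iE: "(0, snd h) \<bullet> E x = h \<bullet> E x" for h x by (simp add: E_def inner_prod_def)
  have dP: "GDERIV (\<lambda>x. \<rho>1\<^sup>2 - E x \<bullet> E x) x :> - 2 *\<^sub>R E x" for x
  proof -
    have "((\<lambda>x. \<rho>1\<^sup>2 - E x \<bullet> E x) has_derivative (\<lambda>h. 0 - (E x \<bullet> (0, snd h) + (0, snd h) \<bullet> E x))) (at x)"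
      by (intro has_derivative_diff has_derivative_const has_derivative_inner dE)
    moreover have "(\<lambda>h. 0 - (E x \<bullet> (0, snd h) + (0, snd h) \<bullet> E x)) = (\<lambda>h. h \<bullet> (- 2 *\<^sub>R E x))"
      by (simp add: fun_eq_iff iE inner_commute[of "E x"])
    ultimately show ?thesis by (simp add: gderiv_def)
  qed
  have dR: "GDERIV (\<lambda>x. \<delta> - fst x) x :> - e1" for x
    unfolding gderiv_def by (auto intro!: derivative_eq_intros simp: e1)
  have dps3: "((\<lambda>x. ps x ^ 3) has_derivative (\<lambda>h. 3 * ps x ^ 2 * (- 2 * (h \<bullet> E x)))) (at x)" for x
    using cut_deriv[OF dP, of "\<lambda>t. pos_part t ^ 3"] pos_part_power_deriv3[OF DERIV_ident] unfolding ps_def by fastforce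
  have dps2: "((\<lambda>x. ps x ^ 2) has_derivative (\<lambda>h. 2 * ps x * (- 2 * (h \<bullet> E x)))) (at x)" for x
    using cut_deriv[OF dP, of "\<lambda>t. pos_part t ^ 2"] pos_part_power_deriv2[OF DERIV_ident] unfolding ps_def by fastforce
  have dpc2: "((\<lambda>x. pc x ^ 2) has_derivative (\<lambda>h. 2 * pc x * (- (h \<bullet> e1)))) (at x)" for x
    using cut_deriv[OF dR, of "\<lambda>t. pos_part t ^ 2"] pos_part_power_deriv2[OF DERIV_ident] unfolding pc_def by fastforce
  have dW: "(W has_derivative W' x) (at x)" if x: "x \<in> \<Omega>" "fst x \<noteq> 0" for x
  proof -
    have du: "((\<lambda>x. u x + \<sigma> * B) has_derivative (\<lambda>h. h \<bullet> G x)) (at x)"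
      using has_derivative_add[OF u_grad[OF x(1), unfolded gderiv_def] has_derivative_const[of "\<sigma> * B"]] by simp
    show ?thesis unfolding W_def[abs_def] W'_def[abs_def]
      by (intro has_derivative_add has_derivative_scaleR has_derivative_mult dpc2 dps3 dps2 dE du G_deriv x
         has_derivative_mult_right)
  qed
  have EG0: "fst (E x) = 0" "e1 \<bullet> E x = 0" for x by (auto simp: E_def e1)
  have trW: "tr (W' x) + a / fst x * fst (W x) = D x" if x: "x \<in> \<Omega>" "fst x \<noteq> 0" for x
  proof -
    define tg where "tg = a / fst x * fst (G x)"
    have W'': "W' x = (\<lambda>h. (pc x ^ 2 * ps x ^ 3) *\<^sub>R H x h
      + ((- 6 * pc x ^ 2 * ps x ^ 2 * (h \<bullet> E x)) *\<^sub>R G x + (- 2 * pc x * ps x ^ 3 * (h \<bullet> e1)) *\<^sub>R G x)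
      + (((u x + \<sigma> * B) * (6 * (pc x ^ 2 * ps x ^ 2))) *\<^sub>R (0, snd h)
      + ((- 24 * (u x + \<sigma> * B) * pc x ^ 2 * ps x * (h \<bullet> E x)) *\<^sub>R E x
        + ((- 12 * (u x + \<sigma> * B) * pc x * ps x ^ 2 * (h \<bullet> e1)) *\<^sub>R E x
         + (6 * (pc x ^ 2 * ps x ^ 2) * (h \<bullet> G x)) *\<^sub>R E x))))"
      by (simp add: fun_eq_iff W'_def flip: scaleR_add_left) (simp add: algebra_simps)
    have 1: "tr (W' x) = pc x ^ 2 * ps x ^ 3 * tr (H x)
      + (- 6 * pc x ^ 2 * ps x ^ 2 * (E x \<bullet> G x) + - 2 * pc x * ps x ^ 3 * fst (G x))
      + ((u x + \<sigma> * B) * (6 * (pc x ^ 2 * ps x ^ 2)) * n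
      + (- 24 * (u x + \<sigma> * B) * pc x ^ 2 * ps x * (E x \<bullet> E x) + (0 + 6 * (pc x ^ 2 * ps x ^ 2) * (G x \<bullet> E x))))"
      unfolding W'' tr_simps tr_snd n_def by (simp add: e1 EG0)
    have 2: "a / fst x * fst (W x) = pc x ^ 2 * ps x ^ 3 * tg"
      by (simp add: W_def tg_def EG0)
    have 3: "tr (H x) = - 1 - tg" using pde[OF x] by (simp add: tg_def)
    show ?thesis unfolding 1 2 3 D_def by (simp add: algebra_simps inner_commute)
  qed
  define Z where "Z x = (if 0 < fst x then W x else 0)" for x
  define Z' where "Z' x = (if 0 < fst x then W' x else (\<lambda>_. 0))" for x
  define d where "d x = (if 0 < fst x then D x else 0)" for x
  define Ub where "Ub = {- \<rho><..<\<rho>} \<times> ball y0 \<rho>"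
  define Kb where "Kb = {0..\<delta>} \<times> cball y0 \<rho>1"
  have Ub: "open Ub" "Ub \<subseteq> {- \<rho>..\<rho>} \<times> cball y0 \<rho>" by (auto simp: Ub_def intro: open_Times)
  have UbS: "Ub \<subseteq> S" using Ub boxS by blast
  have Ub\<Omega>: "Ub \<subseteq> \<Omega>" using UbS S\<Omega> by blast
  have Kb: "compact Kb" "Kb \<subseteq> Ub" using \<rho>1 \<delta> by (auto simp: Ub_def Kb_def intro: compact_Times)
  have cE: "continuous_on A E" for A unfolding E_def by (intro continuous_intros)
  have cps: "continuous_on A ps" for A unfolding ps_def by (intro pos_part_cont continuous_intros cE)
  have cpc: "continuous_on A pc" for A unfolding pc_def by (intro pos_part_cont continuous_intros)
  have cW: "continuous_on \<Omega> W" unfolding W_def by (intro continuous_intros cE cps cpc cG cu)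
  have cD: "continuous_on \<Omega> D" unfolding D_def by (intro continuous_intros cE cps cpc cG cu)
  have Woff: "W x = 0" if "x \<in> Ub" "x \<notin> Kb" "0 < fst x" for x
  proof -
    have "fst x > \<delta> \<or> norm (snd x - y0) > \<rho>1" using that by (cases x) (auto simp: Kb_def dist_norm norm_minus_commute)
    thus ?thesis
    proof
      assume "norm (snd x - y0) > \<rho>1"
      hence "(norm (snd x - y0))\<^sup>2 \<ge> \<rho>1\<^sup>2" using \<rho>1 by (intro power_mono) auto
      hence "ps x = 0" by (simp add: ps_def pos_part_def E_def inner_prod_def power2_norm_eq_inner)
      thus ?thesis by (simp add: W_def)
    qed (simp add: W_def pc_def pos_part_def)
  qed
  have T: "finite {0::real}" "0 \<in> {0::real}" by auto
  have cZ: "continuous_on Ub (\<lambda>x. wt a (fst x) *\<^sub>R Z x)"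
  proof -
    \<comment> \<open>The weight vanishes on the hyperplane, so the jump of \<open>Z\<close> there is harmless.\<close>
    have "continuous_on Ub (\<lambda>x. wt a (max 0 (fst x)) *\<^sub>R W x)"
      by (intro continuous_intros wt_cont a_nonneg continuous_on_subset[OF cW Ub\<Omega>])
    thus ?thesis by (rule continuous_on_eq) (auto simp: Z_def wt_0 apos)
  qed
  have ZK: "Z x = 0" if "x \<in> Ub" "x \<notin> Kb" for x using Woff that by (simp add: Z_def)
  have o1: "open {x\<in>Ub. fst x > 0}" and o2: "open {x\<in>Ub. - fst x > 0}"
    by (rule open_superlevel[OF Ub(1)], intro continuous_intros)+
  have dZ: "(Z has_derivative Z' x) (at x)" if x: "x \<in> Ub" "fst x \<notin> {0}" for x
  proof (cases "fst x > 0")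
    case True
    have "(Z has_derivative W' x) (at x)"
      by (rule has_derivative_transform_within_open[OF dW o1]) (use x True Ub\<Omega> in \<open>auto simp: Z_def\<close>)
    thus ?thesis using True by (simp add: Z'_def)
  next
    case False
    have "(Z has_derivative (\<lambda>_. 0)) (at x)"
      by (rule has_derivative_transform_within_open[OF has_derivative_const o2]) (use x False in \<open>auto simp: Z_def\<close>)
    thus ?thesis using False by (simp add: Z'_def)
  qed
  have split: "{x\<in>Ub. fst x \<notin> {0}} = {x\<in>Ub. fst x > 0} \<union> {x\<in>Ub. - fst x > 0}" by auto
  have cZ': "continuous_on {x\<in>Ub. fst x \<notin> {0}} (\<lambda>x. Z' x b)" for b
    unfolding split
  proof (rule continuous_on_open_Un[OF o1 o2])
    have sub: "{x\<in>Ub. fst x > 0} \<subseteq> {x\<in>\<Omega>. fst x \<noteq> 0}" "{x\<in>Ub. fst x > 0} \<subseteq> \<Omega>" using Ub\<Omega> by auto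
    have "continuous_on {x\<in>Ub. fst x > 0} (\<lambda>x. W' x b)" unfolding W'_def
      by (intro continuous_intros cE cps cpc continuous_on_subset[OF cG sub(2)] continuous_on_subset[OF cu sub(2)]
        continuous_on_subset[OF H_cont sub(1)])
    thus "continuous_on {x\<in>Ub. fst x > 0} (\<lambda>x. Z' x b)" by (rule continuous_on_eq) (simp add: Z'_def)
    show "continuous_on {x\<in>Ub. - fst x > 0} (\<lambda>x. Z' x b)"
      by (rule continuous_on_eq[OF continuous_on_const[of _ 0]]) (simp add: Z'_def)
  qed
  have trZ: "tr (Z' x) + a / fst x * fst (Z x) = d x" if x: "x \<in> Ub" "fst x \<notin> {0}" for x
  proof (cases "fst x > 0")
    case True
    thus ?thesis using trW[of x] x Ub\<Omega> by (auto simp: Z_def Z'_def d_def)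
  next
    case False
    thus ?thesis by (simp add: Z_def Z'_def d_def tr_def)
  qed
  have "compact ({- \<rho>..\<rho>} \<times> cball y0 \<rho>)" by (intro compact_Times) auto
  then obtain M where M: "M > 0" "\<And>x. x \<in> {- \<rho>..\<rho>} \<times> cball y0 \<rho> \<Longrightarrow> norm (D x) \<le> M"
    using compact_bounded_image[OF _ continuous_on_subset[OF cD]] boxS S\<Omega> by (meson subset_trans)
  have bd: "\<bar>d x\<bar> \<le> M" if x: "x \<in> Ub" "fst x \<notin> {0}" for x
    using M(2)[of x] M(1) x Ub(2) by (auto simp: d_def)
  have I: "integrable lborel (\<lambda>x. indicator {x\<in>Ub. fst x \<notin> {0}} x * (wt a (fst x) * d x))"
    "integral\<^sup>L lborel (\<lambda>x. indicator {x\<in>Ub. fst x \<notin> {0}} x * (wt a (fst x) * d x)) = 0"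
    by (rule divergence_weighted_bounded[OF a_nonneg T Ub(1) Kb cZ ZK dZ cZ' trZ bd]; assumption)+
  have key: "- \<sigma> * D x \<ge> pc x * ps x ^ 3 * (m - K2 * \<delta>)" if x: "x \<in> Ub" "fst x > 0" for x
  proof -
    define t where "t = ps x"
    define p where "p = pc x"
    define V where "V = \<sigma> * u x + B"
    define X where "X = 24 * t * (E x \<bullet> E x) - 6 * n * t ^ 2"
    have t0: "t \<ge> 0" and p0: "p \<ge> 0" by (auto simp: t_def p_def ps_def pc_def pos_part_nonneg)
    have p\<delta>: "p \<le> \<delta>" using x \<delta> by (simp add: p_def pc_def pos_part_def)
    have g: "\<sigma> * fst (G x) \<ge> m / 2" using UbS x by (auto simp: S_def)
    have s1: "\<sigma> = 1 \<or> \<sigma> = - 1" using nz by (auto simp: \<sigma>_def sgn_if)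
    have ub: "\<bar>u x\<bar> \<le> B" using B(2)[of x] Ub\<Omega> x closure_subset[of \<Omega>] by blast
    have V: "0 \<le> V" "V \<le> 2 * B" using s1 ub by (auto simp: V_def)
    have X: "X \<ge> - C' * t ^ 3"
    proof (cases "t = 0")
      case False
      hence EE: "E x \<bullet> E x = \<rho>1\<^sup>2 - t" by (auto simp: t_def ps_def pos_part_def max_def split: if_splits)
      have "X + C' * t ^ 3 = t * (24 * \<rho>1\<^sup>2 * (1 - k * t)\<^sup>2)"
      proof -
        have "48 * \<rho>1\<^sup>2 * k = 24 + 6 * n" using \<rho>1 by (simp add: k_def)
        hence n: "6 * n = 48 * \<rho>1\<^sup>2 * k - 24" by simp
        show ?thesis unfolding X_def EE C'_def n by (simp add: algebra_simps power2_eq_square power3_eq_cube)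
      qed
      moreover have "t * (24 * \<rho>1\<^sup>2 * (1 - k * t)\<^sup>2) \<ge> 0" using t0 by simp
      ultimately show ?thesis by simp
    qed (simp add: X_def)
    have "V * X \<ge> V * (- C' * t ^ 3)" using X V by (intro mult_left_mono) auto
    moreover have "V * (C' * t ^ 3) \<le> 2 * B * (C' * t ^ 3)" using V C'0 t0 by (intro mult_right_mono) auto
    ultimately have VX: "V * X \<ge> - (2 * B * C' * t ^ 3)" by simp
    have s\<sigma>: "\<sigma> * (u x + \<sigma> * B) = V" using m(3) by (simp add: V_def distrib_left flip: mult.assoc)
    have "- \<sigma> * D x = \<sigma> * (p\<^sup>2 * t ^ 3) + 2 * p * t ^ 3 * (\<sigma> * fst (G x)) + (\<sigma> * (u x + \<sigma> * B)) * (p\<^sup>2 * X)"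
      unfolding D_def X_def t_def[symmetric] p_def[symmetric] by (simp add: algebra_simps)
    also have "\<dots> = \<sigma> * (p\<^sup>2 * t ^ 3) + 2 * p * t ^ 3 * (\<sigma> * fst (G x)) + p\<^sup>2 * (V * X)"
      unfolding s\<sigma> by simp
    also have "\<dots> \<ge> - (p\<^sup>2 * t ^ 3) + 2 * p * t ^ 3 * (m / 2) + p\<^sup>2 * (- (2 * B * C' * t ^ 3))"
      using s1 t0 p0 g VX by (intro add_mono mult_left_mono) auto
    also have "- (p\<^sup>2 * t ^ 3) + 2 * p * t ^ 3 * (m / 2) + p\<^sup>2 * (- (2 * B * C' * t ^ 3)) = p * t ^ 3 * (m - K2 * p)"
      by (simp add: K2_def algebra_simps power2_eq_square)
    finally have "- \<sigma> * D x \<ge> p * t ^ 3 * (m - K2 * p)" .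
    moreover have "p * t ^ 3 * (m - K2 * p) \<ge> p * t ^ 3 * (m - K2 * \<delta>)"
      using p\<delta> K2 p0 t0 by (intro mult_left_mono) auto
    ultimately show ?thesis by (simp add: p_def t_def)
  qed
  let ?V = "{x\<in>Ub. fst x \<notin> {0}}"
  have oV: "open ?V" using open_Int[OF Ub(1) open_fst_notin[of "{0}"]] by (simp add: Int_def)
  have cd: "continuous_on ?V (\<lambda>x. - \<sigma> * (wt a (fst x) * d x))"
  proof -
    have "continuous_on ?V d"
      unfolding split
    proof (rule continuous_on_open_Un[OF o1 o2])
      have sub: "{x\<in>Ub. fst x > 0} \<subseteq> \<Omega>" using Ub\<Omega> by auto
      show "continuous_on {x\<in>Ub. fst x > 0} d"
        by (rule continuous_on_eq[OF continuous_on_subset[OF cD sub]]) (simp add: d_def)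
      show "continuous_on {x\<in>Ub. - fst x > 0} d"
        by (rule continuous_on_eq[OF continuous_on_const[of _ 0]]) (simp add: d_def)
    qed
    thus ?thesis by (intro continuous_intros wt_cont a_nonneg)
  qed
  have z: "- \<sigma> * (wt a (fst x) * d x) = 0" if "x \<in> ?V" for x
  proof (rule nonneg_continuous_integral_zero[OF oV cd _ _ _ that])
    show "0 \<le> - \<sigma> * (wt a (fst x) * d x)" if "x \<in> ?V" for x
    proof (cases "fst x > 0")
      case True
      have "0 \<le> pc x * ps x ^ 3 * (m - K2 * \<delta>)" using K2\<delta> by (simp add: pc_def ps_def pos_part_nonneg)
      hence "0 \<le> - \<sigma> * D x" using key[of x] that True by auto
      with wt_nonneg[of a "fst x"] have "0 \<le> wt a (fst x) * (- \<sigma> * D x)" by (rule mult_nonneg_nonneg)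
      thus ?thesis using True by (simp add: d_def mult_ac)
    qed (simp add: d_def)
    show "integrable lborel (\<lambda>x. indicator ?V x * (- \<sigma> * (wt a (fst x) * d x)))"
      using integrable_mult_right[OF I(1), of "- \<sigma>"] by (simp add: mult_ac)
    show "integral\<^sup>L lborel (\<lambda>x. indicator ?V x * (- \<sigma> * (wt a (fst x) * d x))) = 0"
      using integral_mult_right_zero[of lborel "- \<sigma>" "\<lambda>x. indicator ?V x * (wt a (fst x) * d x)"] I(2) by (simp add: mult_ac)
  qed
  define x1 where "x1 = (\<delta> / 2, y0)"
  have x1: "x1 \<in> ?V" "fst x1 > 0" using \<delta> \<rho> by (auto simp: x1_def Ub_def)
  have "pc x1 > 0" "ps x1 > 0" using \<delta> \<rho>1 by (auto simp: x1_def pc_def ps_def pos_part_def E_def inner_prod_def)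
  hence "pc x1 * ps x1 ^ 3 * (m - K2 * \<delta>) > 0" using K2\<delta> by simp
  hence "- \<sigma> * D x1 > 0" using key[of x1] x1 by auto
  moreover have "wt a (fst x1) > 0" using x1 by (intro wt_pos) auto
  ultimately show False using z[OF x1(1)] x1 by (auto simp: d_def)
qed

end

section \<open>The radial direction\<close>

lemma set_integrable_bounded_continuous:
  fixes f :: "'a::euclidean_space \<Rightarrow> real"
  assumes "A \<in> sets borel" "bounded A" "continuous_on A f" "\<And>x. x \<in> A \<Longrightarrow> \<bar>f x\<bar> \<le> M"
  shows "set_integrable lborel A f"
  by (rule set_integral_bounded_limit(2)[where f = "\<lambda>_. f" and M = M]) (use assms in auto)

context overdetermined
begin

text \<open>The radial direction for \<open>a > 0\<close>, where the equation is not invariant under translation: the difference quotient \<open>v\<close>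
of \<open>q\<close> satisfies \<open>L v = a Q\<^sub>r(x + h b) / (r (r + h))\<close>, which in the limit has the sign of \<open>Q\<^sub>r\<close>. With
\<open>\<theta> t = ramp_at \<delta> (t\<^sup>2)\<close> the function \<open>\<theta> \<circ> v\<close> is subharmonic in the limit and vanishes near the hyperplane,
because \<open>Q\<^sub>r\<close> is zero there; so no regularity of \<open>Q\<^sub>r\<close> across the hyperplane is required.\<close>

lemma radial_inequality_truncated:
  assumes apos: "a > 0" and e: "e > 0" and \<delta>: "\<delta> > 0"
  shows "0 \<le> (LINT x:U e|lborel. wt a (fst x) * (ramp_at \<delta> ((fst (Q x))\<^sup>2) * (bump_at e (u x) * (G x \<bullet> G x) - step_at e (u x))))"
proof -
  obtain h0 K1 where h0: "h0 > 0" "compact K1" "K1 \<subseteq> \<Omega>" "U e \<subseteq> K1"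
    "\<And>x y. x \<in> U e \<Longrightarrow> norm y \<le> h0 \<Longrightarrow> x + y \<in> K1" using shift_room[OF e] by blast
  have K1c: "K1 \<subseteq> closure \<Omega>" using h0(3) closure_subset by blast
  have cQ1: "continuous_on K1 Q" by (rule continuous_on_subset[OF Q_cont K1c])
  obtain BQ where BQ: "BQ > 0" "\<And>x. x \<in> K1 \<Longrightarrow> norm (Q x) \<le> BQ"
    using compact_bounded_image[OF h0(2) cQ1] by blast
  have Q0: "fst (Q x) = 0" if "x \<in> \<Omega>" "fst x = 0" for x
    using radial_derivative_zero[OF apos that] that by (simp add: Q_def)
  obtain \<rho> where \<rho>: "\<rho> > 0" "\<And>x. x \<in> K1 \<Longrightarrow> \<bar>fst x\<bar> \<le> 2 * \<rho> \<Longrightarrow> (fst (Q x))\<^sup>2 \<le> \<delta>"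
  proof -
    define D where "D = {x\<in>closure K1. (fst (Q x))\<^sup>2 \<ge> \<delta>}"
    have cl: "closure K1 = K1" using h0(2) by (simp add: compact_imp_closed)
    have D: "compact D" unfolding D_def
      by (rule compact_superlevel[OF compact_imp_bounded[OF h0(2)]], unfold cl, intro continuous_intros cQ1)
    show thesis
    proof (cases "D = {}")
      case True
      show thesis by (rule that[of 1]) (use True in \<open>auto simp: D_def cl not_le intro: less_imp_le\<close>)
    next
      case False
      have "continuous_on D (\<lambda>x. \<bar>fst x\<bar>)" by (intro continuous_intros)
      from continuous_attains_inf[OF D False this]
      obtain z where z: "z \<in> D" "\<And>y. y \<in> D \<Longrightarrow> \<bar>fst z\<bar> \<le> \<bar>fst y\<bar>" by blast
      have "fst z \<noteq> 0" using z(1) Q0[of z] h0(3) \<delta> by (auto simp: D_def cl)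
      show thesis
      proof (rule that[of "\<bar>fst z\<bar> / 3"])
        show "\<bar>fst z\<bar> / 3 > 0" using \<open>fst z \<noteq> 0\<close> by simp
        fix x assume x: "x \<in> K1" "\<bar>fst x\<bar> \<le> 2 * (\<bar>fst z\<bar> / 3)"
        show "(fst (Q x))\<^sup>2 \<le> \<delta>"
        proof (rule ccontr)
          assume "\<not> ?thesis"
          hence "x \<in> D" using x by (simp add: D_def cl)
          thus False using z(2)[of x] x \<open>fst z \<noteq> 0\<close> by simp
        qed
      qed
    qed
  qed
  define S where "S = {x :: real \<times> 'b. \<bar>fst x\<bar> > \<rho> / 2}"
  define C where "C = {x :: real \<times> 'b. \<bar>fst x\<bar> \<ge> \<rho>}"
  have S: "open S" unfolding S_def by (intro open_Collect_less continuous_intros)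
  have C: "closed C" unfolding C_def by (intro closed_Collect_le continuous_intros)
  have CS: "C \<subseteq> S" using \<rho> by (auto simp: C_def S_def)
  define b where "b = (1::real, 0::'b)"
  have nb: "norm b = 1" "fst b = 1" "b \<in> Basis" and ib: "z \<bullet> b = fst z" for z
    by (auto simp: b_def norm_Pair inner_prod_def Basis_prod_def)
  define h where "h n = min h0 (\<rho> / 4) * inverse (real (Suc n))" for n
  have hp: "h n > 0" "h n \<le> h0" "h n \<le> \<rho> / 4" "h n \<noteq> 0" for n
  proof -
    show "h n > 0" "h n \<noteq> 0" using h0 \<rho> by (auto simp: h_def)
    have "h n \<le> min h0 (\<rho> / 4)" unfolding h_def using h0 \<rho> by (intro mult_left_le) (auto simp: divide_simps)
    thus "h n \<le> h0" "h n \<le> \<rho> / 4" by auto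
  qed
  have hl: "h \<longlonglongrightarrow> 0" unfolding h_def by (rule tendsto_mult_right_zero[OF LIMSEQ_inverse_real_of_nat])
  have seg: "x + t *\<^sub>R b \<in> K1" if "x \<in> U e" "0 \<le> t" "t \<le> h n" for x t n
    using that h0(5)[of x "t *\<^sub>R b"] hp(2)[of n] nb by simp
  have seg\<Omega>: "x + t *\<^sub>R b \<in> \<Omega>" if "x \<in> U e" "0 \<le> t" "t \<le> h n" for x t n
    using seg[OF that] h0 by blast
  have sh: "x + h n *\<^sub>R b \<in> \<Omega>" "x + h n *\<^sub>R b \<in> K1" if "x \<in> U e" for x n
    using seg\<Omega>[OF that, of "h n" n] seg[OF that, of "h n" n] hp(1)[of n] by auto
  have offp: "\<bar>fst x\<bar> \<ge> \<rho> / 2 \<and> \<bar>fst x + h n\<bar> \<ge> \<rho> / 4 \<and> fst x \<noteq> 0 \<and> fst x + h n \<noteq> 0" if "x \<in> S" for x n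
  proof -
    have "\<bar>fst x\<bar> > \<rho> / 2" using that by (simp add: S_def)
    thus ?thesis using hp(1,3)[of n] \<rho>(1) by (intro conjI; linarith)
  qed
  let ?A = "U e \<inter> S"
  have A: "open ?A" "?A \<subseteq> U e" "?A \<subseteq> \<Omega>" using U_open S U_sub by auto
  have bA: "bounded ?A" using bounded_subset[OF bounded_\<Omega> A(3)] .
  have cQ: "continuous_on \<Omega> Q" by (rule continuous_on_subset[OF Q_cont closure_subset])
  have cdQ: "continuous_on ?A (dQ b (h n))" for n
    unfolding dQ_def using sh A
    by (intro continuous_intros shift_cont[OF cQ] continuous_on_subset[OF cQ]) auto
  have cdq: "continuous_on ?A (dq b (h n))" for n
  proof (rule continuous_at_imp_continuous_on, rule ballI)
    fix x assume "x \<in> ?A"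
    thus "isCont (dq b (h n)) x"
      using dq_grad[of x "h n" b] sh[of x n] A has_derivative_continuous unfolding gderiv_def by blast
  qed
  have cw: "continuous_on X (\<lambda>x::real \<times> 'b. wt a (fst x))" for X by (intro wt_cont a_nonneg continuous_intros)
  let ?F = "\<lambda>x. bump_at e (u x) * (G x \<bullet> G x) - step_at e (u x)"
  define \<theta> where "\<theta> t = ramp_at \<delta> (t\<^sup>2)" for t
  define \<theta>1 where "\<theta>1 t = step_at \<delta> (t\<^sup>2) * (2 * t)" for t
  define \<theta>2 where "\<theta>2 t = bump_at \<delta> (t\<^sup>2) * (2 * t) * (2 * t) + 2 * step_at \<delta> (t\<^sup>2)" for t
  have d2: "((\<lambda>t. t\<^sup>2) has_real_derivative 2 * t) (at t)" for t :: real by (auto intro!: derivative_eq_intros)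
  have d\<theta>: "(\<theta> has_real_derivative \<theta>1 t) (at t)" for t
    unfolding \<theta>_def[abs_def] \<theta>1_def by (rule DERIV_chain2[OF ramp_at_deriv[OF \<delta>] d2])
  have d\<theta>1: "(\<theta>1 has_real_derivative \<theta>2 t) (at t)" for t
  proof -
    have "((\<lambda>t. 2 * t) has_real_derivative 2) (at t)" by (auto intro!: derivative_eq_intros)
    from DERIV_mult[OF DERIV_chain2[OF step_at_deriv[OF \<delta>] d2] this]
    show ?thesis unfolding \<theta>1_def[abs_def] \<theta>2_def by (simp add: mult_ac)
  qed
  have c\<theta>2: "continuous_on UNIV \<theta>2" unfolding \<theta>2_def
    by (intro continuous_intros continuous_on_compose2[OF bump_at_cont[OF \<delta>, of UNIV]] continuous_on_compose2[OF step_at_cont[OF \<delta>, of UNIV]]) auto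
  have c\<theta>: "continuous_on X \<theta>" "continuous_on X \<theta>1" for X
    using DERIV_continuous_on[OF has_field_derivative_at_within[OF d\<theta>]] DERIV_continuous_on[OF has_field_derivative_at_within[OF d\<theta>1]] by auto
  have \<theta>2n: "\<theta>2 t \<ge> 0" for t
    unfolding \<theta>2_def using bump_at_nonneg[OF \<delta>] step_at_nonneg by (simp add: mult.assoc)
  define l where "l n x = a * fst (Q (x + h n *\<^sub>R b)) / (fst x * (fst x + h n))" for n x
  have cl: "continuous_on ?A (l n)" for n
    unfolding l_def using sh A offp[of _ n]
    by (intro continuous_intros shift_cont[OF cQ]) auto
  have dqB: "\<bar>dq b (h n) x\<bar> \<le> BQ \<and> (\<bar>fst x\<bar> < \<rho> \<longrightarrow> (dq b (h n) x)\<^sup>2 \<le> \<delta>)" if x: "x \<in> U e" for x n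
  proof -
    obtain t where t: "0 < t" "t < h n" "dq b (h n) x = Q (x + t *\<^sub>R b) \<bullet> b"
      using dq_bound[OF hp(1)[of n] seg\<Omega>[OF x, of _ n]] by blast
    have k: "x + t *\<^sub>R b \<in> K1" using seg[OF x, of t n] t by auto
    have "\<bar>Q (x + t *\<^sub>R b) \<bullet> b\<bar> \<le> norm (Q (x + t *\<^sub>R b))" using nb(3) by (rule Basis_le_norm)
    also have "\<dots> \<le> BQ" using k BQ by auto
    finally have 1: "\<bar>dq b (h n) x\<bar> \<le> BQ" using t by simp
    have "(dq b (h n) x)\<^sup>2 \<le> \<delta>" if "\<bar>fst x\<bar> < \<rho>"
    proof -
      have "\<bar>fst (x + t *\<^sub>R b)\<bar> \<le> 2 * \<rho>" using that t hp(3)[of n] \<rho>(1) nb by auto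
      from \<rho>(2)[OF k this] show ?thesis unfolding t(3) ib .
    qed
    thus ?thesis using 1 by blast
  qed
  let ?f = "\<lambda>n x. wt a (fst x) * (\<theta> (dq b (h n) x) * ?F x - ramp_at e (u x) * (\<theta>1 (dq b (h n) x) * l n x))"
  have nonneg: "0 \<le> (LINT x:?A|lborel. ?f n x)"
    and bf: "\<exists>M. \<forall>n. \<forall>x\<in>?A. \<bar>?f n x\<bar> \<le> M" for n
  proof -
    have cwF: "continuous_on (K e) (\<lambda>x. (wt a (fst x) * ?F x, wt a (fst x) * ramp_at e (u x)))"
      by (rule continuous_on_subset[OF _ K_sub_U[OF e]]) (intro continuous_intros cw U_cont cut_cont e)
    obtain M where M: "M > 0" "\<And>x. x \<in> K e \<Longrightarrow> norm (wt a (fst x) * ?F x, wt a (fst x) * ramp_at e (u x)) \<le> M"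
      using compact_bounded_image[OF K_compact cwF] by blast
    define L where "L = a * BQ / (\<rho> / 2 * (\<rho> / 4))"
    have L0: "L \<ge> 0" using a_nonneg BQ \<rho> by (simp add: L_def)
    have bound: "\<bar>?f n x\<bar> \<le> M * BQ\<^sup>2 + M * (2 * BQ * L)" if x: "x \<in> ?A" for n x
    proof (cases "x \<in> K e")
      case True
      have xU: "x \<in> U e" and xS: "x \<in> S" using x by auto
      have m: "\<bar>wt a (fst x) * ?F x\<bar> \<le> M" "\<bar>wt a (fst x) * ramp_at e (u x)\<bar> \<le> M"
        using M(2)[OF True] norm_fst_le[of "wt a (fst x) * ?F x" "wt a (fst x) * ramp_at e (u x)"]
          norm_snd_le[of "wt a (fst x) * ramp_at e (u x)" "wt a (fst x) * ?F x"] by auto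
      have v: "\<bar>dq b (h n) x\<bar> \<le> BQ" using dqB[OF xU] by blast
      have t0: "\<bar>\<theta> (dq b (h n) x)\<bar> \<le> BQ\<^sup>2"
      proof -
        have "\<theta> (dq b (h n) x) \<le> (dq b (h n) x)\<^sup>2" unfolding \<theta>_def by (rule ramp_at_le[OF \<delta>]) simp
        also have "\<dots> \<le> BQ\<^sup>2" using v BQ(1) by (simp add: abs_le_square_iff[symmetric])
        finally show ?thesis using ramp_at_nonneg[OF \<delta>] by (simp add: \<theta>_def)
      qed
      have "\<bar>step_at \<delta> ((dq b (h n) x)\<^sup>2)\<bar> * \<bar>2 * dq b (h n) x\<bar> \<le> 1 * (2 * BQ)"
        using v BQ(1) by (intro mult_mono) (auto simp: step_at_nonneg step_at_le)
      hence t1: "\<bar>\<theta>1 (dq b (h n) x)\<bar> \<le> 2 * BQ" by (simp add: \<theta>1_def abs_mult)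
      have l1: "\<bar>l n x\<bar> \<le> L"
      proof -
        have "\<bar>fst (Q (x + h n *\<^sub>R b))\<bar> \<le> norm (Q (x + h n *\<^sub>R b))" using Basis_le_norm[OF nb(3)] unfolding ib .
        also have "\<dots> \<le> BQ" using sh(2)[OF xU] BQ by blast
        finally have 1: "\<bar>a * fst (Q (x + h n *\<^sub>R b))\<bar> \<le> a * BQ" using a_nonneg by (simp add: abs_mult mult_left_mono)
        have "\<rho> / 2 * (\<rho> / 4) \<le> \<bar>fst x\<bar> * \<bar>fst x + h n\<bar>"
          using offp[OF xS, of n] \<rho>(1) by (intro mult_mono) auto
        hence 2: "\<rho> / 2 * (\<rho> / 4) \<le> \<bar>fst x * (fst x + h n)\<bar>" by (simp add: abs_mult)
        have "\<bar>l n x\<bar> = \<bar>a * fst (Q (x + h n *\<^sub>R b))\<bar> / \<bar>fst x * (fst x + h n)\<bar>" unfolding l_def by (rule abs_divide)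
        also have "\<dots> \<le> L" unfolding L_def using 1 2 \<rho>(1) by (intro frac_le) auto
        finally show ?thesis .
      qed
      have "\<bar>?f n x\<bar> = \<bar>(wt a (fst x) * ?F x) * \<theta> (dq b (h n) x) - (wt a (fst x) * ramp_at e (u x)) * (\<theta>1 (dq b (h n) x) * l n x)\<bar>"
        by (simp add: algebra_simps)
      also have "\<dots> \<le> \<bar>wt a (fst x) * ?F x\<bar> * \<bar>\<theta> (dq b (h n) x)\<bar> + \<bar>wt a (fst x) * ramp_at e (u x)\<bar> * (\<bar>\<theta>1 (dq b (h n) x)\<bar> * \<bar>l n x\<bar>)"
        unfolding abs_mult[symmetric] by (rule abs_triangle_ineq4)
      also have "\<dots> \<le> M * BQ\<^sup>2 + M * (2 * BQ * L)"
        using m t0 t1 l1 M(1) BQ(1) L0 by (intro add_mono mult_mono) auto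
      finally show ?thesis .
    next
      case False
      have "?f n x = 0" using off_K[OF e, of x] False x by simp
      moreover have "0 \<le> M * BQ\<^sup>2 + M * (2 * BQ * L)" using M(1) BQ(1) L0 by simp
      ultimately show ?thesis by (simp only: abs_zero)
    qed
    thus "\<exists>M. \<forall>n. \<forall>x\<in>?A. \<bar>?f n x\<bar> \<le> M" by blast
    have cA: "continuous_on ?A (\<lambda>x. \<theta> (dq b (h n) x))" "continuous_on ?A (\<lambda>x. \<theta>1 (dq b (h n) x))"
      by (rule continuous_on_compose2[OF c\<theta>(1)[of UNIV] cdq] continuous_on_compose2[OF c\<theta>(2)[of UNIV] cdq], simp)+
    have cf: "continuous_on ?A (?f n)"
      by (intro continuous_intros cw cA cl continuous_on_subset[OF U_cont(1) A(2)] continuous_on_subset[OF U_cont(2) A(2)]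
        continuous_on_subset[OF cut_cont(1)[OF e] A(2)] continuous_on_subset[OF cut_cont(2)[OF e] A(2)]
        continuous_on_subset[OF cut_cont(3)[OF e] A(2)])
    have i: "set_integrable lborel ?A (?f n)"
      by (rule set_integrable_bounded_continuous[OF _ bA cf bound]) (use A in auto)
    let ?d = "\<lambda>x. wt a (fst x) * (ramp_at e (u x) * (\<theta>2 (dq b (h n) x) * (dQ b (h n) x \<bullet> dQ b (h n) x) + \<theta>1 (dq b (h n) x) * l n x)
      - \<theta> (dq b (h n) x) * ?F x)"
    have T: "finite {0::real}" "0 \<in> {0::real}" by auto
    have gc: "set_integrable lborel ?A ?d" "(LINT x:?A|lborel. ?d x) = 0"
    proof -
      have 1: "GDERIV (dq b (h n)) x :> dQ b (h n) x" if "x \<in> ?A" for x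
        using dq_grad that sh A by blast
      have 2: "(dQ b (h n) has_derivative dHQ b (h n) x) (at x)" if "x \<in> ?A" "fst x \<notin> {0}" for x
        using that sh A offp[of x n] nb by (intro dQ_deriv) auto
      have 3: "continuous_on {x \<in> ?A. fst x \<notin> {0}} (\<lambda>x. dHQ b (h n) x v)" for v
        unfolding dHQ_def using sh A offp[of _ n] nb
        by (intro continuous_intros shift_cont[OF HQ_cont] continuous_on_subset[OF HQ_cont]) auto
      have 4: "tr (dHQ b (h n) x) + a / fst x * fst (dQ b (h n) x) = l n x" if "x \<in> ?A" "fst x \<notin> {0}" for x
      proof -
        have x: "x \<in> U e" "x \<in> \<Omega>" "x \<in> S" using that A by auto
        note o = offp[OF x(3), of n]
        define r where "r = fst x"
        define s where "s = fst x + h n"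
        define q1 where "q1 = fst (Q (x + h n *\<^sub>R b))"
        have rs: "r \<noteq> 0" "s \<noteq> 0" "s - r = h n" "h n \<noteq> 0" using o hp by (auto simp: r_def s_def)
        have fs: "fst (x + h n *\<^sub>R b) = s" using nb by (simp add: s_def)
        have 1: "tr (HQ x) = - (a / r * fst (Q x))" using Q_pde[of x] x o by (simp add: r_def)
        have "tr (HQ (x + h n *\<^sub>R b)) + a / fst (x + h n *\<^sub>R b) * fst (Q (x + h n *\<^sub>R b)) = 0"
          using sh(1)[OF x(1)] rs fs by (intro Q_pde) auto
        hence 2: "tr (HQ (x + h n *\<^sub>R b)) = - (a / s * q1)" unfolding fs q1_def by simp
        have "tr (dHQ b (h n) x) + a / fst x * fst (dQ b (h n) x) =
          (1 / h n) * (tr (HQ (x + h n *\<^sub>R b)) - tr (HQ x)) + a / r * ((1 / h n) * (q1 - fst (Q x)))"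
          unfolding dHQ_def dQ_def tr_simps by (simp add: r_def q1_def)
        also have "\<dots> = (1 / h n) * (a * q1 * (1 / r - 1 / s))"
          unfolding 1 2 by (simp add: algebra_simps)
        also have "1 / r - 1 / s = h n / (r * s)" using rs by (simp add: field_simps)
        finally show ?thesis using rs by (simp add: l_def q1_def r_def s_def)
      qed
      have 5: "\<theta> (dq b (h n) x) = 0 \<and> \<theta>1 (dq b (h n) x) = 0" if "x \<in> ?A" "x \<notin> C" for x
      proof -
        have "(dq b (h n) x)\<^sup>2 \<le> \<delta>" using dqB[of x n] that by (auto simp: C_def)
        thus ?thesis using cut_zero[OF \<delta>, of "(dq b (h n) x)\<^sup>2"] by (simp add: \<theta>_def \<theta>1_def)
      qed
      show "set_integrable lborel ?A ?d" "(LINT x:?A|lborel. ?d x) = 0"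
        by (rule green_convex[OF e T S C CS 1 cdQ 2 3 4 cl d\<theta> d\<theta>1 c\<theta>2 5]; assumption)+
    qed
    have "0 = (LINT x:?A|lborel. - ?d x)" using gc(2) set_integral_uminus[OF gc(1)] by simp
    also have "\<dots> \<le> (LINT x:?A|lborel. ?f n x)"
    proof (rule set_integral_mono[OF _ i])
      show "set_integrable lborel ?A (\<lambda>x. - ?d x)" using gc(1) by (simp add: set_integrable_def)
      fix x assume "x \<in> ?A"
      have "0 \<le> wt a (fst x) * (ramp_at e (u x) * (\<theta>2 (dq b (h n) x) * (dQ b (h n) x \<bullet> dQ b (h n) x)))"
        using wt_nonneg ramp_at_nonneg[OF e] \<theta>2n by (intro mult_nonneg_nonneg) auto
      thus "- ?d x \<le> ?f n x" by (simp add: algebra_simps)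
    qed
    finally show "0 \<le> (LINT x:?A|lborel. ?f n x)" .
  qed
  obtain M where M: "\<And>n x. x \<in> ?A \<Longrightarrow> \<bar>?f n x\<bar> \<le> M" using bf by blast
  let ?g = "\<lambda>x. wt a (fst x) * (\<theta> (fst (Q x)) * ?F x - ramp_at e (u x) * (\<theta>1 (fst (Q x)) * (a * fst (Q x) / (fst x * fst x))))"
  have cA: "continuous_on ?A (\<lambda>x. \<theta> (dq b (h n) x))" "continuous_on ?A (\<lambda>x. \<theta>1 (dq b (h n) x))" for n
    by (rule continuous_on_compose2[OF c\<theta>(1)[of UNIV] cdq] continuous_on_compose2[OF c\<theta>(2)[of UNIV] cdq], simp)+
  have cf: "continuous_on ?A (?f n)" for n
    by (intro continuous_intros cw cA cl continuous_on_subset[OF U_cont(1) A(2)] continuous_on_subset[OF U_cont(2) A(2)]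
      continuous_on_subset[OF cut_cont(1)[OF e] A(2)] continuous_on_subset[OF cut_cont(2)[OF e] A(2)]
      continuous_on_subset[OF cut_cont(3)[OF e] A(2)])
  have lim: "(\<lambda>n. ?f n x) \<longlonglongrightarrow> ?g x" if x: "x \<in> ?A" for x
  proof -
    have x\<Omega>: "x \<in> \<Omega>" "fst x \<noteq> 0" using x A offp[of x 0] by auto
    have v: "(\<lambda>n. dq b (h n) x) \<longlonglongrightarrow> fst (Q x)" using dq_tendsto[OF x\<Omega>(1) hp(4) hl, of b] by (simp add: ib)
    have t: "(\<lambda>n. \<theta> (dq b (h n) x)) \<longlonglongrightarrow> \<theta> (fst (Q x))" "(\<lambda>n. \<theta>1 (dq b (h n) x)) \<longlonglongrightarrow> \<theta>1 (fst (Q x))"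
      using isCont_tendsto_compose[OF DERIV_isCont[OF d\<theta>] v] isCont_tendsto_compose[OF DERIV_isCont[OF d\<theta>1] v] by auto
    have "isCont Q x" using cQ x\<Omega> open_\<Omega> by (simp add: continuous_on_eq_continuous_at)
    moreover have "(\<lambda>n. x + h n *\<^sub>R b) \<longlonglongrightarrow> x + 0 *\<^sub>R b" by (intro tendsto_intros hl)
    ultimately have "(\<lambda>n. Q (x + h n *\<^sub>R b)) \<longlonglongrightarrow> Q x" by (intro isCont_tendsto_compose[of x Q]) auto
    hence "(\<lambda>n. l n x) \<longlonglongrightarrow> a * fst (Q x) / (fst x * (fst x + 0))"
      unfolding l_def using x\<Omega> by (intro tendsto_intros hl) auto
    thus ?thesis by (intro tendsto_intros t) simp
  qed
  have bor: "?A \<in> sets borel" using A by auto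
  note L = set_integral_bounded_limit[OF bor bA cf M lim]
  have "0 \<le> (LINT x:?A|lborel. ?g x)"
    by (rule LIMSEQ_le_const[OF L(1)]) (use nonneg in auto)
  also have "\<dots> \<le> (LINT x:?A|lborel. wt a (fst x) * (\<theta> (fst (Q x)) * ?F x))"
  proof (rule set_integral_mono[OF L(2)])
    have "set_integrable lborel (U e) (\<lambda>x. wt a (fst x) * (\<theta> (fst (Q x)) * ?F x))"
      by (rule level_integrable[OF e], intro continuous_intros cw U_cont cut_cont e
         continuous_on_compose2[OF c\<theta>(1)[of UNIV]]) (auto simp: off_K[OF e] intro!: continuous_intros U_cont)
    thus "set_integrable lborel ?A (\<lambda>x. wt a (fst x) * (\<theta> (fst (Q x)) * ?F x))"
      by (rule set_integrable_subset) (use A in auto)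
    fix x assume "x \<in> ?A"
    have "\<theta>1 (fst (Q x)) * (a * fst (Q x) / (fst x * fst x)) = 2 * step_at \<delta> ((fst (Q x))\<^sup>2) * (a * (fst (Q x))\<^sup>2 / (fst x)\<^sup>2)"
      by (simp add: \<theta>1_def power2_eq_square)
    also have "\<dots> \<ge> 0" using a_nonneg step_at_nonneg by simp
    finally have nn: "0 \<le> \<theta>1 (fst (Q x)) * (a * fst (Q x) / (fst x * fst x))" .
    have "0 \<le> wt a (fst x) * (ramp_at e (u x) * (\<theta>1 (fst (Q x)) * (a * fst (Q x) / (fst x * fst x))))"
      by (rule mult_nonneg_nonneg[OF wt_nonneg mult_nonneg_nonneg[OF ramp_at_nonneg[OF e] nn]])
    thus "?g x \<le> wt a (fst x) * (\<theta> (fst (Q x)) * ?F x)" by (simp add: right_diff_distrib)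
  qed
  also have "\<dots> = (LINT x:U e|lborel. wt a (fst x) * (\<theta> (fst (Q x)) * ?F x))"
    unfolding set_lebesgue_integral_def
  proof (rule arg_cong[where f="integral\<^sup>L lborel"], rule ext)
    fix x
    show "indicat_real ?A x *\<^sub>R (wt a (fst x) * (\<theta> (fst (Q x)) * ?F x)) = indicat_real (U e) x *\<^sub>R (wt a (fst x) * (\<theta> (fst (Q x)) * ?F x))"
    proof (cases "x \<in> U e \<and> x \<notin> S")
      case True
      hence "(fst (Q x))\<^sup>2 \<le> \<delta>" using \<rho> h0(4) by (intro \<rho>(2)) (auto simp: S_def)
      hence "\<theta> (fst (Q x)) = 0" using cut_zero[OF \<delta>] by (simp add: \<theta>_def)
      thus ?thesis by simp
    qed (auto simp: indicator_def)
  qed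
  finally show ?thesis by (simp add: \<theta>_def)
qed

lemma radial_inequality:
  assumes apos: "a > 0" and e: "e > 0"
  shows "0 \<le> (LINT x:U e|lborel. wt a (fst x) * ((fst (Q x))\<^sup>2 * (bump_at e (u x) * (G x \<bullet> G x) - step_at e (u x))))"
proof -
  let ?F = "\<lambda>x. bump_at e (u x) * (G x \<bullet> G x) - step_at e (u x)"
  define \<delta> where "\<delta> n = inverse (real (Suc n))" for n
  have \<delta>: "\<delta> n > 0" for n by (simp add: \<delta>_def)
  have cw: "continuous_on X (\<lambda>x::real \<times> 'b. wt a (fst x))" for X by (intro wt_cont a_nonneg continuous_intros)
  have cB: "continuous_on (K e) (\<lambda>x. wt a (fst x) * ((fst (Q x))\<^sup>2 * ?F x))"
    by (rule continuous_on_subset[OF _ K_sub_U[OF e]]) (intro continuous_intros cw U_cont cut_cont e)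
  obtain M where M: "M > 0" "\<And>x. x \<in> K e \<Longrightarrow> norm (wt a (fst x) * ((fst (Q x))\<^sup>2 * ?F x)) \<le> M"
    using compact_bounded_image[OF K_compact cB] by blast
  have "(\<lambda>n. LINT x:U e|lborel. wt a (fst x) * (ramp_at (\<delta> n) ((fst (Q x))\<^sup>2) * ?F x))
    \<longlonglongrightarrow> (LINT x:U e|lborel. wt a (fst x) * ((fst (Q x))\<^sup>2 * ?F x))"
  proof (rule set_integral_bounded_limit(1)[where M = M])
    show "U e \<in> sets borel" "bounded (U e)" using U_open bounded_subset[OF bounded_\<Omega> U_sub] by auto
    show "continuous_on (U e) (\<lambda>x. wt a (fst x) * (ramp_at (\<delta> n) ((fst (Q x))\<^sup>2) * ?F x))" for n
      by (intro continuous_intros cw cut_cont U_cont e continuous_on_compose2[OF ramp_at_cont[OF \<delta>, of UNIV]]) auto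
    fix x assume x: "x \<in> U e"
    show "\<bar>wt a (fst x) * (ramp_at (\<delta> n) ((fst (Q x))\<^sup>2) * ?F x)\<bar> \<le> M" for n
    proof (cases "x \<in> K e")
      case True
      have "\<bar>ramp_at (\<delta> n) ((fst (Q x))\<^sup>2)\<bar> * \<bar>wt a (fst x) * ?F x\<bar> \<le> (fst (Q x))\<^sup>2 * \<bar>wt a (fst x) * ?F x\<bar>"
        using ramp_at_nonneg[OF \<delta>] ramp_at_le[OF \<delta>] by (intro mult_right_mono) auto
      thus ?thesis using M(2)[OF True] by (simp add: abs_mult mult_ac)
    next
      case False
      thus ?thesis using off_K[OF e x] M(1) by simp
    qed
    have "(\<lambda>n. ramp_at (\<delta> n) ((fst (Q x))\<^sup>2)) \<longlonglongrightarrow> (fst (Q x))\<^sup>2"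
    proof (rule tendsto_sandwich)
      show "\<forall>\<^sub>F n in sequentially. (fst (Q x))\<^sup>2 - 2 * \<delta> n \<le> ramp_at (\<delta> n) ((fst (Q x))\<^sup>2)" using ramp_at_ge[OF \<delta>] by simp
      show "\<forall>\<^sub>F n in sequentially. ramp_at (\<delta> n) ((fst (Q x))\<^sup>2) \<le> (fst (Q x))\<^sup>2" using ramp_at_le[OF \<delta>] by simp
      have "(\<lambda>n. (fst (Q x))\<^sup>2 - 2 * \<delta> n) \<longlonglongrightarrow> (fst (Q x))\<^sup>2 - 2 * 0"
        unfolding \<delta>_def by (intro tendsto_intros LIMSEQ_inverse_real_of_nat)
      thus "(\<lambda>n. (fst (Q x))\<^sup>2 - 2 * \<delta> n) \<longlonglongrightarrow> (fst (Q x))\<^sup>2" by simp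
    qed simp
    thus "(\<lambda>n. wt a (fst x) * (ramp_at (\<delta> n) ((fst (Q x))\<^sup>2) * ?F x)) \<longlonglongrightarrow> wt a (fst x) * ((fst (Q x))\<^sup>2 * ?F x)"
      by (intro tendsto_intros)
  qed
  thus ?thesis by (rule LIMSEQ_le_const) (use radial_inequality_truncated[OF apos e \<delta>] in auto)
qed

end

section \<open>Vanishing of the Hessian and the shape of the domain\<close>

text \<open>Around each point, a point \<open>z\<close> off the hyperplane is joined to all others by segments that meet the
hyperplane at most once, so that continuity suffices there.\<close>

lemma constant_off_plane:
  fixes F :: "real \<times> 'b::euclidean_space \<Rightarrow> 'c::banach"
  assumes \<Omega>: "open \<Omega>" "connected \<Omega>" and c: "continuous_on \<Omega> F"
    and d: "\<And>x. x \<in> \<Omega> \<Longrightarrow> fst x \<noteq> 0 \<Longrightarrow> (F has_derivative (\<lambda>_. 0)) (at x)"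
    and xy: "x \<in> \<Omega>" "y \<in> \<Omega>"
  shows "F x = F y"
proof -
  have seg: "F y = F z" if B: "ball p r \<subseteq> \<Omega>" and z: "z \<in> ball p r" "fst z \<noteq> 0" and y: "y \<in> ball p r" for p r z y
  proof -
    define g where "g t = z + t *\<^sub>R (y - z)" for t
    define k where "k = {- fst z / (fst y - fst z)}"
    have g\<Omega>: "g t \<in> \<Omega>" if "t \<in> {0..1}" for t
    proof -
      have "g t = (1 - t) *\<^sub>R z + t *\<^sub>R y" by (simp add: g_def algebra_simps)
      hence "g t \<in> ball p r" using convexD_alt[OF convex_ball z(1) y, of t] that by simp
      thus ?thesis using B by blast
    qed
    have "F (g 1) = F (g 0)"
    proof (rule has_derivative_zero_unique_strong_interval[of k 0 1 "\<lambda>t. F (g t)" _ 1])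
      show "continuous_on {0..1} (\<lambda>t. F (g t))" unfolding g_def
        by (rule continuous_on_compose2[OF c], intro continuous_intros) (use g\<Omega> in \<open>auto simp: g_def\<close>)
      fix t :: real assume t: "t \<in> {0..1} - k"
      have "fst (g t) \<noteq> 0"
      proof
        assume "fst (g t) = 0"
        hence 0: "fst z + t * (fst y - fst z) = 0" by (simp add: g_def)
        hence "fst y - fst z \<noteq> 0" using z by auto
        hence "t = - fst z / (fst y - fst z)" using 0 by (simp add: field_simps)
        thus False using t by (simp add: k_def)
      qed
      moreover have "(g has_derivative (\<lambda>s. s *\<^sub>R (y - z))) (at t within {0..1})"
        unfolding g_def[abs_def] by (auto intro!: derivative_eq_intros)
      ultimately show "((\<lambda>t. F (g t)) has_derivative (\<lambda>h. 0)) (at t within {0..1})"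
        using has_derivative_compose[of g _ t "{0..1}" F "\<lambda>_. 0"] d[of "g t"] g\<Omega>[of t] t by auto
    qed (auto simp: k_def)
    thus ?thesis by (simp add: g_def)
  qed
  show ?thesis
  proof (rule connected_local_const[OF \<Omega>(2) xy], rule ballI)
    fix p assume p: "p \<in> \<Omega>"
    then obtain r where r: "r > 0" "ball p r \<subseteq> \<Omega>" using \<Omega>(1) open_contains_ball by blast
    obtain z where z: "z \<in> ball p r" "fst z \<noteq> 0" using exists_off_plane[of "ball p r" p 0] r by auto
    have "F p = F y" if "y \<in> ball p r" for y using seg[OF r(2) z, of p] seg[OF r(2) z that] r by simp
    thus "\<forall>\<^sub>F b in at p within \<Omega>. F p = F b"
      unfolding eventually_at using r by (intro exI[of _ r]) (auto simp: dist_commute)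
  qed
qed

context overdetermined
begin

lemma directional_nonneg:
  assumes e: "e > 0" and b: "b \<in> Basis"
  shows "0 \<le> (LINT x:U e|lborel. wt a (fst x) * ((Q x \<bullet> b)\<^sup>2 * (bump_at e (u x) * (G x \<bullet> G x) - step_at e (u x))))"
proof (cases "fst b = 0 \<or> a = 0")
  case True
  thus ?thesis using directional_inequality[OF e b True, of "{}"] by (simp add: set_lebesgue_integral_def)
next
  case False
  hence "b = (1, 0)" "a > 0" using b a_nonneg by (auto simp: Basis_prod_def)
  moreover have "Q x \<bullet> (1, 0) = fst (Q x)" for x by (simp add: inner_prod_def)
  ultimately show ?thesis using radial_inequality[OF _ e] by simp
qed

text \<open>The directional inequalities over an orthonormal basis add up to the quantity that tends to zero with
\<open>e\<close>, and each right-hand side is nonnegative. If \<open>HQ b\<close> were nonzero at a point, the left-hand side for \<open>b\<close>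
would stay above a positive constant.\<close>

lemma hessian_vanishes:
  assumes b: "b \<in> Basis" "fst b = 0 \<or> a = 0" and x1: "x1 \<in> \<Omega>" "fst x1 \<noteq> 0"
  shows "HQ x1 b = 0"
proof (rule ccontr)
  assume nz: "HQ x1 b \<noteq> 0"
  define V where "V = {x\<in>\<Omega>. fst x \<noteq> 0}"
  have oV: "open V" using open_Int[OF open_\<Omega> open_fst_notin[of "{0}"]] by (simp add: V_def Int_def)
  have V\<Omega>: "V \<subseteq> \<Omega>" by (auto simp: V_def)
  have cw: "continuous_on S (\<lambda>x::real \<times> 'b. wt a (fst x))" for S by (intro wt_cont a_nonneg continuous_intros)
  have cu: "continuous_on \<Omega> u" by (rule continuous_on_subset[OF u_cont closure_subset])
  define f0 where "f0 x = wt a (fst x) * (u x / 2 * (HQ x b \<bullet> HQ x b))" for x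
  have cf0: "continuous_on V f0" unfolding f0_def
    by (intro continuous_intros cw continuous_on_subset[OF cu V\<Omega>] continuous_on_subset[OF HQ_cont]) (auto simp: V_def)
  define \<kappa> where "\<kappa> = f0 x1 / 2"
  have "f0 x1 > 0" unfolding f0_def using u_pos[OF x1(1)] wt_pos[OF x1(2)] nz by (intro mult_pos_pos) auto
  hence \<kappa>: "\<kappa> > 0" "f0 x1 > \<kappa>" by (auto simp: \<kappa>_def)
  have "open {x\<in>V. f0 x > \<kappa>}" by (rule open_superlevel[OF oV cf0])
  moreover have "x1 \<in> {x\<in>V. f0 x > \<kappa>}" using x1 \<kappa> by (auto simp: V_def)
  ultimately obtain r where r: "r > 0" "cball x1 r \<subseteq> {x\<in>V. f0 x > \<kappa>}" using open_contains_cball by blast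
  define C where "C = cball x1 r"
  have C: "compact C" "C \<noteq> {}" "C \<subseteq> V" "C \<subseteq> \<Omega>" "\<And>x. x \<in> C \<Longrightarrow> f0 x > \<kappa>" using r V\<Omega> by (auto simp: C_def)
  obtain z where z: "z \<in> C" "\<And>y. y \<in> C \<Longrightarrow> u z \<le> u y"
    using continuous_attains_inf[OF C(1,2) continuous_on_subset[OF cu C(4)]] by blast
  have uz: "u z > 0" using z C(4) u_pos by blast
  define \<mu> where "\<mu> = measure lborel C"
  have \<mu>: "\<mu> > 0" unfolding \<mu>_def C_def using content_cball_pos[OF r(1)] by simp
  obtain e0 where e0: "e0 > 0" "\<And>e. 0 < e \<Longrightarrow> e \<le> e0 \<Longrightarrow>
    (LINT x:U e|lborel. wt a (fst x) * ((Q x \<bullet> Q x) * (bump_at e (u x) * (G x \<bullet> G x) - step_at e (u x)))) \<le> \<kappa> * \<mu>"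
    using total_small[of "\<kappa> * \<mu>"] \<kappa> \<mu> by auto
  define e where "e = min e0 (u z / 4)"
  have e: "e > 0" "e \<le> e0" "4 * e \<le> u z" using e0 uz by (auto simp: e_def)
  have CU: "C \<subseteq> U e" using z(2) C(4) e by (fastforce simp: U_def)
  let ?F = "\<lambda>x. bump_at e (u x) * (G x \<bullet> G x) - step_at e (u x)"
  let ?I = "\<lambda>b. LINT x:U e|lborel. wt a (fst x) * ((Q x \<bullet> b)\<^sup>2 * ?F x)"
  have int: "set_integrable lborel (U e) (\<lambda>x. wt a (fst x) * ((Q x \<bullet> b)\<^sup>2 * ?F x))" for b
    by (rule level_integrable[OF e(1)], intro continuous_intros cw U_cont cut_cont e(1), simp add: off_K[OF e(1)])
  have sum: "(\<Sum>b\<in>Basis. ?I b) = (LINT x:U e|lborel. wt a (fst x) * ((Q x \<bullet> Q x) * ?F x))"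
  proof -
    have "(\<Sum>b\<in>Basis. ?I b) = (LINT x|lborel. (\<Sum>b\<in>Basis. indicat_real (U e) x *\<^sub>R (wt a (fst x) * ((Q x \<bullet> b)\<^sup>2 * ?F x))))"
      unfolding set_lebesgue_integral_def using int
      by (subst Bochner_Integration.integral_sum) (auto simp: set_integrable_def)
    also have "(\<lambda>x. \<Sum>b\<in>Basis. indicat_real (U e) x *\<^sub>R (wt a (fst x) * ((Q x \<bullet> b)\<^sup>2 * ?F x)))
      = (\<lambda>x. indicat_real (U e) x *\<^sub>R (wt a (fst x) * ((Q x \<bullet> Q x) * ?F x)))"
    proof
      fix x
      have "Q x \<bullet> Q x = (\<Sum>b\<in>Basis. (Q x \<bullet> b)\<^sup>2)" by (subst euclidean_inner) (simp add: power2_eq_square)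
      thus "(\<Sum>b\<in>Basis. indicat_real (U e) x *\<^sub>R (wt a (fst x) * ((Q x \<bullet> b)\<^sup>2 * ?F x)))
        = indicat_real (U e) x *\<^sub>R (wt a (fst x) * ((Q x \<bullet> Q x) * ?F x))"
        by (simp only: real_scaleR_def sum_distrib_left[symmetric] sum_distrib_right[symmetric])
    qed
    finally show ?thesis by (simp add: set_lebesgue_integral_def)
  qed
  have "?I b \<le> (\<Sum>b\<in>Basis. ?I b)"
    by (rule member_le_sum[OF b(1)]) (use directional_nonneg[OF e(1)] in auto)
  also have "\<dots> \<le> \<kappa> * \<mu>" unfolding sum using e0(2)[OF e(1,2)] .
  finally have up: "?I b \<le> \<kappa> * \<mu>" .
  let ?A = "\<lambda>x. wt a (fst x) * (ramp_at e (u x) * (HQ x b \<bullet> HQ x b))"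
  have iA: "set_integrable lborel C ?A"
  proof -
    have cA: "continuous_on C ?A"
      by (intro continuous_intros cw continuous_on_subset[OF cut_cont(1)[OF e(1)] CU] continuous_on_subset[OF HQ_cont])
         (use C in \<open>auto simp: V_def\<close>)
    obtain M where "M > 0" "\<And>x. x \<in> C \<Longrightarrow> norm (?A x) \<le> M" using compact_bounded_image[OF C(1) cA] by blast
    thus ?thesis
      by (intro set_integrable_bounded_continuous[OF _ _ cA, of M]) (auto simp: C_def)
  qed
  have fin: "emeasure lborel C \<noteq> \<infinity>" "emeasure lborel C < \<infinity>"
    using emeasure_bounded_finite[of C] by (auto simp: C_def)
  have "\<kappa> * \<mu> = (LINT x:C|lborel. \<kappa>)"
    using fin by (subst set_integral_const) (auto simp: C_def \<mu>_def)
  also have "\<dots> \<le> (LINT x:C|lborel. ?A x)"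
  proof (rule set_integral_mono[OF _ iA])
    show "set_integrable lborel C (\<lambda>x. \<kappa>)" unfolding set_integrable_def using fin
      by (simp add: C_def)
    fix x assume x: "x \<in> C"
    have "u x / 2 \<le> ramp_at e (u x)" using ramp_at_ge[OF e(1), of "u x"] z(2)[OF x] e by linarith
    hence "f0 x \<le> ?A x" unfolding f0_def using wt_nonneg by (intro mult_left_mono mult_right_mono) auto
    thus "\<kappa> \<le> ?A x" using C(5)[OF x] by simp
  qed
  finally have "2 * (\<kappa> * \<mu>) \<le> 2 * (LINT x:C|lborel. ?A x)" by simp
  also have "\<dots> \<le> ?I b"
    by (rule directional_inequality[OF e(1) b C(1) CU]) (use C(3) in \<open>auto simp: V_def\<close>)
  also note up
  finally show False using \<kappa> \<mu> by (simp add: mult_pos_pos)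
qed

text \<open>For \<open>a = 0\<close> the whole Hessian of \<open>q\<close> vanishes. For \<open>a > 0\<close> its rows in the directions of \<open>y\<close> vanish,
which makes the \<open>y\<close>-component of \<open>Q\<close> constant and reduces the equation to \<open>\<partial>\<^sub>r (\<bar>r\<bar>\<^sup>a Q\<^sub>r) = 0\<close>; the
constant value of \<open>\<bar>r\<bar>\<^sup>a Q\<^sub>r\<close> is zero because the domain meets the hyperplane.\<close>

lemma Q_constant:
  assumes conn: "connected \<Omega>" and meets: "p0 \<in> \<Omega>" "fst p0 = 0" and x: "x \<in> \<Omega>"
  shows "Q x = Q p0"
proof (cases "a = 0")
  case True
  have cQ: "continuous_on \<Omega> Q" by (rule continuous_on_subset[OF Q_cont closure_subset])
  show ?thesis
  proof (rule constant_off_plane[OF open_\<Omega> conn cQ _ x meets(1)])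
    fix x assume x: "x \<in> \<Omega>" "fst x \<noteq> 0"
    have lin: "linear (HQ x)" using Q_deriv[OF x] has_derivative_linear by blast
    have "HQ x = (\<lambda>_. 0)"
      by (rule linear_eq_stdbasis[OF lin bounded_linear.linear[OF bounded_linear_zero]])
         (use hessian_vanishes True x in auto)
    thus "(Q has_derivative (\<lambda>_. 0)) (at x)" using Q_deriv[OF x] by simp
  qed
next
  case False
  hence apos: "a > 0" using a_nonneg by simp
  have cQ: "continuous_on \<Omega> Q" by (rule continuous_on_subset[OF Q_cont closure_subset])
  have Q0: "fst (Q x) = 0" if "x \<in> \<Omega>" "fst x = 0" for x
    using radial_derivative_zero[OF apos that] that by (simp add: Q_def)
  have b0: "HQ x (0, i) = 0" if "x \<in> \<Omega>" "fst x \<noteq> 0" "i \<in> Basis" for x i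
    using hessian_vanishes[of "(0, i)" x] that by (auto simp: Basis_prod_def)
  have s0: "snd (HQ x v) = 0" if x: "x \<in> \<Omega>" "fst x \<noteq> 0" for x v
  proof (rule euclidean_eqI)
    fix i :: 'b assume i: "i \<in> Basis"
    have "snd (HQ x v) \<bullet> i = HQ x v \<bullet> (0, i)" by (simp add: inner_prod_def)
    also have "\<dots> = v \<bullet> HQ x (0, i)" by (rule HQ_sym[OF x])
    finally show "snd (HQ x v) \<bullet> i = 0 \<bullet> i" using b0[OF x i] by simp
  qed
  have "snd (Q x) = snd (Q p0)"
  proof (rule constant_off_plane[OF open_\<Omega> conn _ _ x meets(1)])
    show "continuous_on \<Omega> (\<lambda>x. snd (Q x))" by (intro continuous_intros cQ)
    fix x assume x: "x \<in> \<Omega>" "fst x \<noteq> 0"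
    show "((\<lambda>x. snd (Q x)) has_derivative (\<lambda>_. 0)) (at x)"
      using has_derivative_snd[OF Q_deriv[OF x]] s0[OF x] by simp
  qed
  moreover have "fst (Q x) = fst (Q p0)"
  proof (cases "fst x = 0")
    case True
    thus ?thesis using Q0 x meets by simp
  next
    case F: False
    have "wt a (fst x) * fst (Q x) = wt a (fst p0) * fst (Q p0)"
    proof (rule constant_off_plane[OF open_\<Omega> conn _ _ x meets(1)])
      show "continuous_on \<Omega> (\<lambda>x. wt a (fst x) * fst (Q x))" by (intro continuous_intros cQ wt_cont a_nonneg)
      fix x assume x: "x \<in> \<Omega>" "fst x \<noteq> 0"
      have lin: "linear (HQ x)" using Q_deriv[OF x] has_derivative_linear by blast
      have dw: "((\<lambda>x. wt a (fst x)) has_derivative (\<lambda>v. a / fst x * wt a (fst x) * fst v)) (at x)"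
      proof -
        have "(wt a has_derivative (*) (a / fst x * wt a (fst x))) (at (fst x))"
          using wt_deriv[OF x(2), of a] unfolding has_field_derivative_def by simp
        with bounded_linear_imp_has_derivative[OF bounded_linear_fst] show ?thesis by (rule has_derivative_compose)
      qed
      have t: "tr (HQ x) = fst (HQ x (1, 0))"
      proof -
        have "tr (HQ x) = HQ x (1, 0) \<bullet> (1, 0)"
          unfolding tr_def Basis_prod_def using b0[OF x]
          by (subst sum.union_disjoint) (auto simp: sum.reindex inj_on_def)
        thus ?thesis by (simp add: inner_prod_def)
      qed
      have f: "fst (HQ x v) = - (a / fst x * fst (Q x)) * fst v" for v
      proof -
        have "fst (HQ x v) = HQ x v \<bullet> (1, 0)" by (simp add: inner_prod_def)
        also have "\<dots> = v \<bullet> HQ x (1, 0)" by (rule HQ_sym[OF x])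
        also have "\<dots> = fst v * fst (HQ x (1, 0))" using s0[OF x] by (simp add: inner_prod_def)
        also have "fst (HQ x (1, 0)) = - (a / fst x * fst (Q x))" using Q_pde[OF x] unfolding t by linarith
        finally show ?thesis by simp
      qed
      from has_derivative_mult[OF dw has_derivative_fst[OF Q_deriv[OF x]]]
      have "((\<lambda>x. wt a (fst x) * fst (Q x)) has_derivative
         (\<lambda>v. wt a (fst x) * fst (HQ x v) + a / fst x * wt a (fst x) * fst v * fst (Q x))) (at x)" .
      moreover have "(\<lambda>v. wt a (fst x) * fst (HQ x v) + a / fst x * wt a (fst x) * fst v * fst (Q x)) = (\<lambda>_. 0)"
        unfolding f by (simp add: fun_eq_iff algebra_simps)
      ultimately show "((\<lambda>x. wt a (fst x) * fst (Q x)) has_derivative (\<lambda>_. 0)) (at x)" by simp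
    qed
    thus ?thesis using wt_pos[OF F, of a] Q0[OF meets] by simp
  qed
  ultimately show ?thesis by (simp add: prod_eq_iff)
qed

text \<open>Since \<open>q\<close> is affine, \<open>u\<close> is a quadratic polynomial whose positivity set is a ball around \<open>z\<close>. It contains
\<open>\<Omega>\<close>, and no boundary point of \<open>\<Omega>\<close> lies in it, because \<open>u = 0\<close> there. Being connected, the ball equals \<open>\<Omega>\<close>.\<close>

lemma domain_is_ball:
  assumes conn: "connected \<Omega>" and meets: "p0 \<in> \<Omega>" "fst p0 = 0"
  obtains z R where "R > 0" "\<Omega> = ball z R" "\<And>x. x \<in> closure \<Omega> \<Longrightarrow> u x = (R\<^sup>2 - (x - z) \<bullet> (x - z)) / (2 * N)"
proof -
  define p where "p = Q p0"
  define z where "z = N *\<^sub>R p"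
  have Qp: "Q x = p" if "x \<in> \<Omega>" for x using Q_constant[OF conn meets that] by (simp add: p_def)
  define k where "k = q p0 - p \<bullet> p0"
  have qx: "q x - p \<bullet> x = k" if x: "x \<in> \<Omega>" for x
    unfolding k_def
  proof (rule constant_off_plane[OF open_\<Omega> conn _ _ x meets(1)])
    show "continuous_on \<Omega> (\<lambda>x. q x - p \<bullet> x)"
      unfolding q_def by (intro continuous_intros continuous_on_subset[OF u_cont closure_subset])
    fix x assume x: "x \<in> \<Omega>" "fst x \<noteq> 0"
    have "((\<lambda>x. q x - p \<bullet> x) has_derivative (\<lambda>h. h \<bullet> Q x - p \<bullet> h)) (at x)"
      using q_grad[OF x(1)] unfolding gderiv_def by (auto intro!: derivative_eq_intros)
    thus "((\<lambda>x. q x - p \<bullet> x) has_derivative (\<lambda>_. 0)) (at x)" using Qp[OF x(1)] by (simp add: inner_commute)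
  qed
  define R2 where "R2 = 2 * N * k + z \<bullet> z"
  have u\<Omega>: "u x = (R2 - (x - z) \<bullet> (x - z)) / (2 * N)" if "x \<in> \<Omega>" for x
  proof -
    have "u x = k + p \<bullet> x - (1 / (2 * N)) * (x \<bullet> x)" using qx[OF that] by (simp add: q_def)
    moreover have "p \<bullet> x = (2 * (z \<bullet> x)) / (2 * N)" using N_pos by (simp add: z_def)
    moreover have "R2 - (x - z) \<bullet> (x - z) = 2 * N * k + 2 * (z \<bullet> x) - x \<bullet> x"
      by (simp add: R2_def inner_diff_left inner_diff_right inner_commute)
    ultimately show ?thesis using N_pos by (simp add: add_divide_distrib diff_divide_distrib)
  qed
  have ucl: "u x = (R2 - (x - z) \<bullet> (x - z)) / (2 * N)" if "x \<in> closure \<Omega>" for x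
  proof -
    have "u x - (R2 - (x - z) \<bullet> (x - z)) / (2 * N) = 0"
    proof (rule continuous_constant_on_closure[OF _ _ that])
      show "continuous_on (closure \<Omega>) (\<lambda>x. u x - (R2 - (x - z) \<bullet> (x - z)) / (2 * N))"
        using N_pos by (intro continuous_intros u_cont) auto
    qed (simp add: u\<Omega>)
    thus ?thesis by simp
  qed
  have lt: "(x - z) \<bullet> (x - z) < R2" if "x \<in> \<Omega>" for x
    using u_pos[OF that] u\<Omega>[OF that] N_pos by (simp add: zero_less_divide_iff)
  have R2: "R2 > 0" using lt[OF meets(1)] inner_ge_zero[of "p0 - z"] by linarith
  define R where "R = sqrt R2"
  have R: "R > 0" "R\<^sup>2 = R2" using R2 by (auto simp: R_def)
  have dR: "dist z x < R \<longleftrightarrow> (x - z) \<bullet> (x - z) < R2" for x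
  proof -
    have "(x - z) \<bullet> (x - z) = (dist z x)\<^sup>2" by (simp add: power2_norm_eq_inner[symmetric] dist_norm norm_minus_commute)
    moreover have "dist z x < R \<longleftrightarrow> (dist z x)\<^sup>2 < R\<^sup>2"
      using abs_le_square_iff[of R "dist z x"] R(1) by (simp add: not_le[symmetric])
    ultimately show ?thesis using R(2) by simp
  qed
  have sub: "\<Omega> \<subseteq> ball z R" using lt dR by auto
  have "ball z R \<inter> frontier \<Omega> = {}"
  proof (rule ccontr)
    assume "ball z R \<inter> frontier \<Omega> \<noteq> {}"
    then obtain x where x: "x \<in> ball z R" "x \<in> frontier \<Omega>" by blast
    have "u x = 0" by (rule u_bdry[OF x(2)])
    moreover have "x \<in> closure \<Omega>" using x(2) by (simp add: frontier_def)
    ultimately have "(x - z) \<bullet> (x - z) = R2" using ucl[of x] N_pos by simp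
    thus False using x(1) dR[of x] by simp
  qed
  moreover have "ball z R \<inter> \<Omega> \<noteq> {}" using sub meets by auto
  ultimately have "ball z R - \<Omega> = {}" using connected_Int_frontier[of "ball z R" \<Omega>] connected_ball by blast
  hence "\<Omega> = ball z R" using sub by blast
  moreover have "u x = (R\<^sup>2 - (x - z) \<bullet> (x - z)) / (2 * N)" if "x \<in> closure \<Omega>" for x
    using ucl[OF that] R by simp
  ultimately show thesis using that[of R z] R by blast
qed

end

section \<open>The Weinstein operator and the theorem\<close>

lemma dir_deriv_grad:
  assumes "GDERIV u x :> g" shows "dir_deriv v u x = v \<bullet> g"
proof -
  have "((\<lambda>t. x + t *\<^sub>R v) has_derivative (\<lambda>t. t *\<^sub>R v)) (at 0)" by (auto intro!: derivative_eq_intros)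
  from has_derivative_compose[OF this, of u "\<lambda>h. h \<bullet> g"] assms
  have "((\<lambda>t. u (x + t *\<^sub>R v)) has_real_derivative (v \<bullet> g)) (at 0)"
    by (simp add: gderiv_def has_field_derivative_def mult_commute_abs)
  thus ?thesis unfolding dir_deriv_def by (rule DERIV_imp_deriv)
qed

lemma dir_deriv_hessian:
  assumes V: "open V" "x \<in> V" and G: "\<And>y. y \<in> V \<Longrightarrow> GDERIV u y :> G y" and A: "(G has_derivative A) (at x)"
  shows "dir_deriv v (dir_deriv v u) x = A v \<bullet> v"
proof -
  have "((\<lambda>y. v \<bullet> G y) has_derivative (\<lambda>h. v \<bullet> A h)) (at x)" using A by (rule has_derivative_inner_right)
  hence d: "(dir_deriv v u has_derivative (\<lambda>h. v \<bullet> A h)) (at x)"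
    by (rule has_derivative_transform_within_open[OF _ V]) (simp add: dir_deriv_grad[OF G])
  have lin: "linear A" using A has_derivative_linear by blast
  have "((\<lambda>t. x + t *\<^sub>R v) has_derivative (\<lambda>t. t *\<^sub>R v)) (at 0)" by (auto intro!: derivative_eq_intros)
  from has_derivative_compose[OF this, of "dir_deriv v u" "\<lambda>h. v \<bullet> A h"] d
  have "((\<lambda>t. dir_deriv v u (x + t *\<^sub>R v)) has_real_derivative (v \<bullet> A v)) (at 0)"
    by (simp add: has_field_derivative_def linear_cmul[OF lin] mult_commute_abs)
  hence "dir_deriv v (dir_deriv v u) x = v \<bullet> A v" unfolding dir_deriv_def[of v "dir_deriv v u"] by (rule DERIV_imp_deriv)
  thus ?thesis by (simp add: inner_commute)
qed

lemma tr_prod_vec: "tr A = A (1, 0) \<bullet> (1, 0) + (\<Sum>i\<in>UNIV. A (0, axis i 1) \<bullet> (0, axis i (1::real)))"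
  for A :: "real \<times> (real^'k) \<Rightarrow> real \<times> (real^'k)"
proof -
  have B: "(Basis :: (real^'k) set) = range (\<lambda>i. axis i 1)" by (auto simp: Basis_vec_def)
  have inj: "inj (\<lambda>i::'k. axis i (1::real))" by (auto simp: inj_def axis_eq_axis)
  have "tr A = (\<Sum>b\<in>(\<lambda>u. (u, 0)) ` Basis. A b \<bullet> b) + (\<Sum>b\<in>(\<lambda>v. (0, v)) ` Basis. A b \<bullet> b)"
    unfolding tr_def Basis_prod_def by (rule sum.union_disjoint) auto
  also have "(\<Sum>b\<in>(\<lambda>u. (u, 0)) ` Basis. A b \<bullet> b) = A (1, 0) \<bullet> (1, 0)" by simp
  also have "(\<Sum>b\<in>(\<lambda>v. (0, v)) ` Basis. A b \<bullet> b) = (\<Sum>v\<in>Basis. A (0, v) \<bullet> (0, v))"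
    by (subst sum.reindex) (auto simp: inj_on_def)
  also have "\<dots> = (\<Sum>i\<in>UNIV. A (0, axis i 1) \<bullet> (0, axis i (1::real)))"
    unfolding B by (subst sum.reindex[OF inj]) simp
  finally show ?thesis .
qed

lemma weinstein_eq:
  assumes V: "open V" "x \<in> V" and G: "\<And>y. y \<in> V \<Longrightarrow> GDERIV u y :> G y" and A: "(G has_derivative A) (at x)"
  shows "weinstein a u x = tr A + a / fst x * fst (G x)"
proof -
  have "(1, 0) \<bullet> G x = fst (G x)" by (simp add: inner_prod_def)
  moreover have "dir_deriv v (dir_deriv v u) x = A v \<bullet> v" for v by (rule dir_deriv_hessian[OF V G A])
  ultimately show ?thesis
    unfolding weinstein_def tr_prod_vec by (simp add: dir_deriv_grad[OF G[OF V(2)]])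
qed

lemma gderiv_unique: "GDERIV f x :> g \<Longrightarrow> GDERIV f x :> g' \<Longrightarrow> g = g'"
  unfolding gderiv_def using has_derivative_unique[of f "\<lambda>h. h \<bullet> g" x "\<lambda>h. h \<bullet> g'"]
  by (metis inner_commute vector_eq_ldot)

theorem theorem1p1:
  fixes a :: real
    and \<Omega> :: "(real \<times> (real^'k)) set"
    and u :: "real \<times> (real^'k) \<Rightarrow> real"
  assumes "a \<ge> 0"
    and "bounded \<Omega>" and "connected \<Omega>" and "open \<Omega>" and "\<Omega> \<noteq> {}"
    and "\<And>r y. (r, y) \<in> \<Omega> \<longleftrightarrow> (- r, y) \<in> \<Omega>"
    and "piecewise_C1_boundary \<Omega>"
  shows "(C2_on (\<Omega> - {x. fst x = 0}) u \<and>
          (\<exists>Du. C1_closure_grad \<Omega> u Du \<and>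
            (\<forall>x \<in> \<Omega> - {x. fst x = 0}. weinstein a u x = -1) \<and>
            (\<forall>x \<in> frontier \<Omega>. u x = 0) \<and>
            (\<exists>c. \<forall>x \<in> frontier \<Omega>. norm (Du x) = c)))
     \<longleftrightarrow>
         (\<exists>R>0. \<exists>y0. \<Omega> = ball (0, y0) R \<and>
            (\<forall>(r, y) \<in> closure \<Omega>.
               u (r, y) = (R\<^sup>2 - r\<^sup>2 - (norm (y - y0))\<^sup>2) / (2 * (a + 1 + real CARD('k)))))"
    (is "?solvable \<longleftrightarrow> ?ball")
proof
  note sym = assms(6)
  assume ?solvable
  then obtain Du c where C2: "C2_on (\<Omega> - {x. fst x = 0}) u" and C1: "C1_closure_grad \<Omega> u Du"
    and pde: "\<And>x. x \<in> \<Omega> - {x. fst x = 0} \<Longrightarrow> weinstein a u x = -1"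
    and ub: "\<And>x. x \<in> frontier \<Omega> \<Longrightarrow> u x = 0" and gb: "\<And>x. x \<in> frontier \<Omega> \<Longrightarrow> norm (Du x) = c" by blast
  define V where "V = \<Omega> - {x. fst x = 0}"
  have V: "V = {x\<in>\<Omega>. fst x \<noteq> 0}" by (auto simp: V_def)
  have oV: "open V" unfolding V using open_Int[OF assms(4) open_fst_notin[of "{0}"]] by (simp add: Int_def)
  obtain G0 and A :: "real \<times> (real^'k) \<Rightarrow> (real \<times> (real^'k)) \<Rightarrow>\<^sub>L (real \<times> (real^'k))"
    where G0: "C1_grad_on V u G0" "\<And>x. x \<in> V \<Longrightarrow> (G0 has_derivative blinfun_apply (A x)) (at x)" "continuous_on V A"
    using C2 unfolding C2_on_def V_def by blast
  have Du: "continuous_on (closure \<Omega>) u" "continuous_on (closure \<Omega>) Du" "\<And>x. x \<in> \<Omega> \<Longrightarrow> GDERIV u x :> Du x"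
    using C1 unfolding C1_closure_grad_def by auto
  have eq: "G0 x = Du x" if "x \<in> V" for x
    using gderiv_unique[of u x "G0 x" "Du x"] G0(1) Du(3)[of x] that unfolding C1_grad_on_def V_def by blast
  have dD: "(Du has_derivative blinfun_apply (A x)) (at x)" if "x \<in> V" for x
    by (rule has_derivative_transform_within_open[OF G0(2)[OF that] oV that]) (simp add: eq)
  interpret S: overdetermined a c \<Omega> u Du "\<lambda>x. blinfun_apply (A x)"
  proof
    show "(Du has_derivative blinfun_apply (A x)) (at x)" if "x \<in> \<Omega>" "fst x \<noteq> 0" for x
      using dD[of x] that by (simp add: V)
    show "continuous_on {x \<in> \<Omega>. fst x \<noteq> 0} (\<lambda>x. blinfun_apply (A x) v)" for v
      using G0(3) unfolding V by (intro continuous_intros)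
    show "tr (blinfun_apply (A x)) + a / fst x * fst (Du x) = - 1" if x: "x \<in> \<Omega>" "fst x \<noteq> 0" for x
    proof -
      have xV: "x \<in> V" using x by (simp add: V)
      have "weinstein a u x = tr (blinfun_apply (A x)) + a / fst x * fst (Du x)"
        by (rule weinstein_eq[OF oV xV Du(3) dD[OF xV]]) (simp add: V)
      thus ?thesis using pde[of x] xV by (simp add: V_def)
    qed
  qed (use assms Du ub gb in auto)
  \<comment> \<open>A connected symmetric domain meets the hyperplane.\<close>
  obtain p where p: "p \<in> \<Omega>" "fst p = 0"
  proof -
    obtain x where x: "x \<in> \<Omega>" using assms(5) by blast
    have x': "(- fst x, snd x) \<in> \<Omega>" using sym[of "fst x" "snd x"] x by simp
    have "connected (fst ` \<Omega>)" by (intro connected_continuous_image assms(3) continuous_intros)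
    hence "0 \<in> fst ` \<Omega>"
      using connectedD_interval[of "fst ` \<Omega>" "- \<bar>fst x\<bar>" "\<bar>fst x\<bar>" 0] imageI[OF x, of fst] imageI[OF x', of fst]
      by (cases "fst x \<ge> 0") auto
    thus thesis using that by auto
  qed
  obtain z R where zR: "R > 0" "\<Omega> = ball z R" "\<And>x. x \<in> closure \<Omega> \<Longrightarrow> u x = (R\<^sup>2 - (x - z) \<bullet> (x - z)) / (2 * S.N)"
    using S.domain_is_ball[OF assms(3) p] by blast
  have z0: "fst z = 0"
  proof (rule ccontr)
    assume nz: "fst z \<noteq> 0"
    \<comment> \<open>The reflection of the point at distance \<open>s\<close> from \<open>z\<close>, on the side away from the hyperplane,
      has distance \<open>2 \<bar>fst z\<bar> + s \<ge> R\<close> from \<open>z\<close>.\<close>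
    define s where "s = max 0 (R - \<bar>fst z\<bar>)"
    have s: "0 \<le> s" "s < R" using nz zR(1) by (auto simp: s_def)
    define r where "r = fst z + s * sgn (fst z)"
    have "dist z (r, snd z) = s" using s nz
      by (simp add: r_def dist_prod_def dist_real_def abs_mult)
    hence "(r, snd z) \<in> \<Omega>" using zR(2) s by simp
    hence "(- r, snd z) \<in> \<Omega>" using sym by blast
    hence "dist z (- r, snd z) < R" using zR(2) by simp
    moreover have "dist z (- r, snd z) = \<bar>fst z + r\<bar>" by (simp add: dist_prod_def dist_real_def)
    moreover have "\<bar>fst z + r\<bar> = 2 * \<bar>fst z\<bar> + s" using s nz by (cases "fst z" "0::real" rule: linorder_cases) (auto simp: r_def)
    ultimately show False using nz by (auto simp: s_def max_def split: if_splits)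
  qed
  have "u (r, y) = (R\<^sup>2 - r\<^sup>2 - (norm (y - snd z))\<^sup>2) / (2 * (a + 1 + real CARD('k)))" if "(r, y) \<in> closure \<Omega>" for r y
    using zR(3)[OF that] z0 unfolding S.N_def
    by (simp add: inner_prod_def power2_norm_eq_inner power2_eq_square[of r] diff_diff_eq)
  moreover have "z = (0, snd z)" using z0 by (simp add: prod_eq_iff)
  ultimately show ?ball using zR(1,2) by (intro exI[of _ R] exI[of _ "snd z"] conjI) auto
next
  assume ?ball
  then obtain R y0 where R: "R > 0" and ball: "\<Omega> = ball (0, y0) R"
    and u: "\<And>r y. (r, y) \<in> closure \<Omega> \<Longrightarrow> u (r, y) = (R\<^sup>2 - r\<^sup>2 - (norm (y - y0))\<^sup>2) / (2 * (a + 1 + real CARD('k)))" by blast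
  define z where "z = (0::real, y0)"
  define N where "N = a + 1 + real CARD('k)"
  have N: "N > 0" using assms(1) by (simp add: N_def add_nonneg_pos)
  have ball': "\<Omega> = ball z R" by (simp add: ball z_def)
  have fr: "frontier \<Omega> = sphere z R" using R by (simp add: ball' frontier_ball)
  define v where "v x = (R\<^sup>2 - (x - z) \<bullet> (x - z)) / (2 * N)" for x
  define Dv where "Dv x = (- 1 / N) *\<^sub>R (x - z)" for x
  have uv: "u x = v x" if "x \<in> closure \<Omega>" for x
  proof -
    obtain r y where x: "x = (r, y)" by (cases x)
    show ?thesis using u[of r y] that unfolding x v_def N_def z_def
      by (simp add: inner_prod_def power2_norm_eq_inner power2_eq_square[of r] diff_diff_eq)
  qed
  have dv: "GDERIV v x :> Dv x" for x
  proof -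
    have d: "((\<lambda>x. x - z) has_derivative (\<lambda>h. h)) (at x)" by (auto intro!: derivative_eq_intros)
    have "((\<lambda>x. (1 / (2 * N)) * (R\<^sup>2 - (x - z) \<bullet> (x - z))) has_derivative
       (\<lambda>h. (1 / (2 * N)) * (0 - ((x - z) \<bullet> h + h \<bullet> (x - z))))) (at x)"
      by (intro has_derivative_mult_right has_derivative_diff has_derivative_const has_derivative_inner d)
    moreover have "(\<lambda>h. (1 / (2 * N)) * (0 - ((x - z) \<bullet> h + h \<bullet> (x - z)))) = (\<lambda>h. h \<bullet> Dv x)"
    proof
      fix h
      have "(1 / (2 * N)) * (0 - (t + t)) = (- 1 / N) * t" for t by simp
      thus "(1 / (2 * N)) * (0 - ((x - z) \<bullet> h + h \<bullet> (x - z))) = h \<bullet> Dv x"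
        by (simp only: Dv_def inner_scaleR_right inner_commute[of "x - z" h])
    qed
    ultimately show ?thesis by (simp add: gderiv_def v_def[abs_def])
  qed
  have du: "GDERIV u x :> Dv x" if "x \<in> \<Omega>" for x
    unfolding gderiv_def
    by (rule has_derivative_transform_within_open[OF dv[unfolded gderiv_def] assms(4) that])
       (simp add: uv subsetD[OF closure_subset])
  define A where "A = (- 1 / N) *\<^sub>R (id_blinfun :: (real \<times> (real^'k)) \<Rightarrow>\<^sub>L (real \<times> (real^'k)))"
  have A: "blinfun_apply A = (\<lambda>h. (- 1 / N) *\<^sub>R h)" by (simp only: A_def scaleR_blinfun.rep_eq id_blinfun.rep_eq)
  have dA: "(Dv has_derivative blinfun_apply A) (at x)" for x
    unfolding A Dv_def[abs_def] by (auto intro!: derivative_eq_intros)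
  have cDv: "continuous_on S Dv" for S unfolding Dv_def by (intro continuous_intros)
  show ?solvable
  proof (intro conjI exI[of _ Dv])
    show "C2_on (\<Omega> - {x. fst x = 0}) u"
      unfolding C2_on_def C1_grad_on_def
      by (intro exI[of _ Dv] exI[of _ "\<lambda>_. A"] conjI ballI cDv dA continuous_on_const du) auto
    show "C1_closure_grad \<Omega> u Dv"
    proof -
      have "continuous_on (closure \<Omega>) v" unfolding v_def using N by (intro continuous_intros) auto
      hence "continuous_on (closure \<Omega>) u" by (rule continuous_on_eq) (simp add: uv)
      thus ?thesis unfolding C1_closure_grad_def using du cDv by blast
    qed
    show "\<forall>x\<in>\<Omega> - {x. fst x = 0}. weinstein a u x = - 1"
    proof
      fix x assume x: "x \<in> \<Omega> - {x. fst x = 0}"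
      have x\<Omega>: "x \<in> \<Omega>" "fst x \<noteq> 0" using x by auto
      have "weinstein a u x = tr (blinfun_apply A) + a / fst x * fst (Dv x)"
        by (rule weinstein_eq[OF assms(4) x\<Omega>(1) du dA])
      also have "tr (blinfun_apply A) = (- 1 / N) * real DIM(real \<times> (real^'k))" unfolding A tr_scaleR tr_ident ..
      also have "a / fst x * fst (Dv x) = (- 1 / N) * a" using x\<Omega> by (simp add: Dv_def z_def)
      also have "(- 1 / N) * real DIM(real \<times> (real^'k)) + (- 1 / N) * a = (- 1 / N) * N"
        by (simp only: distrib_left[symmetric]) (simp add: N_def)
      also have "\<dots> = - 1" using N by simp
      finally show "weinstein a u x = - 1" .
    qed
    show "\<forall>x\<in>frontier \<Omega>. u x = 0"
    proof
      fix x assume x: "x \<in> frontier \<Omega>"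
      hence "norm (x - z) = R" by (simp add: fr dist_norm norm_minus_commute)
      hence "v x = 0" by (simp add: v_def power2_norm_eq_inner[symmetric])
      thus "u x = 0" using uv[of x] x by (simp add: frontier_def)
    qed
    have "norm (Dv x) = R / N" if "x \<in> frontier \<Omega>" for x
    proof -
      have "norm (x - z) = R" using that by (simp add: fr dist_norm norm_minus_commute)
      thus ?thesis using N by (simp add: Dv_def)
    qed
    thus "\<exists>c. \<forall>x\<in>frontier \<Omega>. norm (Dv x) = c" by blast
  qed
qed

end
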